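(* Let $X$ be a countable CW-complex and $\gamma:\coprod S^1\rightarrow X$ a map from a finite disjoint union of circles. For every real class $\alpha\in H_2(X,\gamma;\mathbb{R})$, \[ \|\alpha\|_1=\sup\left\{\frac{\langle u,\alpha\rangle}{\|u\|_\infty}\;\middle|\; u\in H^2_b(X;\mathbb{R})\smallsetminus\{0\}\right\}. \]
   Context: $X_\gamma$ is the mapping cylinder $(X\sqcup(\coprod S^1\times[0,1]))/((u,0)\sim\gamma(u))$, with $\coprod S^1$ identified with $\coprod S^1\times\{1\}$, and $H_*(X,\gamma;\mathbb{R}):=H_*(X_\gamma,\coprod S^1;\mathbb{R})$ (singular homology). The relative Gromov seminorm $\|\alpha\|_1$ is the infimum of $\|a\|_1$ over relative singular cycles $a$ representing $\alpha$, where $\|\sum_\sigma\lambda_\sigma\sigma\|_1=\sum_\sigma|\lambda_\sigma|$ and relative chains carry the quotient seminorm. $H^*_b$ denotes bounded cohomology with real coefficients (cohomology of singular cochains bounded on singular simplices), with the $\ell^\infty$-seminorm $\|u\|_\infty=\inf$ of $\sup|\psi(\sigma)|$ over bounded cocycles $\psi$ representing $u$. Since $H^*_b(\coprod S^1;\mathbb{R})=0$, the long exact sequence of the pair gives an isomorphism $H^2_b(X_\gamma,\coprod S^1;\mathbb{R})\cong H^2_b(X_\gamma;\mathbb{R})\cong H^2_b(X;\mathbb{R})$; the pairing $\langle\cdot,\cdot\rangle:H^2_b(X;\mathbb{R})\times H_2(X,\gamma;\mathbb{R})\to\mathbb{R}$ is the Kronecker product of relative bounded cohomology with relative homology, transported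 through this isomorphism. *)

theory Defs
  imports "HOL-Analysis.Analysis" "HOL-Homology.Homology"
begin

text \<open>Closed ball, open ball and sphere of radius 1 in the subspace of nat => real
 used by HOL-Analysis' Euclidean_space n (coordinates >= n are zero).\<close>

definition cballE :: "nat \<Rightarrow> (nat \<Rightarrow> real) set" where
  "cballE n = {x. (\<forall>i\<ge>n. x i = 0) \<and> (\<Sum>i<n. (x i)^2) \<le> 1}"
definition ballE :: "nat \<Rightarrow> (nat \<Rightarrow> real) set" where
  "ballE n = {x. (\<forall>i\<ge>n. x i = 0) \<and> (\<Sum>i<n. (x i)^2) < 1}"
definition sphereE :: "nat \<Rightarrow> (nat \<Rightarrow> real) set" where
  "sphereE n = {x. (\<forall>i\<ge>n. x i = 0) \<and> (\<Sum>i<n. (x i)^2) = 1}"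

definition countable_cw_complex :: "'a topology \<Rightarrow> bool" where
  "countable_cw_complex X \<longleftrightarrow> Hausdorff_space X \<and>
    (\<exists>(I::nat set) (n::nat \<Rightarrow> nat) (\<Phi>::nat \<Rightarrow> (nat \<Rightarrow> real) \<Rightarrow> 'a).
      (\<forall>i\<in>I. continuous_map (subtopology (Euclidean_space (n i)) (cballE (n i))) X (\<Phi> i)) \<and>
      (\<forall>i\<in>I. homeomorphic_map (subtopology (Euclidean_space (n i)) (ballE (n i)))
                 (subtopology X (\<Phi> i ` ballE (n i))) (\<Phi> i)) \<and>
      (\<forall>i\<in>I. \<forall>j\<in>I. i \<noteq> j \<longrightarrow> \<Phi> i ` ballE (n i) \<inter> \<Phi> j ` ballE (n j) = {}) \<and>
      (\<Union>i\<in>I. \<Phi> i ` ballE (n i)) = topspace X \<and>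
      (\<forall>i\<in>I. \<exists>J\<subseteq>I. finite J \<and> (\<forall>j\<in>J. n j < n i) \<and>
                 \<Phi> i ` sphereE (n i) \<subseteq> (\<Union>j\<in>J. \<Phi> j ` ballE (n j))) \<and>
      (\<forall>C. C \<subseteq> topspace X \<longrightarrow>
          (closedin X C \<longleftrightarrow>
            (\<forall>i\<in>I. closedin (subtopology (Euclidean_space (n i)) (cballE (n i)))
                              {x \<in> cballE (n i). \<Phi> i x \<in> C}))))"

definition circles :: "nat \<Rightarrow> (nat \<times> (nat \<Rightarrow> real)) topology" where
  "circles k = sum_topology (\<lambda>i. nsphere 1) {..<k}"

definition cyl_proj :: "(nat \<times> (nat \<Rightarrow> real) \<Rightarrow> 'a) \<Rightarrow> (nat \<times> (nat \<Rightarrow> real)) \<times> real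
      \<Rightarrow> 'a + (nat \<times> (nat \<Rightarrow> real)) \<times> real" where
  "cyl_proj \<gamma> = (\<lambda>(u,t). if t = 0 then Inl (\<gamma> u) else Inr (u,t))"

text \<open>X_gamma = (X + (circles x [0,1])) / ((u,0) ~ gamma u), with quotient topology;
 a point (u,t), t>0, is represented by Inr (u,t), and points of X by Inl.\<close>

definition mapping_cylinder :: "'a topology \<Rightarrow> nat \<Rightarrow> (nat \<times> (nat \<Rightarrow> real) \<Rightarrow> 'a)
      \<Rightarrow> ('a + (nat \<times> (nat \<Rightarrow> real)) \<times> real) topology" where
  "mapping_cylinder X k \<gamma> = topology (\<lambda>U.
      U \<subseteq> Inl ` topspace X \<union> Inr ` (topspace (circles k) \<times> {0<..1}) \<and>
      openin X {x. Inl x \<in> U} \<and>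
      openin (prod_topology (circles k) (top_of_set {0..1}))
             {w \<in> topspace (circles k) \<times> {0..1}. cyl_proj \<gamma> w \<in> U})"

definition cyl_end :: "nat \<Rightarrow> ('a + (nat \<times> (nat \<Rightarrow> real)) \<times> real) set" where
  "cyl_end k = Inr ` (topspace (circles k) \<times> {1})"

type_synonym 'b ssimplex = "(nat \<Rightarrow> real) \<Rightarrow> 'b"

definition rchain :: "nat \<Rightarrow> 'b topology \<Rightarrow> ('b ssimplex \<Rightarrow> real) \<Rightarrow> bool" where
  "rchain p Y c \<longleftrightarrow> finite {\<sigma>. c \<sigma> \<noteq> 0} \<and> (\<forall>\<sigma>. c \<sigma> \<noteq> 0 \<longrightarrow> singular_simplex p Y \<sigma>)"

definition rbd :: "nat \<Rightarrow> ('b ssimplex \<Rightarrow> real) \<Rightarrow> ('b ssimplex \<Rightarrow> real)" where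
  "rbd p c = (\<lambda>\<tau>. \<Sum>\<sigma>\<in>{\<sigma>. c \<sigma> \<noteq> 0}.
                 \<Sum>k\<in>{k. k \<le> p \<and> singular_face p k \<sigma> = \<tau>}. (-1)^k * c \<sigma>)"

definition rrelcycle :: "nat \<Rightarrow> 'b topology \<Rightarrow> 'b set \<Rightarrow> ('b ssimplex \<Rightarrow> real) \<Rightarrow> bool" where
  "rrelcycle p Y A c \<longleftrightarrow> rchain p Y c \<and> rchain (p - 1) (subtopology Y A) (rbd p c)"

definition rhomologous :: "nat \<Rightarrow> 'b topology \<Rightarrow> 'b set
      \<Rightarrow> ('b ssimplex \<Rightarrow> real) \<Rightarrow> ('b ssimplex \<Rightarrow> real) \<Rightarrow> bool" where
  "rhomologous p Y A c c' \<longleftrightarrow> (\<exists>b a. rchain (Suc p) Y b \<and> rchain p (subtopology Y A) a \<and>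
       (\<forall>\<sigma>. c \<sigma> - c' \<sigma> = rbd (Suc p) b \<sigma> + a \<sigma>))"

definition l1norm :: "('b ssimplex \<Rightarrow> real) \<Rightarrow> real" where
  "l1norm c = (\<Sum>\<sigma>\<in>{\<sigma>. c \<sigma> \<noteq> 0}. \<bar>c \<sigma>\<bar>)"

definition gromov_norm :: "nat \<Rightarrow> 'b topology \<Rightarrow> 'b set \<Rightarrow> ('b ssimplex \<Rightarrow> real) \<Rightarrow> real" where
  "gromov_norm p Y A z = Inf {l1norm c | c. rrelcycle p Y A c \<and> rhomologous p Y A c z}"

text \<open>A p-cochain is a real function on singular simplices; only its values on singular
 p-simplices of the space matter.\<close>

definition cobd :: "nat \<Rightarrow> ('b ssimplex \<Rightarrow> real) \<Rightarrow> ('b ssimplex \<Rightarrow> real)" where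
  "cobd p \<phi> = (\<lambda>\<sigma>. \<Sum>k\<le>Suc p. (-1)^k * \<phi> (singular_face (Suc p) k \<sigma>))"

definition bounded_cochain :: "nat \<Rightarrow> 'b topology \<Rightarrow> ('b ssimplex \<Rightarrow> real) \<Rightarrow> bool" where
  "bounded_cochain p Y \<phi> \<longleftrightarrow> (\<exists>B. \<forall>\<sigma>. singular_simplex p Y \<sigma> \<longrightarrow> \<bar>\<phi> \<sigma>\<bar> \<le> B)"

definition bcocycle :: "nat \<Rightarrow> 'b topology \<Rightarrow> 'b set \<Rightarrow> ('b ssimplex \<Rightarrow> real) \<Rightarrow> bool" where
  "bcocycle p Y A \<psi> \<longleftrightarrow> bounded_cochain p Y \<psi> \<and>
      (\<forall>\<sigma>. singular_simplex p (subtopology Y A) \<sigma> \<longrightarrow> \<psi> \<sigma> = 0) \<and>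
      (\<forall>\<sigma>. singular_simplex (Suc p) Y \<sigma> \<longrightarrow> cobd p \<psi> \<sigma> = 0)"

definition bcohomologous :: "nat \<Rightarrow> 'b topology \<Rightarrow> 'b set
      \<Rightarrow> ('b ssimplex \<Rightarrow> real) \<Rightarrow> ('b ssimplex \<Rightarrow> real) \<Rightarrow> bool" where
  "bcohomologous p Y A \<psi> \<psi>' \<longleftrightarrow> (\<exists>\<phi>. bounded_cochain (p - 1) Y \<phi> \<and>
      (\<forall>\<sigma>. singular_simplex (p - 1) (subtopology Y A) \<sigma> \<longrightarrow> \<phi> \<sigma> = 0) \<and>
      (\<forall>\<sigma>. singular_simplex p Y \<sigma> \<longrightarrow> \<psi> \<sigma> - \<psi>' \<sigma> = cobd (p - 1) \<phi> \<sigma>))"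

definition binfnorm :: "nat \<Rightarrow> 'b topology \<Rightarrow> ('b ssimplex \<Rightarrow> real) \<Rightarrow> real" where
  "binfnorm p Y \<psi> = Inf {(SUP \<sigma>\<in>singular_simplex_set p Y. \<bar>\<psi>' \<sigma>\<bar>) | \<psi>'.
        bcocycle p Y {} \<psi>' \<and> bcohomologous p Y {} \<psi> \<psi>'}"

definition pullback :: "nat \<Rightarrow> ('c \<Rightarrow> 'b) \<Rightarrow> ('b ssimplex \<Rightarrow> real) \<Rightarrow> ('c ssimplex \<Rightarrow> real)" where
  "pullback p f \<psi> = (\<lambda>\<sigma>. \<psi> (simplex_map p f \<sigma>))"

definition kronecker :: "('b ssimplex \<Rightarrow> real) \<Rightarrow> ('b ssimplex \<Rightarrow> real) \<Rightarrow> real" where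
  "kronecker z \<psi> = (\<Sum>\<sigma>\<in>{\<sigma>. z \<sigma> \<noteq> 0}. z \<sigma> * \<psi> \<sigma>)"

text \<open>Pairing of the class of a bounded cocycle psi on X with the relative class of z in
 (Y,A), transported through H_b(Y,A) = H_b(Y) = H_b(X), the second isomorphism
 induced by the inclusion iota : X -> Y: pick a relative bounded cocycle psi' on (Y,A)
 whose restriction to X is cohomologous to psi, and evaluate it on z.\<close>
definition transported_pairing :: "nat \<Rightarrow> 'b topology \<Rightarrow> 'b set \<Rightarrow> ('c \<Rightarrow> 'b) \<Rightarrow> 'c topology
      \<Rightarrow> ('c ssimplex \<Rightarrow> real) \<Rightarrow> ('b ssimplex \<Rightarrow> real) \<Rightarrow> real" where
  "transported_pairing p Y A \<iota> X \<psi> z = (THE r. \<exists>\<psi>'. bcocycle p Y A \<psi>' \<and>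
       bcohomologous p X {} (pullback p \<iota> \<psi>') \<psi> \<and> r = kronecker z \<psi>')"

end

theory Submission
  imports Defs "HOL-Complex_Analysis.Great_Picard"
begin

text \<open>
  Write \<open>(Y, A)\<close> for the mapping cylinder and its free end. By Hahn--Banach the seminorm of a
  relative class is attained by a relative cocycle on \<open>(Y, A)\<close> bounded by \<open>1\<close>, and restricting it to
  \<open>X\<close> bounds the norm from above by the supremum. Conversely, let \<open>\<psi>\<close> be a relative cocycle that
  differs from a cocycle bounded by \<open>C\<close> by the coboundary of a bounded cochain \<open>\<phi>\<close>; the claim is
  \<open>\<bar>\<langle>\<psi>, z\<rangle>\<bar> \<le> C \<parallel>z\<parallel>\<close>. Every vertex of \<open>z\<close> on a boundary circle is slid around its circle a number of
  times chosen independently and uniformly in \<open>{0..<N}\<close>, and each edge inside a circle is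
  straightened on the way. This does not change \<open>\<langle>\<psi>, z\<rangle>\<close> and does not increase the norm, while an edge
  of the boundary becomes an average of straight loops whose winding numbers are distributed almost
  independently of the edge. After antisymmetrising under reversal of simplices these averages
  cancel up to \<open>O(1/N)\<close>, so the contribution of \<open>\<phi>\<close> vanishes in the limit. The same sliding, and
  averaging over the integers, gives bounded primitives on the circles, hence the isomorphism
  between relative and absolute bounded cohomology in degree two.
\<close>

section \<open>Real chains and cochains\<close>

text \<open>Averaging alone cannot finish. On a boundary edge the averaged \<open>\<phi>\<close> is,
  up to O(1/N), a number that depends on the circle and on N but not on the edge. The coefficients
  of the boundary on one circle need not add up to zero, since a single loop is already a cycle, so
  such a constant would survive in the pairing. Under reversal a cocycle changes sign up to a
  coboundary, whereas an edge and its reversal have nearly the same average; the difference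
  therefore removes the constant. All of this happens on the level of cochains. The homotopy chosen
  for an edge depends only on the edge and on the two numbers at its ends, so triangles with a
  common edge agree there and the cost of sliding is a genuine coboundary. Edges of a circle are
  slid inside that circle, so the cochain behind this coboundary vanishes on them and the pairing
  with \<open>z\<close> does not see it. The estimate with \<open>C = 0\<close> has a second use: it
  shows that the pairing does not depend on the relative cocycle by which it is computed.\<close>

lemma kronecker_superset:
  assumes "finite S" "{\<sigma>. c \<sigma> \<noteq> 0} \<subseteq> S"
  shows "kronecker c f = (\<Sum>\<sigma>\<in>S. c \<sigma> * f \<sigma>)"
  unfolding kronecker_def using assms by (intro sum.mono_neutral_left) auto

lemma kronecker_cong:
  assumes "\<And>\<sigma>. c \<sigma> \<noteq> 0 \<Longrightarrow> f \<sigma> = g \<sigma>"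
  shows "kronecker c f = kronecker c g"
  unfolding kronecker_def using assms by (intro sum.cong) auto

lemma kronecker_zero_right: "kronecker c (\<lambda>_. 0) = 0"
  by (simp add: kronecker_def)

lemma kronecker_add_right: "kronecker c (\<lambda>\<sigma>. f \<sigma> + g \<sigma>) = kronecker c f + kronecker c g"
  by (simp add: kronecker_def sum.distrib algebra_simps)

lemma kronecker_diff_right: "kronecker c (\<lambda>\<sigma>. f \<sigma> - g \<sigma>) = kronecker c f - kronecker c g"
  by (simp add: kronecker_def sum_subtractf algebra_simps)

lemma kronecker_add_left:
  assumes "finite {\<sigma>. c \<sigma> \<noteq> 0}" "finite {\<sigma>. d \<sigma> \<noteq> 0}"
  shows "kronecker (\<lambda>\<sigma>. c \<sigma> + d \<sigma>) f = kronecker c f + kronecker d f"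
proof -
  let ?S = "{\<sigma>. c \<sigma> \<noteq> 0} \<union> {\<sigma>. d \<sigma> \<noteq> 0}"
  have S: "finite ?S" using assms by simp
  have "kronecker (\<lambda>\<sigma>. c \<sigma> + d \<sigma>) f = (\<Sum>\<sigma>\<in>?S. (c \<sigma> + d \<sigma>) * f \<sigma>)"
    by (rule kronecker_superset [OF S]) auto
  also have "\<dots> = (\<Sum>\<sigma>\<in>?S. c \<sigma> * f \<sigma>) + (\<Sum>\<sigma>\<in>?S. d \<sigma> * f \<sigma>)"
    by (simp only: distrib_right sum.distrib)
  also have "\<dots> = kronecker c f + kronecker d f"
    using kronecker_superset [OF S, of c f] kronecker_superset [OF S, of d f] by simp
  finally show ?thesis .
qed

lemma kronecker_scale_left: "kronecker (\<lambda>\<sigma>. r * c \<sigma>) f = r * kronecker c f"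
  by (cases "r = 0") (simp_all add: kronecker_def sum_distrib_left mult.assoc)

lemma l1norm_nonneg: "0 \<le> l1norm c"
  by (simp add: l1norm_def sum_nonneg)

lemma abs_kronecker_le:
  assumes "\<And>\<sigma>. c \<sigma> \<noteq> 0 \<Longrightarrow> \<bar>f \<sigma>\<bar> \<le> C"
  shows "\<bar>kronecker c f\<bar> \<le> C * l1norm c"
proof -
  have "\<bar>kronecker c f\<bar> \<le> (\<Sum>\<sigma> | c \<sigma> \<noteq> 0. \<bar>c \<sigma> * f \<sigma>\<bar>)"
    unfolding kronecker_def by (rule sum_abs)
  also have "\<dots> \<le> (\<Sum>\<sigma> | c \<sigma> \<noteq> 0. C * \<bar>c \<sigma>\<bar>)"
    using assms by (intro sum_mono) (auto simp: abs_mult mult.commute intro!: mult_right_mono)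
  finally show ?thesis by (simp add: l1norm_def sum_distrib_left)
qed

section \<open>The boundary operator and its adjoint\<close>

lemma rbd_support:
  "{\<tau>. rbd p c \<tau> \<noteq> 0} \<subseteq> (\<Union>\<sigma>\<in>{\<sigma>. c \<sigma> \<noteq> 0}. (\<lambda>k. singular_face p k \<sigma>) ` {..p})"
proof
  fix \<tau> assume "\<tau> \<in> {\<tau>. rbd p c \<tau> \<noteq> 0}"
  then have "(\<Sum>\<sigma>\<in>{\<sigma>. c \<sigma> \<noteq> 0}. \<Sum>k | k \<le> p \<and> singular_face p k \<sigma> = \<tau>. (-1)^k * c \<sigma>) \<noteq> 0"
    by (simp add: rbd_def)
  then obtain \<sigma> where "\<sigma> \<in> {\<sigma>. c \<sigma> \<noteq> 0}"
    "(\<Sum>k | k \<le> p \<and> singular_face p k \<sigma> = \<tau>. (-1)^k * c \<sigma>) \<noteq> 0"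
    by (rule sum.not_neutral_contains_not_neutral)
  moreover from this(2) obtain k where "k \<in> {k. k \<le> p \<and> singular_face p k \<sigma> = \<tau>}"
    by (rule sum.not_neutral_contains_not_neutral)
  ultimately show "\<tau> \<in> (\<Union>\<sigma>\<in>{\<sigma>. c \<sigma> \<noteq> 0}. (\<lambda>k. singular_face p k \<sigma>) ` {..p})" by auto
qed

lemma finite_rbd_support:
  "finite {\<sigma>. c \<sigma> \<noteq> 0} \<Longrightarrow> finite {\<tau>. rbd p c \<tau> \<noteq> 0}"
  by (rule finite_subset [OF rbd_support]) auto

lemma rchain_rbd:
  assumes "rchain (Suc p) Y c"
  shows "rchain p Y (rbd (Suc p) c)"
proof -
  have "singular_simplex p Y \<tau>" if "rbd (Suc p) c \<tau> \<noteq> 0" for \<tau>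
    using rbd_support [of "Suc p" c] that assms singular_simplex_singular_face [of "Suc p" Y]
    by (fastforce simp: rchain_def)
  then show ?thesis using assms by (auto simp: rchain_def intro!: finite_rbd_support)
qed

text \<open>Boundary and coboundary are adjoint. Several faces of one simplex may be the same
  singular simplex, so the terms are regrouped by the value of the face instead of being matched one
  by one.\<close>

lemma kronecker_rbd:
  assumes fin: "finite {\<sigma>. c \<sigma> \<noteq> 0}"
  shows "kronecker (rbd (Suc p) c) f = kronecker c (cobd p f)"
proof -
  let ?S = "{\<sigma>. c \<sigma> \<noteq> 0}"
  let ?T = "\<Union>\<sigma>\<in>?S. (\<lambda>k. singular_face (Suc p) k \<sigma>) ` {..Suc p}"
  have T: "finite ?T" using fin by auto
  have "kronecker (rbd (Suc p) c) f = (\<Sum>\<tau>\<in>?T. rbd (Suc p) c \<tau> * f \<tau>)"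
    by (rule kronecker_superset [OF T rbd_support])
  also have "\<dots> = (\<Sum>\<tau>\<in>?T. \<Sum>\<sigma>\<in>?S. \<Sum>k | k \<le> Suc p \<and> singular_face (Suc p) k \<sigma> = \<tau>.
                      (-1)^k * c \<sigma> * f (singular_face (Suc p) k \<sigma>))"
    by (simp add: rbd_def sum_distrib_right)
  also have "\<dots> = (\<Sum>\<sigma>\<in>?S. \<Sum>\<tau>\<in>?T. \<Sum>k | k \<in> {..Suc p} \<and> singular_face (Suc p) k \<sigma> = \<tau>.
                      (-1)^k * c \<sigma> * f (singular_face (Suc p) k \<sigma>))"
    by (subst sum.swap) simp
  also have "\<dots> = (\<Sum>\<sigma>\<in>?S. \<Sum>k\<le>Suc p. (-1)^k * c \<sigma> * f (singular_face (Suc p) k \<sigma>))"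
  proof (rule sum.cong [OF refl])
    fix \<sigma> assume "\<sigma> \<in> ?S"
    then show "(\<Sum>\<tau>\<in>?T. \<Sum>k | k \<in> {..Suc p} \<and> singular_face (Suc p) k \<sigma> = \<tau>.
                      (-1)^k * c \<sigma> * f (singular_face (Suc p) k \<sigma>))
        = (\<Sum>k\<le>Suc p. (-1)^k * c \<sigma> * f (singular_face (Suc p) k \<sigma>))"
      by (intro sum.group T) auto
  qed
  also have "\<dots> = kronecker c (cobd p f)"
    by (simp add: kronecker_def cobd_def sum_distrib_left mult_ac del: sum.atMost_Suc)
  finally show ?thesis .
qed

lemma singular_face_swap:
  assumes "j < k" "k \<le> Suc (Suc p)"
  shows "singular_face (Suc p) j (singular_face (Suc (Suc p)) k f)
       = singular_face (Suc p) (k - 1) (singular_face (Suc (Suc p)) j f)"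
proof
  fix x :: "nat \<Rightarrow> real"
  have "simplical_face k (simplical_face j x) = simplical_face j (simplical_face (k - 1) x)"
  proof
    fix i
    consider "i < j" | "i = j" | "j < i" "i < k" | "i = k" | "k < i" by linarith
    then show "simplical_face k (simplical_face j x) i = simplical_face j (simplical_face (k - 1) x) i"
      using assms by cases (auto simp: simplical_face_def)
  qed
  moreover have "simplical_face j x \<in> standard_simplex (Suc p)"
      "simplical_face (k - 1) x \<in> standard_simplex (Suc p)" if "x \<in> standard_simplex p"
    using assms that simplical_face_in_standard_simplex [of "Suc p" _ x] by simp_all
  ultimately show "singular_face (Suc p) j (singular_face (Suc (Suc p)) k f) x
       = singular_face (Suc p) (k - 1) (singular_face (Suc (Suc p)) j f) x"
    by (simp add: singular_face_def restrict_def del: One_nat_def)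
qed

lemma cobd_1: "cobd 1 f \<sigma> = f (singular_face 2 0 \<sigma>) - f (singular_face 2 1 \<sigma>) + f (singular_face 2 2 \<sigma>)"
  by (simp add: cobd_def numeral_2_eq_2)

lemma cobd_2: "cobd 2 f \<sigma> = f (singular_face 3 0 \<sigma>) - f (singular_face 3 1 \<sigma>)
    + f (singular_face 3 2 \<sigma>) - f (singular_face 3 3 \<sigma>)"
  by (simp add: cobd_def numeral_2_eq_2 numeral_3_eq_3)

lemma cobd_cobd: "cobd 2 (cobd 1 f) \<sigma> = 0"
proof -
  have "singular_face 2 j (singular_face 3 k \<sigma>) = singular_face 2 (k - 1) (singular_face 3 j \<sigma>)"
    if "j < k" "k \<le> 3" for j k
    using singular_face_swap [of j k 1 \<sigma>] that by (simp add: numeral_2_eq_2 numeral_3_eq_3)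
  from this [of 0 1] this [of 0 2] this [of 0 3] this [of 1 2] this [of 1 3] this [of 2 3]
  show ?thesis unfolding cobd_2 cobd_1 by simp
qed

text \<open>Dual to \<open>cobd_cobd\<close>: a coefficient of a chain is its pairing with the
  indicator cochain of the simplex, and adjointness moves both boundaries onto that cochain.\<close>

lemma rbd_rbd:
  assumes "finite {\<sigma>. c \<sigma> \<noteq> 0}"
  shows "rbd 2 (rbd 3 c) \<tau> = 0"
proof -
  let ?d = "rbd 2 (rbd 3 c)" and ?i = "\<lambda>\<sigma>. if \<sigma> = \<tau> then 1 else 0 :: real"
  have fin: "finite {\<sigma>. rbd 3 c \<sigma> \<noteq> 0}" using assms by (rule finite_rbd_support)
  have "?d \<tau> = kronecker ?d ?i"
    using kronecker_superset [of "insert \<tau> {\<sigma>. ?d \<sigma> \<noteq> 0}" ?d ?i, OF _ subset_insertI] finite_rbd_support [OF fin]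
    by (simp add: sum.remove [of _ \<tau>] if_distrib [of "\<lambda>x. _ * x"] cong: if_cong)
  also have "\<dots> = kronecker c (cobd 2 (cobd 1 ?i))"
    using kronecker_rbd [OF fin, of 1] kronecker_rbd [OF assms, of 2]
    by (simp add: numeral_2_eq_2 numeral_3_eq_3)
  also have "\<dots> = 0" by (simp only: cobd_cobd kronecker_def mult_zero_right sum.neutral_const)
  finally show ?thesis .
qed

text \<open>The coboundary moves over to the boundary of \<open>z\<close>, which is supported on
  simplices of \<open>A\<close>.\<close>

lemma kronecker_cobd_eq_0:
  assumes z: "rrelcycle 2 Y A z"
    and f: "\<And>e. singular_simplex 1 (subtopology Y A) e \<Longrightarrow> f e = 0"
  shows "kronecker z (cobd 1 f) = 0"
proof -
  have "kronecker z (cobd 1 f) = kronecker (rbd 2 z) f"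
    using kronecker_rbd [of z 1 f] z by (simp add: rrelcycle_def rchain_def numeral_2_eq_2)
  also have "\<dots> = kronecker (rbd 2 z) (\<lambda>_. 0)"
    using z f by (intro kronecker_cong) (auto simp: rrelcycle_def rchain_def)
  finally show ?thesis by (simp only: kronecker_zero_right)
qed

lemma kronecker_bcocycle_homologous:
  assumes \<psi>: "bcocycle 2 Y A \<psi>" and c: "rchain 2 Y c" and z: "rchain 2 Y z"
    and h: "rhomologous 2 Y A c z"
  shows "kronecker c \<psi> = kronecker z \<psi>"
proof -
  obtain b a where b: "rchain 3 Y b" and a: "rchain 2 (subtopology Y A) a"
    and eq: "\<And>\<sigma>. c \<sigma> - z \<sigma> = rbd 3 b \<sigma> + a \<sigma>"
    using h by (auto simp: rhomologous_def numeral_3_eq_3 numeral_2_eq_2)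
  have fin: "finite {\<sigma>. z \<sigma> \<noteq> 0}" "finite {\<sigma>. b \<sigma> \<noteq> 0}" "finite {\<sigma>. a \<sigma> \<noteq> 0}"
    "finite {\<sigma>. rbd 3 b \<sigma> \<noteq> 0}"
    using z a b by (auto simp: rchain_def intro!: finite_rbd_support)
  have ceq: "c = (\<lambda>\<sigma>. z \<sigma> + (rbd 3 b \<sigma> + a \<sigma>))"
  proof
    fix \<sigma> show "c \<sigma> = z \<sigma> + (rbd 3 b \<sigma> + a \<sigma>)" using eq [of \<sigma>] by simp
  qed
  have "finite {\<sigma>. rbd 3 b \<sigma> + a \<sigma> \<noteq> 0}"
    by (rule finite_subset [OF _ finite_UnI [OF fin(4,3)]]) auto
  then have "kronecker c \<psi> = kronecker z \<psi> + (kronecker (rbd 3 b) \<psi> + kronecker a \<psi>)"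
    unfolding ceq
    by (simp only: kronecker_add_left [OF fin(1)] kronecker_add_left [OF fin(4,3)])
  moreover have "kronecker (rbd 3 b) \<psi> = kronecker b (cobd 2 \<psi>)"
    using kronecker_rbd [OF fin(2), of 2] by (simp add: numeral_3_eq_3 numeral_2_eq_2)
  moreover have "kronecker b (cobd 2 \<psi>) = kronecker b (\<lambda>_. 0)"
    using b \<psi> by (intro kronecker_cong) (auto simp: rchain_def bcocycle_def numeral_3_eq_3 numeral_2_eq_2)
  moreover have "kronecker a \<psi> = kronecker a (\<lambda>_. 0)"
    using a \<psi> by (intro kronecker_cong) (auto simp: rchain_def bcocycle_def)
  ultimately show ?thesis by (simp only: kronecker_zero_right add_0_right)
qed

section \<open>Affine simplices in prisms\<close>

lemma singular_simplex_iff_top_of_set: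
  "singular_simplex p Y f \<longleftrightarrow>
     continuous_map (top_of_set (standard_simplex p)) Y f \<and> f \<in> extensional (standard_simplex p)"
  by (simp add: singular_simplex_def euclidean_product_topology)

lemma standard_simplexI:
  assumes "\<And>i. 0 \<le> x i" "\<And>i. p < i \<Longrightarrow> x i = 0" "(\<Sum>i\<le>p. x i) = 1"
  shows "x \<in> standard_simplex p"
proof -
  have "x i \<le> 1" for i
  proof (cases "i \<le> p")
    case True
    then have "x i \<le> (\<Sum>i\<le>p. x i)" using assms(1) by (intro member_le_sum) auto
    then show ?thesis using assms by simp
  qed (use assms in auto)
  then show ?thesis using assms by (auto simp: standard_simplex_def)
qed

lemma continuous_map_compose_on:
  assumes "continuous_map (top_of_set T) Y g" "continuous_on S f" "f \<in> S \<rightarrow> T"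
  shows "continuous_map (top_of_set S) Y (\<lambda>x. g (f x))"
proof -
  have "continuous_map (top_of_set S) (top_of_set T) f" using assms by simp
  from continuous_map_compose [OF this assms(1)] show ?thesis by (simp add: o_def)
qed

lemma continuous_on_coordinate: "continuous_on S f \<Longrightarrow> continuous_on S (\<lambda>x. f x i :: real)"
  by (rule continuous_on_product_then_coordinatewise)

definition vpoint :: "(nat \<times> real) list \<Rightarrow> (nat \<Rightarrow> real) \<Rightarrow> nat \<Rightarrow> real" where
  "vpoint vs y = (\<lambda>l. \<Sum>j<length vs. (if fst (vs ! j) = l then 1 else 0) * y j)"

definition vheight :: "(nat \<times> real) list \<Rightarrow> (nat \<Rightarrow> real) \<Rightarrow> real" where
  "vheight vs y = (\<Sum>j<length vs. snd (vs ! j) * y j)"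

text \<open>An entry \<open>(l, t)\<close> of the list stands for the point at height \<open>t\<close> over the \<open>l\<close>-th vertex of
  the standard simplex; the list spans an affine simplex in the product of the standard simplex
  with the line, and \<open>pmap\<close> composes it with \<open>G\<close>.\<close>

definition pmap :: "(nat \<times> real) list \<Rightarrow> ((nat \<Rightarrow> real) \<Rightarrow> real \<Rightarrow> 'b) \<Rightarrow> 'b ssimplex" where
  "pmap vs G = restrict (\<lambda>y. G (vpoint vs y) (vheight vs y)) (standard_simplex (length vs - 1))"

lemma vpoint_in_simplex:
  assumes "\<And>v. v \<in> set vs \<Longrightarrow> fst v \<le> q" "y \<in> standard_simplex (length vs - 1)" "vs \<noteq> []"
  shows "vpoint vs y \<in> standard_simplex q"
proof (rule standard_simplexI)
  have y: "\<And>j. 0 \<le> y j" "(\<Sum>j<length vs. y j) = 1"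
    using assms(2,3) by (auto simp: standard_simplex_def lessThan_Suc_atMost [symmetric] Suc_diff_1)
  show "0 \<le> vpoint vs y i" for i
    by (auto simp: vpoint_def intro!: sum_nonneg y)
  show "vpoint vs y i = 0" if "q < i" for i
  proof -
    have "fst (vs ! j) \<noteq> i" if "j < length vs" for j
      using assms(1) [OF nth_mem [OF that]] \<open>q < i\<close> by simp
    then show ?thesis by (simp add: vpoint_def)
  qed
  have "(\<Sum>i\<le>q. vpoint vs y i) = (\<Sum>j<length vs. (\<Sum>i\<le>q. (if fst (vs ! j) = i then 1 else 0) * y j))"
    unfolding vpoint_def by (rule sum.swap)
  also have "\<dots> = (\<Sum>j<length vs. y j)"
  proof (rule sum.cong)
    fix j assume "j \<in> {..<length vs}"
    then have "fst (vs ! j) \<le> q" using assms(1) by simp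
    then show "(\<Sum>i\<le>q. (if fst (vs ! j) = i then 1 else 0) * y j) = y j"
      by (simp flip: sum_distrib_right)
  qed simp
  finally show "(\<Sum>i\<le>q. vpoint vs y i) = 1" using y by simp
qed

lemma vheight_in_convex:
  assumes "convex T" "\<And>v. v \<in> set vs \<Longrightarrow> snd v \<in> T" "y \<in> standard_simplex (length vs - 1)" "vs \<noteq> []"
  shows "vheight vs y \<in> T"
proof -
  have y: "\<And>j. 0 \<le> y j" "(\<Sum>j<length vs. y j) = 1"
    using assms(3,4) by (auto simp: standard_simplex_def lessThan_Suc_atMost [symmetric] Suc_diff_1)
  have "(\<Sum>j<length vs. y j *\<^sub>R snd (vs ! j)) \<in> T"
    using assms y by (intro convex_sum) auto
  then show ?thesis by (simp add: vheight_def mult.commute)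
qed

text \<open>The set \<open>T\<close> of heights is left general: prisms use the unit interval,
  \<open>reindex\<close> the singleton \<open>{0}\<close>, straight simplices on a circle the whole
  real line.\<close>

lemma singular_simplex_pmap:
  assumes G: "continuous_map (top_of_set (standard_simplex q \<times> T)) Y (case_prod G)"
    and T: "convex T" and vs: "\<And>v. v \<in> set vs \<Longrightarrow> fst v \<le> q \<and> snd v \<in> T" "length vs = Suc p"
  shows "singular_simplex p Y (pmap vs G)"
proof -
  have "continuous_map (top_of_set (standard_simplex p)) Y
          (\<lambda>y. case_prod G (vpoint vs y, vheight vs y))"
  proof (rule continuous_map_compose_on [OF G])
    show "continuous_on (standard_simplex p) (\<lambda>y. (vpoint vs y, vheight vs y))"
      unfolding vpoint_def vheight_def by (intro continuous_intros continuous_on_coordinate [OF continuous_on_id])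
    have "vs \<noteq> []" "length vs - 1 = p" using vs(2) by auto
    then show "(\<lambda>y. (vpoint vs y, vheight vs y)) \<in> standard_simplex p \<rightarrow> standard_simplex q \<times> T"
      using vpoint_in_simplex [of vs q] vheight_in_convex [of T vs] T vs by auto
  qed
  then show ?thesis
    using vs(2) by (simp add: singular_simplex_iff_top_of_set pmap_def)
qed

lemma pmap_cong:
  assumes "\<And>x t. x \<in> standard_simplex q \<Longrightarrow> t \<in> T \<Longrightarrow> G x t = H x t"
    and "convex T" "\<And>v. v \<in> set vs \<Longrightarrow> fst v \<le> q \<and> snd v \<in> T" "vs \<noteq> []"
  shows "pmap vs G = pmap vs H"
  unfolding pmap_def using assms vpoint_in_simplex [of vs q] vheight_in_convex [of T vs]
  by (intro restrict_ext) auto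

lemma sum_simplical_face:
  fixes a :: "nat \<Rightarrow> real"
  assumes "k \<le> n"
  shows "(\<Sum>j<Suc n. a j * simplical_face k y j) = (\<Sum>j<n. a (if j < k then j else Suc j) * y j)"
proof -
  have "(\<Sum>j<Suc n. a j * simplical_face k y j) = (\<Sum>j\<in>{..<Suc n} - {k}. a j * simplical_face k y j)"
    using assms by (subst sum.remove [of _ k]) (auto simp: simplical_face_def)
  also have "\<dots> = (\<Sum>j<n. a (if j < k then j else Suc j) * y j)"
    using assms
    by (intro sum.reindex_bij_witness [where i = "\<lambda>j. if j < k then j else Suc j"
          and j = "\<lambda>j. if j < k then j else j - 1"]) (auto simp: simplical_face_def)
  finally show ?thesis .
qed

lemma singular_face_pmap:
  assumes "length vs = Suc (Suc p)" "k \<le> Suc p"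
  shows "singular_face (Suc p) k (pmap vs G) = pmap (take k vs @ drop (Suc k) vs) G"
proof
  fix y :: "nat \<Rightarrow> real"
  let ?ws = "take k vs @ drop (Suc k) vs"
  have len: "length ?ws = Suc p" using assms by simp
  have nth: "?ws ! j = vs ! (if j < k then j else Suc j)" if "j < Suc p" for j
    using that assms by (auto simp: nth_append)
  have "vpoint vs (simplical_face k y) = vpoint ?ws y"
    unfolding vpoint_def len assms(1) sum_simplical_face [OF assms(2)] using nth
    by (intro ext sum.cong) auto
  moreover have "vheight vs (simplical_face k y) = vheight ?ws y"
    unfolding vheight_def len assms(1) sum_simplical_face [OF assms(2)] using nth
    by (intro sum.cong) auto
  moreover have "y \<in> standard_simplex p \<Longrightarrow> simplical_face k y \<in> standard_simplex (Suc p)"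
    using simplical_face_in_standard_simplex [of "Suc p" k y] assms by simp
  ultimately show "singular_face (Suc p) k (pmap vs G) y = pmap ?ws G y"
    using assms(1) len by (simp add: singular_face_def pmap_def restrict_def)
qed

text \<open>Restricting a homotopy to the \<open>k\<close>-th face raises the vertex labels from
  \<open>k\<close> on by one. In this way the wall of a prism over a triangle is recognised as the
  prism over an edge.\<close>

lemma pmap_face:
  "pmap vs (\<lambda>x t. G (simplical_face k x) t)
     = pmap (map (\<lambda>(l,t). (if l < k then l else Suc l, t)) vs) G"
proof -
  let ?ws = "map (\<lambda>(l,t). (if l < k then l else Suc l, t)) vs"
  have "simplical_face k (vpoint vs y) = vpoint ?ws y" for y
  proof
    fix l
    consider "l < k" | "l = k" | "k < l" by linarith
    then show "simplical_face k (vpoint vs y) l = vpoint ?ws y l"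
      by cases (auto simp: simplical_face_def vpoint_def split_beta intro!: sum.cong sum.neutral
          sum.neutral [symmetric])
  qed
  moreover have "vheight vs y = vheight ?ws y" for y
    by (auto simp: vheight_def split_beta intro!: sum.cong)
  ultimately show ?thesis by (simp add: pmap_def)
qed

lemma pmap_level:
  assumes "\<And>x. x \<in> standard_simplex 2 \<Longrightarrow> G x t = \<sigma> x" "\<sigma> \<in> extensional (standard_simplex 2)"
  shows "pmap [(0,t),(1,t),(2,t)] G = \<sigma>"
proof
  fix y
  have "vpoint [(0,t),(1,t),(2,t)] y = y" "vheight [(0,t),(1,t),(2,t)] y = t" if y: "y \<in> standard_simplex 2"
  proof -
    have *: "y 0 + y 1 + y 2 = 1" "\<And>i. i > 2 \<Longrightarrow> y i = 0"
      using y by (auto simp: standard_simplex_def numeral_2_eq_2)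
    show "vheight [(0,t),(1,t),(2,t)] y = t"
    proof -
      have "vheight [(0,t),(1,t),(2,t)] y = t * (y 0 + y 1 + y 2)"
        by (simp add: vheight_def lessThan_Suc numeral_2_eq_2 algebra_simps)
      then show ?thesis using *(1) by simp
    qed
    show "vpoint [(0,t),(1,t),(2,t)] y = y"
    proof
      fix l :: nat
      consider "l = 0" | "l = 1" | "l = 2" | "l > 2" by linarith
      then show "vpoint [(0,t),(1,t),(2,t)] y l = y l"
        using * by cases (auto simp: vpoint_def lessThan_Suc numeral_2_eq_2)
    qed
  qed
  then show "pmap [(0,t),(1,t),(2,t)] G y = \<sigma> y"
    using assms by (cases "y \<in> standard_simplex 2") (auto simp: pmap_def extensional_def numeral_2_eq_2)
qed

lemma pmap_level_1:
  assumes "\<And>x. x \<in> standard_simplex 1 \<Longrightarrow> G x t = \<sigma> x" "\<sigma> \<in> extensional (standard_simplex 1)"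
  shows "pmap [(0,t),(1,t)] G = \<sigma>"
proof
  fix y
  have "vpoint [(0,t),(1,t)] y = y" "vheight [(0,t),(1,t)] y = t" if y: "y \<in> standard_simplex 1"
  proof -
    have *: "y 0 + y 1 = 1" "\<And>i. i > 1 \<Longrightarrow> y i = 0"
      using y by (auto simp: standard_simplex_def)
    show "vheight [(0,t),(1,t)] y = t"
      using *(1) by (simp add: vheight_def lessThan_Suc flip: distrib_left)
    show "vpoint [(0,t),(1,t)] y = y"
    proof
      fix l :: nat
      consider "l = 0" | "l = 1" | "l > 1" by linarith
      then show "vpoint [(0,t),(1,t)] y l = y l"
        using * by cases (auto simp: vpoint_def lessThan_Suc)
    qed
  qed
  then show "pmap [(0,t),(1,t)] G y = \<sigma> y"
    using assms by (cases "y \<in> standard_simplex 1") (auto simp: pmap_def extensional_def)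
qed

section \<open>Cochains on prisms\<close>

lemma cobd_1_pmap:
  "cobd 1 \<phi> (pmap [a,b,c] G) = \<phi> (pmap [b,c] G) - \<phi> (pmap [a,c] G) + \<phi> (pmap [a,b] G)"
  unfolding cobd_1 using singular_face_pmap [of "[a,b,c]" 1 _ G] by (simp add: numeral_2_eq_2)

lemma cobd_2_pmap:
  "cobd 2 \<psi> (pmap [a,b,c,d] G)
    = \<psi> (pmap [b,c,d] G) - \<psi> (pmap [a,c,d] G) + \<psi> (pmap [a,b,d] G) - \<psi> (pmap [a,b,c] G)"
  unfolding cobd_2 using singular_face_pmap [of "[a,b,c,d]" 2 _ G] by (simp add: numeral_2_eq_2 numeral_3_eq_3)

text \<open>Dual of the prism operator on an edge: the square is cut along the diagonal from
  \<open>(0,0)\<close> to \<open>(1,1)\<close>, and the triangles carry the usual alternating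
  signs.\<close>

definition prism_cochain :: "('b ssimplex \<Rightarrow> real) \<Rightarrow> ((nat \<Rightarrow> real) \<Rightarrow> real \<Rightarrow> 'b) \<Rightarrow> real" where
  "prism_cochain \<psi> E = \<psi> (pmap [(0,0),(0,1),(1,1)] E) - \<psi> (pmap [(0,0),(1,0),(1,1)] E)"

lemma prism_cochain_cong:
  assumes "\<And>x t. x \<in> standard_simplex 1 \<Longrightarrow> t \<in> {0..1} \<Longrightarrow> E x t = F x t"
  shows "prism_cochain \<psi> E = prism_cochain \<psi> F"
proof -
  have "pmap vs E = pmap vs F" if "vs = [(0,0),(0,1),(1,1)] \<or> vs = [(0,0),(1,0),(1,1)]" for vs
    using that assms by (intro pmap_cong [of 1 "{0..1}"]) auto
  then show ?thesis by (simp add: prism_cochain_def)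
qed

lemma abs_prism_cochain_le:
  assumes "\<And>\<sigma>. singular_simplex 2 Y \<sigma> \<Longrightarrow> \<bar>\<psi> \<sigma>\<bar> \<le> B"
    and E: "continuous_map (top_of_set (standard_simplex 1 \<times> {0..1})) Y (case_prod E)"
  shows "\<bar>prism_cochain \<psi> E\<bar> \<le> 2 * B"
proof -
  have "singular_simplex 2 Y (pmap vs E)" if "vs = [(0,0),(0,1),(1,1)] \<or> vs = [(0,0),(1,0),(1,1)]" for vs
    using that by (intro singular_simplex_pmap [OF E]) auto
  then have "\<bar>\<psi> (pmap [(0,0),(0,1),(1,1)] E)\<bar> \<le> B" "\<bar>\<psi> (pmap [(0,0),(1,0),(1,1)] E)\<bar> \<le> B"
    using assms(1) by blast+
  then show ?thesis by (simp add: prism_cochain_def)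
qed

text \<open>Write v for the bottom and w for the top vertices. The cocycle is evaluated on the
  tetrahedra v0 w0 w1 w2, v0 v1 w1 w2 and v0 v1 v2 w2 with alternating signs. The inner triangles v0
  w1 w2 and v0 v1 w2 cancel; what remains is the top, the bottom and two triangles on each
  wall.\<close>

lemma prism_identity:
  assumes \<psi>: "\<And>\<sigma>. singular_simplex 3 Y \<sigma> \<Longrightarrow> cobd 2 \<psi> \<sigma> = 0"
    and G: "continuous_map (top_of_set (standard_simplex 2 \<times> {0..1})) Y (case_prod G)"
  shows "\<psi> (pmap [(0,1),(1,1),(2,1)] G) - \<psi> (pmap [(0,0),(1,0),(2,0)] G)
     = prism_cochain \<psi> (\<lambda>x t. G (simplical_face 0 x) t)
     - prism_cochain \<psi> (\<lambda>x t. G (simplical_face 1 x) t)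
     + prism_cochain \<psi> (\<lambda>x t. G (simplical_face 2 x) t)"
proof -
  have "cobd 2 \<psi> (pmap vs G) = 0"
    if "set vs \<subseteq> {0,1,2} \<times> {0,1}" "length vs = 4" for vs
    using that by (intro \<psi> singular_simplex_pmap [OF G]) auto
  from this [of "[(0,0),(0,1),(1,1),(2,1)]"] this [of "[(0,0),(1,0),(1,1),(2,1)]"]
    this [of "[(0,0),(1,0),(2,0),(2,1)]"]
  show ?thesis
    by (simp add: cobd_2_pmap prism_cochain_def pmap_face Suc_1 One_nat_def [symmetric] del: One_nat_def)
qed

text \<open>Precomposition with the affine map that sends the \<open>i\<close>-th vertex to vertex
  \<open>ls ! i\<close>, repetitions allowed. The height is a dummy; writing it as a
  \<open>pmap\<close> makes the face formulas available.\<close>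

definition reindex :: "nat list \<Rightarrow> 'b ssimplex \<Rightarrow> 'b ssimplex" where
  "reindex ls \<sigma> = pmap (map (\<lambda>l. (l,0)) ls) (\<lambda>x t. \<sigma> x)"

lemma singular_simplex_reindex:
  assumes "singular_simplex q Y \<sigma>" "set ls \<subseteq> {..q}" "length ls = Suc p"
  shows "singular_simplex p Y (reindex ls \<sigma>)"
proof -
  have "continuous_map (top_of_set (standard_simplex q \<times> {0})) Y (\<lambda>w. \<sigma> (fst w))"
    by (rule continuous_map_compose_on [of "standard_simplex q"])
      (use assms in \<open>auto simp: singular_simplex_iff_top_of_set intro!: continuous_on_fst\<close>)
  then show ?thesis unfolding reindex_def using assms
    by (intro singular_simplex_pmap [of q "{0}"]) (auto simp: split_def)
qed

lemma reindex_face: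
  assumes "set ls \<subseteq> {..1}" "ls \<noteq> []" "k \<le> 2"
  shows "reindex ls (singular_face 2 k \<sigma>) = reindex (map (\<lambda>l. if l < k then l else Suc l) ls) \<sigma>"
proof -
  have "reindex ls (singular_face 2 k \<sigma>) = pmap (map (\<lambda>l. (l,0)) ls) (\<lambda>x t. \<sigma> (simplical_face k x))"
    unfolding reindex_def
    by (rule pmap_cong [of 1 "{0}"]) (use assms in \<open>auto simp: singular_face_def\<close>)
  also have "\<dots> = reindex (map (\<lambda>l. if l < k then l else Suc l) ls) \<sigma>"
    using pmap_face [of "map (\<lambda>l. (l,0)) ls" "\<lambda>x t. \<sigma> x" k] by (simp add: reindex_def o_def)
  finally show ?thesis .
qed

lemma reindex_id: "singular_simplex 2 Y \<sigma> \<Longrightarrow> reindex [0,1,2] \<sigma> = \<sigma>"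
  unfolding reindex_def list.map by (rule pmap_level) (auto simp: singular_simplex_def)

text \<open>Reversal exchanges the faces 0 and 2 and reverses every edge. Those two faces have the
  same sign in the coboundary, so no sign appears.\<close>

lemma cobd_1_reverse:
  "cobd 1 \<phi> (reindex [2,1,0] \<sigma>) = cobd 1 (\<lambda>e. \<phi> (reindex [1,0] e)) \<sigma>"
proof -
  have "cobd 1 \<phi> (reindex [2,1,0] \<sigma>)
      = \<phi> (reindex [1,0] \<sigma>) - \<phi> (reindex [2,0] \<sigma>) + \<phi> (reindex [2,1] \<sigma>)"
    by (simp add: reindex_def cobd_1_pmap del: One_nat_def)
  then show ?thesis
    by (simp add: cobd_1 reindex_face Suc_1 One_nat_def [symmetric] del: One_nat_def)
qed

text \<open>The degenerate triangle 010 has boundary 10 - 00 + 01, and 000 has boundary 00. Together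
  they bound the sum of an edge and its reversal, which makes this the edge term of a chain homotopy
  between reversal and minus the identity.\<close>

definition reverse_cochain :: "('b ssimplex \<Rightarrow> real) \<Rightarrow> 'b ssimplex \<Rightarrow> real" where
  "reverse_cochain \<psi> e = \<psi> (reindex [0,1,0] e) + \<psi> (reindex [0,0,0] e)"

text \<open>The six tetrahedra are the cone from vertex \<open>0\<close> over the cycle whose vanishing is claimed.\<close>

lemma reverse_identity:
  assumes \<psi>: "\<And>\<sigma>. singular_simplex 3 Y \<sigma> \<Longrightarrow> cobd 2 \<psi> \<sigma> = 0"
    and \<sigma>: "singular_simplex 2 Y \<sigma>"
  shows "\<psi> (reindex [2,1,0] \<sigma>) + \<psi> \<sigma> = cobd 1 (reverse_cochain \<psi>) \<sigma>"
proof -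
  have z: "cobd 2 \<psi> (reindex ls \<sigma>) = 0" if "set ls \<subseteq> {..2}" "length ls = 4" for ls
    using that by (intro \<psi> singular_simplex_reindex [OF \<sigma>]) auto
  have c: "cobd 2 \<psi> (reindex [a,b,c,d] \<sigma>) = \<psi> (reindex [b,c,d] \<sigma>) - \<psi> (reindex [a,c,d] \<sigma>)
      + \<psi> (reindex [a,b,d] \<sigma>) - \<psi> (reindex [a,b,c] \<sigma>)" for a b c d
    by (simp add: reindex_def cobd_2_pmap)
  have "cobd 1 (reverse_cochain \<psi>) \<sigma> = \<psi> (reindex [1,2,1] \<sigma>) + \<psi> (reindex [1,1,1] \<sigma>)
     - (\<psi> (reindex [0,2,0] \<sigma>) + \<psi> (reindex [0,0,0] \<sigma>)) + (\<psi> (reindex [0,1,0] \<sigma>) + \<psi> (reindex [0,0,0] \<sigma>))"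
    by (simp add: cobd_1 reverse_cochain_def reindex_face Suc_1 One_nat_def [symmetric] del: One_nat_def)
  then show ?thesis
    using z [of "[0,2,1,0]"] z [of "[0,0,1,2]"] z [of "[0,1,2,1]"] z [of "[0,1,1,1]"]
      z [of "[0,0,2,0]"] z [of "[0,0,1,0]"] reindex_id [OF \<sigma>]
    by (simp add: c del: One_nat_def)
qed

section \<open>Homotopy extension from the boundary of a simplex\<close>

definition simplex_boundary :: "nat \<Rightarrow> (nat \<Rightarrow> real) set" where
  "simplex_boundary p = {x \<in> standard_simplex p. \<exists>i\<le>p. x i = 0}"

text \<open>On the standard simplex this vanishes exactly on the boundary and is largest at the
  barycentre; the gauge of the simplex is affine in it.\<close>

primrec mincoord :: "nat \<Rightarrow> (nat \<Rightarrow> real) \<Rightarrow> real" where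
  "mincoord 0 x = x 0"
| "mincoord (Suc p) x = min (mincoord p x) (x (Suc p))"

lemma continuous_on_mincoord: "continuous_on S f \<Longrightarrow> continuous_on S (\<lambda>x. mincoord p (f x))"
proof (induction p)
  case 0
  then show ?case using continuous_on_coordinate by simp
next
  case (Suc p)
  then show ?case unfolding mincoord.simps
    using continuous_on_min [OF Suc.IH continuous_on_coordinate [of S f "Suc p"]] by blast
qed

lemma mincoord_le: "i \<le> p \<Longrightarrow> mincoord p x \<le> x i"
  by (induction p) (auto simp: le_Suc_eq min_le_iff_disj)

lemma mincoord_attained: "\<exists>i\<le>p. mincoord p x = x i"
  by (induction p) (auto simp: min_def le_Suc_eq)

text \<open>At time \<open>t\<close> the simplex is dilated about its barycentre by the factor \<open>1 + t\<close>; the part pushed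
  out of the simplex, detected by the gauge \<open>lam\<close>, is read off from \<open>B\<close>.\<close>

lemma homotopy_extension_simplex:
  fixes B :: "(nat \<Rightarrow> real) \<Rightarrow> real \<Rightarrow> 'b"
  assumes \<sigma>: "continuous_map (top_of_set (standard_simplex p)) Y \<sigma>"
    and B: "continuous_map (top_of_set (simplex_boundary p \<times> {0..1})) Y (case_prod B)"
    and B0: "\<And>y. y \<in> simplex_boundary p \<Longrightarrow> B y 0 = \<sigma> y"
  shows "\<exists>G. continuous_map (top_of_set (standard_simplex p \<times> {0..1})) Y (case_prod G)
     \<and> (\<forall>x\<in>standard_simplex p. G x 0 = \<sigma> x)
     \<and> (\<forall>y\<in>simplex_boundary p. \<forall>t\<in>{0..1}. G y t = B y t)"
proof -
  define b where "b = 1 / (real p + 1)"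
  \<comment> \<open>Normalised by the barycentric coordinate \<open>b\<close> so that the gauge is 0
    at the barycentre and 1 on the boundary.\<close>
  define lam where "lam = (\<lambda>x. 1 - (real p + 1) * mincoord p x)"
  define inner where "inner = (\<lambda>x t i. if i \<le> p then b + (1 + t) * (x i - b) else (0::real))"
  define outer where "outer = (\<lambda>x i. if i \<le> p then b + (x i - b) / lam x else (0::real))"
  \<comment> \<open>\<open>outer x\<close> is the radial projection to the boundary, and the excess
    of the dilated gauge over 1 serves as time. On the boundary the gauge is 1, so this time is
    \<open>t\<close> itself.\<close>
  define G where "G = (\<lambda>x t. if lam x * (1 + t) \<le> 1 then \<sigma> (inner x t) else B (outer x) (lam x * (1 + t) - 1))"
  have b: "(real p + 1) * b = 1" "b > 0" by (auto simp: b_def)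
  have m: "mincoord p x = b * (1 - lam x)" for x
  proof -
    have "b * (1 - lam x) = ((real p + 1) * b) * mincoord p x" unfolding lam_def by simp
    then show ?thesis using b by simp
  qed
  have lam1: "lam x \<le> 1" if "x \<in> standard_simplex p" for x
    using mincoord_attained [of p x] that by (auto simp: lam_def standard_simplex_def)
  have sumb: "(\<Sum>i\<le>p. x i - b) = 0" if "x \<in> standard_simplex p" for x
    using that b by (simp add: sum_subtractf standard_simplex_def algebra_simps)
  have inner: "inner x t \<in> standard_simplex p"
    if x: "x \<in> standard_simplex p" and t: "t \<in> {0..1}" and le: "lam x * (1 + t) \<le> 1" for x t
  proof (rule standard_simplexI)
    show "0 \<le> inner x t i" for i
    proof (cases "i \<le> p")
      case True
      have "(1 + t) * (b * lam x) \<le> b * 1" using le b by (simp add: mult_ac)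
      moreover have "(1 + t) * (x i - b) \<ge> (1 + t) * (- b * lam x)"
        using mincoord_le [OF True, of x] t unfolding m by (intro mult_left_mono) (auto simp: algebra_simps)
      ultimately show ?thesis using True by (simp add: inner_def)
    qed (simp add: inner_def)
    have "(\<Sum>i\<le>p. inner x t i) = (\<Sum>i\<le>p. b + (1 + t) * (x i - b))" by (simp add: inner_def)
    also have "\<dots> = (real p + 1) * b + (1 + t) * (\<Sum>i\<le>p. x i - b)"
      by (simp add: sum.distrib flip: sum_distrib_left)
    finally show "(\<Sum>i\<le>p. inner x t i) = 1" using sumb [OF x] b by simp
  qed (simp add: inner_def)
  have outer: "outer x \<in> simplex_boundary p" if x: "x \<in> standard_simplex p" and pos: "lam x > 0" for x
  proof -
    have nonneg: "0 \<le> outer x i" for i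
    proof (cases "i \<le> p")
      case True
      have "x i - b \<ge> - b * lam x" using mincoord_le [OF True, of x] by (simp add: m algebra_simps)
      then have "(x i - b) / lam x \<ge> - b" using pos by (simp add: field_simps)
      then show ?thesis using True by (simp add: outer_def)
    qed (simp add: outer_def)
    have "(\<Sum>i\<le>p. outer x i) = (\<Sum>i\<le>p. b + (x i - b) / lam x)" by (simp add: outer_def)
    also have "\<dots> = (real p + 1) * b + (\<Sum>i\<le>p. x i - b) / lam x"
      by (simp add: sum.distrib flip: sum_divide_distrib)
    finally have "outer x \<in> standard_simplex p"
      using sumb [OF x] b nonneg by (intro standard_simplexI) (auto simp: outer_def)
    moreover obtain i where i: "i \<le> p" "mincoord p x = x i" using mincoord_attained by blast
    have "outer x i = 0" using i m [of x] pos by (simp add: outer_def field_simps)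
    ultimately show ?thesis using i by (auto simp: simplex_boundary_def)
  qed
  have lamB: "lam y = 1" if "y \<in> simplex_boundary p" for y
  proof -
    from that obtain i where i: "i \<le> p" "y i = 0" unfolding simplex_boundary_def by blast
    have "mincoord p y = 0"
      using mincoord_le [OF i(1), of y] i mincoord_attained [of p y] that
      by (auto simp: simplex_boundary_def standard_simplex_def intro: antisym)
    then show ?thesis by (simp add: lam_def)
  qed
  have contlam: "continuous_on S (\<lambda>w. lam (fst w) * (1 + snd w))" for S
    unfolding lam_def by (intro continuous_intros continuous_on_mincoord)
  \<comment> \<open>On the outer part the gauge is positive, so the radial projection is defined and
    continuous there.\<close>
  have half: "lam x > 0" if "1 \<le> lam x * (1 + t)" "t \<in> {0..1}" for x t
  proof (rule ccontr)
    assume "\<not> 0 < lam x"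
    then have "lam x * (1 + t) \<le> 0" using that(2) by (simp add: mult_le_0_iff)
    then show False using that(1) by simp
  qed
  have "continuous_map (top_of_set (standard_simplex p \<times> {0..1})) Y
     (\<lambda>w. if lam (fst w) * (1 + snd w) \<le> 1 then \<sigma> (inner (fst w) (snd w))
          else (case_prod B) (outer (fst w), lam (fst w) * (1 + snd w) - 1))"
  proof (rule continuous_map_cases_le)
    show "continuous_map (top_of_set (standard_simplex p \<times> {0..1})) euclideanreal
        (\<lambda>w. lam (fst w) * (1 + snd w))"
      using contlam by simp
    show "continuous_map (top_of_set (standard_simplex p \<times> {0..1})) euclideanreal (\<lambda>w. 1)" by simp
    let ?S = "(standard_simplex p \<times> {0..1}) \<inter> {w \<in> standard_simplex p \<times> {0..1}. lam (fst w) * (1 + snd w) \<le> 1}"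
    have "continuous_on ?S (\<lambda>w. inner (fst w) (snd w))"
    proof (rule continuous_on_coordinatewise_then_product)
      show "continuous_on ?S (\<lambda>w. inner (fst w) (snd w) i)" for i
        unfolding inner_def
        by (cases "i \<le> p") (simp_all add: continuous_on_add continuous_on_mult continuous_on_diff
            continuous_on_const continuous_on_fst continuous_on_snd continuous_on_id continuous_on_coordinate)
    qed
    then have "continuous_map (top_of_set ?S) Y (\<lambda>w. \<sigma> (inner (fst w) (snd w)))"
      by (rule continuous_map_compose_on [OF \<sigma>]) (use inner in auto)
    then show "continuous_map (subtopology (top_of_set (standard_simplex p \<times> {0..1}))
        {w \<in> topspace (top_of_set (standard_simplex p \<times> {0..1})). lam (fst w) * (1 + snd w) \<le> 1})
        Y (\<lambda>w. \<sigma> (inner (fst w) (snd w)))"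
      by (simp add: subtopology_subtopology)
    let ?T = "(standard_simplex p \<times> {0..1}) \<inter> {w \<in> standard_simplex p \<times> {0..1}. 1 \<le> lam (fst w) * (1 + snd w)}"
    have "continuous_on ?T (\<lambda>w. outer (fst w))"
    proof (rule continuous_on_coordinatewise_then_product)
      have "continuous_on ?T (\<lambda>w. lam (fst w))"
        unfolding lam_def by (intro continuous_intros continuous_on_mincoord)
      moreover have "lam (fst w) \<noteq> 0" if "w \<in> ?T" for w
        using half [of "fst w" "snd w"] that by auto
      ultimately show "continuous_on ?T (\<lambda>w. outer (fst w) i)" for i
        unfolding outer_def
        by (cases "i \<le> p") (simp_all add: continuous_on_add continuous_on_divide continuous_on_diff
            continuous_on_const continuous_on_fst continuous_on_id continuous_on_coordinate)
    qed
    then have "continuous_map (top_of_set ?T) Y (\<lambda>w. (case_prod B) (outer (fst w), lam (fst w) * (1 + snd w) - 1))"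
    proof (intro continuous_map_compose_on [OF B] continuous_on_Pair continuous_on_diff contlam continuous_on_const)
      have "lam x * (1 + t) - 1 \<le> 1" if "x \<in> standard_simplex p" "t \<in> {0..1}" for x t
      proof -
        have "lam x * (1 + t) \<le> 1 * (1 + 1)" using lam1 [OF that(1)] that(2) by (intro mult_mono) auto
        then show ?thesis by simp
      qed
      then show "(\<lambda>w. (outer (fst w), lam (fst w) * (1 + snd w) - 1)) \<in> ?T \<rightarrow> simplex_boundary p \<times> {0..1}"
        using outer half by auto
    qed
    then show "continuous_map (subtopology (top_of_set (standard_simplex p \<times> {0..1}))
        {w \<in> topspace (top_of_set (standard_simplex p \<times> {0..1})). 1 \<le> lam (fst w) * (1 + snd w)})
        Y (\<lambda>w. (case_prod B) (outer (fst w), lam (fst w) * (1 + snd w) - 1))"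
      by (simp add: subtopology_subtopology)
    \<comment> \<open>On the interface \<open>1 + t\<close> is the inverse of the gauge, so the
      dilated point is the radial projection; the time is 0 there, where \<open>B\<close> agrees
      with \<open>\<sigma>\<close>.\<close>
    fix w assume w: "w \<in> topspace (top_of_set (standard_simplex p \<times> {0..1}))" and eq: "lam (fst w) * (1 + snd w) = 1"
    have pos: "lam (fst w) > 0" using half [of "fst w" "snd w"] w eq by auto
    have "1 + snd w = 1 / lam (fst w)" using eq pos by (simp add: field_simps)
    then have "inner (fst w) (snd w) = outer (fst w)"
      by (auto simp: inner_def outer_def)
    then show "\<sigma> (inner (fst w) (snd w)) = (case_prod B) (outer (fst w), lam (fst w) * (1 + snd w) - 1)"
      using B0 [OF outer, of "fst w"] w pos eq by auto
  qed
  moreover have "(\<lambda>w. if lam (fst w) * (1 + snd w) \<le> 1 then \<sigma> (inner (fst w) (snd w))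
          else (case_prod B) (outer (fst w), lam (fst w) * (1 + snd w) - 1)) = case_prod G"
    by (auto simp: G_def fun_eq_iff)
  ultimately have cont: "continuous_map (top_of_set (standard_simplex p \<times> {0..1})) Y (case_prod G)" by simp
  have id: "inner x 0 = x" if "x \<in> standard_simplex p" for x
    using that by (auto simp: inner_def standard_simplex_def)
  have "G x 0 = \<sigma> x" if "x \<in> standard_simplex p" for x
    using lam1 [OF that] id [OF that] by (simp add: G_def)
  moreover have "G y t = B y t" if y: "y \<in> simplex_boundary p" and t: "t \<in> {0..1}" for y t
  proof (cases "t = 0")
    case True
    then show ?thesis using y B0 lamB id by (simp add: G_def simplex_boundary_def)
  next
    case False
    have "outer y = y" using y lamB [OF y] by (auto simp: outer_def simplex_boundary_def standard_simplex_def)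
    then show ?thesis using False t lamB [OF y] by (simp add: G_def)
  qed
  ultimately show ?thesis using cont by blast
qed

text \<open>The faces are a finite closed cover of the boundary, so homotopies on them that agree on
  overlaps can be pasted. Applied with \<open>p = 1\<close> to extend from vertices to an edge and
  with \<open>p = 2\<close> to extend from edges to a triangle.\<close>

lemma homotopy_extension_faces:
  fixes F :: "nat \<Rightarrow> (nat \<Rightarrow> real) \<Rightarrow> real \<Rightarrow> 'b"
  assumes \<sigma>: "continuous_map (top_of_set (standard_simplex p)) Y \<sigma>"
    and F: "\<And>i. i \<le> p \<Longrightarrow>
       continuous_map (top_of_set ({y \<in> standard_simplex p. y i = 0} \<times> {0..1})) Y (case_prod (F i))"
    and FF: "\<And>i j y t. \<lbrakk>i \<le> p; j \<le> p; y \<in> standard_simplex p; y i = 0; y j = 0; t \<in> {0..1}\<rbrakk>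
       \<Longrightarrow> F i y t = F j y t"
    and F0: "\<And>i y. \<lbrakk>i \<le> p; y \<in> standard_simplex p; y i = 0\<rbrakk> \<Longrightarrow> F i y 0 = \<sigma> y"
  shows "\<exists>G. continuous_map (top_of_set (standard_simplex p \<times> {0..1})) Y (case_prod G)
     \<and> (\<forall>x\<in>standard_simplex p. G x 0 = \<sigma> x)
     \<and> (\<forall>i\<le>p. \<forall>y\<in>standard_simplex p. \<forall>t\<in>{0..1}. y i = 0 \<longrightarrow> G y t = F i y t)"
proof -
  let ?S = "simplex_boundary p \<times> {0..1::real}"
  obtain B where B: "continuous_map (top_of_set ?S) Y B"
    and BF: "\<And>w i. \<lbrakk>i \<in> {..p}; w \<in> topspace (top_of_set ?S) \<inter> {w \<in> ?S. fst w i = 0}\<rbrakk> \<Longrightarrow> B w = case_prod (F i) w"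
  proof (rule pasting_lemma_exists_closed [of "{..p}" "top_of_set ?S" "\<lambda>i. {w \<in> ?S. fst w i = 0}" Y "\<lambda>i. case_prod (F i)"])
    show "topspace (top_of_set ?S) \<subseteq> (\<Union>i\<in>{..p}. {w \<in> ?S. fst w i = 0})"
      by (auto simp: simplex_boundary_def)
    show "closedin (top_of_set ?S) {w \<in> ?S. fst w i = 0}" for i
      by (intro continuous_closedin_preimage_constant continuous_on_coordinate continuous_on_fst continuous_on_id)
    show "continuous_map (subtopology (top_of_set ?S) {w \<in> ?S. fst w i = 0}) Y (case_prod (F i))"
      if "i \<in> {..p}" for i
    proof -
      have "?S \<inter> {w \<in> ?S. fst w i = 0} = {y \<in> standard_simplex p. y i = 0} \<times> {0..1}"
        using that by (auto simp: simplex_boundary_def)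
      then show ?thesis using F that by (simp only: subtopology_subtopology atMost_iff)
    qed
    show "case_prod (F i) w = case_prod (F j) w"
      if "i \<in> {..p}" "j \<in> {..p}" "w \<in> topspace (top_of_set ?S) \<inter> {w \<in> ?S. fst w i = 0} \<inter> {w \<in> ?S. fst w j = 0}"
      for i j w
    proof -
      obtain y t where w: "w = (y, t)" by fastforce
      then have "y \<in> standard_simplex p" "y i = 0" "y j = 0" "t \<in> {0..1}"
        using that(3) by (auto simp: simplex_boundary_def)
      then show ?thesis unfolding w prod.case using that(1,2) by (intro FF) auto
    qed
  qed auto
  have BF': "B (y, t) = F i y t" if "i \<le> p" "y \<in> standard_simplex p" "y i = 0" "t \<in> {0..1}" for i y t
    using BF [of i "(y, t)"] that by (auto simp: simplex_boundary_def)
  have "\<exists>G. continuous_map (top_of_set (standard_simplex p \<times> {0..1})) Y (case_prod G)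
     \<and> (\<forall>x\<in>standard_simplex p. G x 0 = \<sigma> x)
     \<and> (\<forall>y\<in>simplex_boundary p. \<forall>t\<in>{0..1}. G y t = B (y, t))"
  proof (rule homotopy_extension_simplex [OF \<sigma>])
    show "continuous_map (top_of_set ?S) Y (\<lambda>(x, t). B (x, t))" using B by simp
    show "B (y, 0) = \<sigma> y" if "y \<in> simplex_boundary p" for y
      using that BF' F0 by (force simp: simplex_boundary_def)
  qed
  then obtain G where G: "continuous_map (top_of_set (standard_simplex p \<times> {0..1})) Y (case_prod G)"
    "\<And>x. x \<in> standard_simplex p \<Longrightarrow> G x 0 = \<sigma> x"
    "\<And>y t. \<lbrakk>y \<in> simplex_boundary p; t \<in> {0..1}\<rbrakk> \<Longrightarrow> G y t = B (y, t)" by blast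
  have "G y t = F i y t" if "i \<le> p" "y \<in> standard_simplex p" "t \<in> {0..1}" "y i = 0" for i y t
    using G(3) [of y t] BF' that by (auto simp: simplex_boundary_def)
  with G(1,2) show ?thesis by blast
qed

section \<open>Sliding vertices around the circles\<close>

abbreviation vertex :: "nat \<Rightarrow> nat \<Rightarrow> real" where
  "vertex i \<equiv> (\<lambda>j. if j = i then 1 else 0)"

lemma standard_simplex_1D:
  assumes "x \<in> standard_simplex 1"
  shows "x 0 + x 1 = 1" "x 0 = 0 \<Longrightarrow> x = vertex 1" "x 1 = 0 \<Longrightarrow> x = vertex 0"
proof -
  have *: "x 0 + x 1 = 1" "\<And>i. i > 1 \<Longrightarrow> x i = 0"
    using assms by (auto simp: standard_simplex_def)
  then show "x 0 + x 1 = 1" by simp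
  show "x = vertex 1" if "x 0 = 0"
  proof
    fix i show "x i = vertex 1 i"
      using * that by (cases "i = 0"; cases "i = 1") auto
  qed
  show "x = vertex 0" if "x 1 = 0"
  proof
    fix i show "x i = vertex 0 i"
      using * that by (cases "i = 0"; cases "i = 1") auto
  qed
qed

lemma standard_simplex_2D:
  assumes "x \<in> standard_simplex 2"
  shows "x 0 + x 1 + x 2 = 1" "\<And>i. i > 2 \<Longrightarrow> x i = 0"
  using assms by (auto simp: standard_simplex_def numeral_2_eq_2)

definition drop_coord :: "nat \<Rightarrow> (nat \<Rightarrow> real) \<Rightarrow> nat \<Rightarrow> real" where
  "drop_coord i y = (\<lambda>j. if j < i then y j else y (Suc j))"

lemma simplical_face_drop_coord: "y i = 0 \<Longrightarrow> simplical_face i (drop_coord i y) = y"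
  by (auto simp: simplical_face_def drop_coord_def fun_eq_iff)

lemma drop_coord_simplical_face: "drop_coord i (simplical_face i x) = x"
  by (auto simp: simplical_face_def drop_coord_def fun_eq_iff)

lemma drop_coord_in_simplex:
  assumes "y \<in> standard_simplex 2" "y i = 0" "i \<le> 2"
  shows "drop_coord i y \<in> standard_simplex 1"
proof (rule standard_simplexI)
  have y: "y 0 + y 1 + y 2 = 1" "\<And>i. i > 2 \<Longrightarrow> y i = 0" "\<And>i. 0 \<le> y i"
    using standard_simplex_2D [OF assms(1)] assms(1) by (simp_all add: standard_simplex_def)
  show "0 \<le> drop_coord i y j" for j using y by (simp add: drop_coord_def)
  show "drop_coord i y j = 0" if "1 < j" for j using y that assms(3) by (simp add: drop_coord_def)
  consider "i = 0" | "i = 1" | "i = 2" using assms(3) by linarith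
  then show "(\<Sum>j\<le>1. drop_coord i y j) = 1"
    using y(1) assms(2) by cases (simp_all add: drop_coord_def numeral_2_eq_2)
qed

lemma face_in_simplex_2: "x \<in> standard_simplex 1 \<Longrightarrow> i \<le> 2 \<Longrightarrow> simplical_face i x \<in> standard_simplex 2"
  using simplical_face_in_standard_simplex [of 2 i x] by simp

lemma continuous_on_if_const:
  "\<lbrakk>P \<Longrightarrow> continuous_on S f; \<not> P \<Longrightarrow> continuous_on S g\<rbrakk> \<Longrightarrow> continuous_on S (\<lambda>x. if P then f x else g x)"
  by (cases P) simp_all

lemma singular_face_apply: "x \<in> standard_simplex 1 \<Longrightarrow> singular_face 2 i \<sigma> x = \<sigma> (simplical_face i x)"
  by (simp add: singular_face_def)

lemma simplical_face_vertex:
  "simplical_face 0 (vertex 0) = vertex 1" "simplical_face 0 (vertex 1) = vertex 2"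
  "simplical_face 1 (vertex 0) = vertex 0" "simplical_face 1 (vertex 1) = vertex 2"
  "simplical_face 2 (vertex 0) = vertex 0" "simplical_face 2 (vertex 1) = vertex 1"
  by (auto simp: simplical_face_def fun_eq_iff)

text \<open>\<open>A\<close> is a disjoint union of \<open>k\<close> circles, the \<open>j\<close>-th being parametrised by \<open>cA j\<close> with period \<open>1\<close>.\<close>

locale circle_end =
  fixes Y :: "'b topology" and A :: "'b set" and k :: nat and cA :: "nat \<Rightarrow> real \<Rightarrow> 'b"
  assumes cA_cont: "j < k \<Longrightarrow> continuous_map euclideanreal (subtopology Y A) (cA j)"
    and cA_eq: "\<lbrakk>j < k; j' < k\<rbrakk> \<Longrightarrow> cA j s = cA j' t \<longleftrightarrow> j = j' \<and> s - t \<in> \<int>"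
    and lift_exists: "\<lbrakk>p \<le> 2; singular_simplex p (subtopology Y A) \<sigma>\<rbrakk> \<Longrightarrow>
       \<exists>j<k. \<exists>g. continuous_on (standard_simplex p) g \<and> (\<forall>x\<in>standard_simplex p. \<sigma> x = cA j (g x))"
begin

definition lifts :: "nat \<Rightarrow> 'b ssimplex \<Rightarrow> nat \<Rightarrow> ((nat \<Rightarrow> real) \<Rightarrow> real) \<Rightarrow> bool" where
  "lifts p \<sigma> j g \<longleftrightarrow> j < k \<and> continuous_on (standard_simplex p) g \<and>
      (\<forall>x\<in>standard_simplex p. \<sigma> x = cA j (g x))"

lemma cA_shift: "j < k \<Longrightarrow> m \<in> \<int> \<Longrightarrow> cA j (s + m) = cA j s"
  using cA_eq by simp

lemma continuous_map_cA:
  assumes "j < k" "continuous_on S f"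
  shows "continuous_map (top_of_set S) (subtopology Y A) (\<lambda>x. cA j (f x))"
  using continuous_map_compose [of "top_of_set S" euclideanreal f "subtopology Y A" "cA j"] assms cA_cont
  by (simp add: o_def)

text \<open>The difference of two lifts is a continuous function with integer values on a connected
  set.\<close>

lemma lifts_unique:
  assumes "lifts p \<sigma> j g" "lifts p \<sigma> j' g'"
  shows "j' = j" and "\<exists>m\<in>\<int>. \<forall>x\<in>standard_simplex p. g' x = g x + m"
proof -
  have eq: "cA j (g x) = cA j' (g' x)" "j < k" "j' < k" if "x \<in> standard_simplex p" for x
    using assms that by (auto simp: lifts_def)
  obtain x0 where x0: "x0 \<in> standard_simplex p" using nonempty_standard_simplex by blast
  show j: "j' = j" using eq [OF x0] cA_eq by blast
  have int: "g' x - g x \<in> \<int>" if "x \<in> standard_simplex p" for x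
  proof -
    have "g x - g' x \<in> \<int>" using eq [OF that] cA_eq by blast
    then show ?thesis by (metis Ints_minus minus_diff_eq)
  qed
  have "(\<lambda>x. g' x - g x) constant_on standard_simplex p"
  proof (rule continuous_discrete_range_constant)
    show "connected (standard_simplex p)"
      using connectedin_standard_simplex [of p] by (simp add: euclidean_product_topology)
    show "continuous_on (standard_simplex p) (\<lambda>x. g' x - g x)"
      using assms by (auto simp: lifts_def intro: continuous_on_diff)
    fix x assume x: "x \<in> standard_simplex p"
    have "1 \<le> norm (g' y - g y - (g' x - g x))"
      if "y \<in> standard_simplex p" "g' y - g y \<noteq> g' x - g x" for y
    proof -
      have "g' y - g y - (g' x - g x) \<in> \<int>" by (rule Ints_diff [OF int [OF that(1)] int [OF x]])
      moreover have "g' y - g y - (g' x - g x) \<noteq> 0" using that(2) by simp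
      ultimately show ?thesis unfolding real_norm_def by (rule Ints_nonzero_abs_ge1)
    qed
    then show "\<exists>e>0. \<forall>y. y \<in> standard_simplex p \<and> g' y - g y \<noteq> g' x - g x \<longrightarrow> e \<le> norm (g' y - g y - (g' x - g x))"
      by (intro exI [of _ 1]) auto
  qed
  then obtain m where m: "\<And>x. x \<in> standard_simplex p \<Longrightarrow> g' x - g x = m"
    unfolding constant_on_def by blast
  have "m \<in> \<int>" using int [OF x0] m [OF x0] by simp
  moreover have "\<forall>x\<in>standard_simplex p. g' x = g x + m" using m by force
  ultimately show "\<exists>m\<in>\<int>. \<forall>x\<in>standard_simplex p. g' x = g x + m" by blast
qed

lemma lifts_face:
  assumes "lifts 2 \<sigma> j g" "i \<le> 2"
  shows "lifts 1 (singular_face 2 i \<sigma>) j (\<lambda>x. g (simplical_face i x))"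
proof -
  have "continuous_on (standard_simplex 1) (simplical_face i :: (nat \<Rightarrow> real) \<Rightarrow> _)"
    unfolding simplical_face_def
    by (rule continuous_on_coordinatewise_then_product)
      (intro continuous_on_if_const continuous_on_coordinate continuous_on_id continuous_on_const)
  moreover have "continuous_on (simplical_face i ` standard_simplex 1) g"
    using assms face_in_simplex_2 by (auto simp: lifts_def intro: continuous_on_subset)
  ultimately have "continuous_on (standard_simplex 1) (\<lambda>x. g (simplical_face i x))"
    using continuous_on_compose [of "standard_simplex 1" "simplical_face i" g] by (simp add: o_def)
  then show ?thesis using assms face_in_simplex_2 by (auto simp: lifts_def singular_face_apply)
qed

text \<open>One angle is fixed for every point of the circles. It need not vary continuously with
  the point, since it is only used at vertices, but it must depend on the point alone so that
  simplices with a common vertex agree.\<close>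

definition vindex :: "'b \<Rightarrow> nat" where "vindex v = (SOME j. j < k \<and> (\<exists>s. v = cA j s))"
definition vangle :: "'b \<Rightarrow> real" where "vangle v = (SOME s. v = cA (vindex v) s)"

lemma vindex_cA: "j < k \<Longrightarrow> vindex (cA j s) = j"
  unfolding vindex_def
proof (rule some_equality)
  show "i = j" if "j < k" "i < k \<and> (\<exists>t. cA j s = cA i t)" for i
    using that cA_eq by blast
qed blast

lemma cA_vangle: "j < k \<Longrightarrow> cA j (vangle (cA j s)) = cA j s"
  unfolding vangle_def vindex_cA by (rule someI [where P = "\<lambda>t. cA j s = cA j t", symmetric]) simp

lemma vangle_Ints: "j < k \<Longrightarrow> s - vangle (cA j s) \<in> \<int>"
  using cA_vangle [of j s] cA_eq [of j j s "vangle (cA j s)"] by simp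

text \<open>A point of a circle travels from its chosen angle to the integer \<open>n\<close>. It
  always ends at the base point of angle 0, and \<open>n\<close> decides how many turns it makes;
  points off the circles rest.\<close>

definition vpath :: "'b \<Rightarrow> int \<Rightarrow> real \<Rightarrow> 'b" where
  "vpath v n t = (if \<exists>j<k. \<exists>s. v = cA j s
     then cA (vindex v) ((1 - t) * vangle v + t * of_int n) else v)"

lemma vpath_cA: "j < k \<Longrightarrow> vpath (cA j s) n t = cA j ((1 - t) * vangle (cA j s) + t * of_int n)"
  by (auto simp: vpath_def vindex_cA)

lemma vpath_0: "vpath v n 0 = v"
  using cA_vangle by (auto simp: vpath_def vindex_cA)

lemma continuous_map_vpath:
  assumes "v \<in> topspace Y"
  shows "continuous_map (top_of_set S) Y (vpath v n)"
proof (cases "\<exists>j<k. \<exists>s. v = cA j s")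
  case True
  then obtain j s where j: "j < k" "v = cA j s" by blast
  have "continuous_map (top_of_set S) (subtopology Y A) (\<lambda>t. cA j ((1 - t) * vangle v + t * of_int n))"
    by (intro continuous_map_cA j continuous_intros)
  moreover have "vpath v n = (\<lambda>t. cA j ((1 - t) * vangle v + t * of_int n))"
    using j vpath_cA by auto
  ultimately show ?thesis by (simp only: continuous_map_in_subtopology)
next
  case False
  then have "vpath v n = (\<lambda>t. v)" unfolding vpath_def by (simp del: not_ex ex_simps)
  then show ?thesis using assms by simp
qed

text \<open>Straight homotopy from the lift \<open>g\<close> to an affine function. At a vertex
  \<open>g\<close> differs from the chosen angle by an integer, so the lift of \<open>vpath\<close>
  that starts at \<open>g\<close> ends at \<open>n\<close> plus this integer; these are the vertex
  values of the affine function.\<close>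

definition slide :: "'b ssimplex \<Rightarrow> ((nat \<Rightarrow> real) \<Rightarrow> real) \<Rightarrow> int \<Rightarrow> int \<Rightarrow> (nat \<Rightarrow> real) \<Rightarrow> real \<Rightarrow> real" where
  "slide e g n0 n1 x t = (1 - t) * g x
     + t * (x 0 * (of_int n0 + g (vertex 0) - vangle (e (vertex 0)))
          + x 1 * (of_int n1 + g (vertex 1) - vangle (e (vertex 1))))"

text \<open>The last clause speaks of all lifts at once, which is consistent by
  \<open>slide_independent\<close>. It keeps an edge of a circle inside the circle and makes it
  straight at time 1.\<close>

definition edge_homotopy :: "'b ssimplex \<Rightarrow> int \<Rightarrow> int \<Rightarrow> ((nat \<Rightarrow> real) \<Rightarrow> real \<Rightarrow> 'b) \<Rightarrow> bool" where
  "edge_homotopy e n0 n1 E \<longleftrightarrow>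
     continuous_map (top_of_set (standard_simplex 1 \<times> {0..1})) Y (case_prod E) \<and>
     (\<forall>x\<in>standard_simplex 1. E x 0 = e x) \<and>
     (\<forall>t\<in>{0..1}. E (vertex 0) t = vpath (e (vertex 0)) n0 t \<and> E (vertex 1) t = vpath (e (vertex 1)) n1 t) \<and>
     (\<forall>j g. lifts 1 e j g \<longrightarrow> (\<forall>x\<in>standard_simplex 1. \<forall>t\<in>{0..1}. E x t = cA j (slide e g n0 n1 x t)))"

text \<open>The weights \<open>1 - t\<close>, \<open>t * x 0\<close> and \<open>t * x 1\<close> add
  up to 1, so an integer constant added to the lift is added to the slide.\<close>

lemma slide_independent:
  assumes "lifts 1 e j g" "lifts 1 e j' g'" "x \<in> standard_simplex 1"
  shows "cA j' (slide e g' n0 n1 x t) = cA j (slide e g n0 n1 x t)"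
proof -
  obtain m where m: "m \<in> \<int>" "\<And>x. x \<in> standard_simplex 1 \<Longrightarrow> g' x = g x + m" and j: "j' = j"
    using lifts_unique [OF assms(1,2)] by blast
  have 1: "x 0 = 1 - x 1" using standard_simplex_1D(1) [OF assms(3)] by simp
  have "g' x = g x + m" "g' (vertex 0) = g (vertex 0) + m" "g' (vertex 1) = g (vertex 1) + m"
    using m(2) assms(3) by simp_all
  then have "slide e g' n0 n1 x t = slide e g n0 n1 x t + m"
    unfolding slide_def 1 by (simp add: algebra_simps)
  then show ?thesis using j m(1) assms(1) by (simp add: cA_shift lifts_def)
qed

lemma continuous_on_slide:
  assumes "lifts 1 e j g"
  shows "continuous_on (standard_simplex 1 \<times> {0..1}) (\<lambda>w. slide e g n0 n1 (fst w) (snd w))"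
proof -
  have "continuous_on (standard_simplex 1 \<times> {0..1::real}) (\<lambda>w. g (fst w))"
    by (rule continuous_on_compose2 [of "standard_simplex 1" g])
      (use assms in \<open>auto simp: lifts_def intro: continuous_on_fst\<close>)
  moreover have "continuous_on S (\<lambda>w. fst w i)" for S :: "((nat \<Rightarrow> real) \<times> real) set" and i
    by (intro continuous_on_coordinate continuous_on_fst continuous_on_id)
  ultimately show ?thesis unfolding slide_def
    by (intro continuous_on_add continuous_on_mult continuous_on_diff continuous_on_const
        continuous_on_snd continuous_on_id)
qed

lemma edge_homotopy_exists:
  assumes e: "singular_simplex 1 Y e"
  shows "\<exists>E. edge_homotopy e n0 n1 E"
proof (cases "\<exists>j g. lifts 1 e j g")
  case True
  then obtain j g where l: "lifts 1 e j g" by blast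
  then have j: "j < k" and eg: "\<And>x. x \<in> standard_simplex 1 \<Longrightarrow> e x = cA j (g x)"
    by (auto simp: lifts_def)
  let ?E = "\<lambda>x t. cA j (slide e g n0 n1 x t)"
  have "continuous_map (top_of_set (standard_simplex 1 \<times> {0..1})) Y (case_prod ?E)"
    using continuous_map_cA [OF j continuous_on_slide [OF l, of n0 n1]]
    by (simp add: split_def continuous_map_in_subtopology)
  moreover have "?E (vertex i) t = vpath (e (vertex i)) (if i = 0 then n0 else n1) t"
    if i: "i \<le> 1" for i t
  proof -
    define m where "m = g (vertex i) - vangle (e (vertex i))"
    have v: "e (vertex i) = cA j (g (vertex i))" using eg i by simp
    have m: "m \<in> \<int>" unfolding m_def v by (rule vangle_Ints [OF j])
    have "slide e g n0 n1 (vertex i) t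
        = ((1 - t) * vangle (e (vertex i)) + t * of_int (if i = 0 then n0 else n1)) + m"
    proof -
      consider "i = 0" | "i = 1" using i by linarith
      then show ?thesis by cases (simp_all add: slide_def m_def algebra_simps)
    qed
    moreover have "vpath (e (vertex i)) (if i = 0 then n0 else n1) t
        = cA j ((1 - t) * vangle (e (vertex i)) + t * of_int (if i = 0 then n0 else n1))"
      using vpath_cA [OF j, of "g (vertex i)"] v by simp
    ultimately show ?thesis using cA_shift [OF j m] by simp
  qed
  from this [of 0] this [of 1]
  have "?E (vertex 0) t = vpath (e (vertex 0)) n0 t" "?E (vertex 1) t = vpath (e (vertex 1)) n1 t" for t
    by simp_all
  moreover have "\<forall>x\<in>standard_simplex 1. ?E x 0 = e x" using eg by (simp add: slide_def)
  ultimately have "edge_homotopy e n0 n1 ?E"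
    unfolding edge_homotopy_def using slide_independent l by blast
  then show ?thesis by blast
next
  case False
  have ce: "continuous_map (top_of_set (standard_simplex 1)) Y e"
    using e by (simp add: singular_simplex_iff_top_of_set)
  \<comment> \<open>The face \<open>y 0 = 0\<close> of an edge is its vertex 1, and conversely;
    hence the exchanged ends.\<close>
  let ?F = "\<lambda>i (y :: nat \<Rightarrow> real) t. if i = (0::nat) then vpath (e (vertex 1)) n1 t else vpath (e (vertex 0)) n0 t"
  have ev: "e (vertex i) \<in> topspace Y" if "i \<le> 1" for i
    using continuous_map_funspace [OF ce] that by auto
  have "\<exists>G. continuous_map (top_of_set (standard_simplex 1 \<times> {0..1})) Y (case_prod G)
     \<and> (\<forall>x\<in>standard_simplex 1. G x 0 = e x)
     \<and> (\<forall>i\<le>1. \<forall>y\<in>standard_simplex 1. \<forall>t\<in>{0..1}. y i = 0 \<longrightarrow> G y t = ?F i y t)"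
  proof (rule homotopy_extension_faces [OF ce])
    fix i :: nat assume i: "i \<le> 1"
    let ?S = "{y \<in> standard_simplex 1. y i = 0} \<times> {0..1}"
    have "continuous_map (top_of_set ?S) Y (\<lambda>w. vpath (e (vertex j)) n (snd w))" if "j \<le> 1" for j n
      by (rule continuous_map_compose_on [OF continuous_map_vpath [OF ev [OF that]], of _ _ UNIV])
         (auto intro: continuous_on_snd)
    from this [of 0 n0] this [of 1 n1] show "continuous_map (top_of_set ?S) Y (case_prod (?F i))"
      by (cases "i = 0") (simp_all add: split_def)
    fix y :: "nat \<Rightarrow> real" assume y: "y \<in> standard_simplex 1" "y i = 0"
    then show "?F i y 0 = e y"
      using i standard_simplex_1D [OF y(1)] by (cases "i = 0") (auto simp: vpath_0 le_Suc_eq)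
    fix t :: real and j :: nat assume j: "j \<le> 1" "y j = 0"
    then have "i = j" using i y standard_simplex_1D(1) [OF y(1)] by (auto simp: le_Suc_eq)
    then show "?F i y t = ?F j y t" by simp
  qed
  then obtain G where G: "continuous_map (top_of_set (standard_simplex 1 \<times> {0..1})) Y (case_prod G)"
     "\<forall>x\<in>standard_simplex 1. G x 0 = e x"
     "\<And>i y t. \<lbrakk>i \<le> 1; y \<in> standard_simplex 1; t \<in> {0..1}; y i = 0\<rbrakk> \<Longrightarrow> G y t = ?F i y t" by blast
  have "G (vertex 0) t = vpath (e (vertex 0)) n0 t" "G (vertex 1) t = vpath (e (vertex 1)) n1 t"
    if "t \<in> {0..1}" for t
    using G(3) [of 1 "vertex 0" t] G(3) [of 0 "vertex 1" t] that by simp_all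
  then have "edge_homotopy e n0 n1 G" unfolding edge_homotopy_def using G(1,2) False by blast
  then show ?thesis by blast
qed

text \<open>The choice depends on the edge and its two numbers only, so triangles with a common edge
  receive the same homotopy on it.\<close>

definition edge_slide :: "'b ssimplex \<Rightarrow> int \<Rightarrow> int \<Rightarrow> (nat \<Rightarrow> real) \<Rightarrow> real \<Rightarrow> 'b" where
  "edge_slide e n0 n1 = (SOME E. edge_homotopy e n0 n1 E)"

lemma edge_homotopy_edge_slide: "singular_simplex 1 Y e \<Longrightarrow> edge_homotopy e n0 n1 (edge_slide e n0 n1)"
  unfolding edge_slide_def using edge_homotopy_exists by (rule someI_ex)

definition triangle_homotopy :: "'b ssimplex \<Rightarrow> int \<Rightarrow> int \<Rightarrow> int \<Rightarrow> ((nat \<Rightarrow> real) \<Rightarrow> real \<Rightarrow> 'b) \<Rightarrow> bool" where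
  "triangle_homotopy \<sigma> n0 n1 n2 G \<longleftrightarrow>
    continuous_map (top_of_set (standard_simplex 2 \<times> {0..1})) Y (case_prod G)
    \<and> (\<forall>x\<in>standard_simplex 2. G x 0 = \<sigma> x)
    \<and> (\<forall>x\<in>standard_simplex 1. \<forall>t\<in>{0..1}.
        G (simplical_face 0 x) t = edge_slide (singular_face 2 0 \<sigma>) n1 n2 x t
      \<and> G (simplical_face 1 x) t = edge_slide (singular_face 2 1 \<sigma>) n0 n2 x t
      \<and> G (simplical_face 2 x) t = edge_slide (singular_face 2 2 \<sigma>) n0 n1 x t)"

lemma triangle_homotopy_exists:
  assumes \<sigma>: "singular_simplex 2 Y \<sigma>"
  shows "\<exists>G. triangle_homotopy \<sigma> n0 n1 n2 G"
proof -
  define E where "E = (\<lambda>i. edge_slide (singular_face 2 i \<sigma>) (if i = 0 then n1 else n0) (if i = 2 then n1 else n2))"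
  define n where "n = (\<lambda>i::nat. if i = 0 then n0 else if i = 1 then n1 else n2)"
  have c\<sigma>: "continuous_map (top_of_set (standard_simplex 2)) Y \<sigma>"
    using \<sigma> by (simp add: singular_simplex_iff_top_of_set)
  have face: "singular_simplex 1 Y (singular_face 2 i \<sigma>)" if "i \<le> 2" for i
    using singular_simplex_singular_face [OF \<sigma>, of i] that by simp
  have eh: "edge_homotopy (singular_face 2 i \<sigma>) (if i = 0 then n1 else n0) (if i = 2 then n1 else n2) (E i)"
    if "i \<le> 2" for i
    unfolding E_def by (rule edge_homotopy_edge_slide [OF face [OF that]])
  \<comment> \<open>At a corner both adjacent edges move along the \<open>vpath\<close> of that
    vertex with the number of that vertex, so they are compatible.\<close>
  have corner: "E i (drop_coord i (vertex l)) t = vpath (\<sigma> (vertex l)) (n l) t"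
    if i: "i \<le> 2" "l \<le> 2" "i \<noteq> l" and t: "t \<in> {0..1}" for i l t
  proof -
    have "E i (vertex 0) t = vpath (singular_face 2 i \<sigma> (vertex 0)) (if i = 0 then n1 else n0) t"
      "E i (vertex 1) t = vpath (singular_face 2 i \<sigma> (vertex 1)) (if i = 2 then n1 else n2) t"
      using eh [OF i(1)] t unfolding edge_homotopy_def by blast+
    then have E: "E i (vertex 0) t = vpath (\<sigma> (simplical_face i (vertex 0))) (if i = 0 then n1 else n0) t"
      "E i (vertex 1) t = vpath (\<sigma> (simplical_face i (vertex 1))) (if i = 2 then n1 else n2) t"
      by (simp_all add: singular_face_apply)
    consider "i = 0" "l = 1" | "i = 0" "l = 2" | "i = 1" "l = 0" | "i = 1" "l = 2" | "i = 2" "l = 0" | "i = 2" "l = 1"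
      using i by (auto simp: le_Suc_eq numeral_2_eq_2)
    then show ?thesis
      using E drop_coord_simplical_face [of i "vertex 0"] drop_coord_simplical_face [of i "vertex 1"]
      unfolding n_def
      by cases (simp_all only: simplical_face_vertex if_True if_False zero_neq_one one_neq_zero numeral_eq_one_iff
          zero_neq_numeral numeral_neq_zero one_eq_numeral_iff num.distinct simp_thms)
  qed
  have "\<exists>G. continuous_map (top_of_set (standard_simplex 2 \<times> {0..1})) Y (case_prod G)
     \<and> (\<forall>x\<in>standard_simplex 2. G x 0 = \<sigma> x)
     \<and> (\<forall>i\<le>2. \<forall>y\<in>standard_simplex 2. \<forall>t\<in>{0..1}. y i = 0 \<longrightarrow> G y t = E i (drop_coord i y) t)"
  proof (rule homotopy_extension_faces [OF c\<sigma>])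
    fix i :: nat assume i: "i \<le> 2"
    let ?S = "{y \<in> standard_simplex 2. y i = 0} \<times> {0..1::real}"
    have "continuous_map (top_of_set ?S) Y (\<lambda>w. case_prod (E i) (drop_coord i (fst w), snd w))"
    proof (rule continuous_map_compose_on)
      show "continuous_map (top_of_set (standard_simplex 1 \<times> {0..1})) Y (case_prod (E i))"
        using eh [OF i] unfolding edge_homotopy_def by blast
      have "continuous_on ?S (\<lambda>w. drop_coord i (fst w))"
        unfolding drop_coord_def
        by (rule continuous_on_coordinatewise_then_product)
          (intro continuous_on_if_const continuous_on_coordinate continuous_on_fst continuous_on_id)
      then show "continuous_on ?S (\<lambda>w. (drop_coord i (fst w), snd w))"
        by (intro continuous_on_Pair continuous_on_snd continuous_on_id)
    qed (use drop_coord_in_simplex i in auto)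
    then show "continuous_map (top_of_set ?S) Y (\<lambda>(y, t). E i (drop_coord i y) t)"
      by (simp add: split_def)
    fix y :: "nat \<Rightarrow> real" assume y: "y \<in> standard_simplex 2" "y i = 0"
    have "E i (drop_coord i y) 0 = singular_face 2 i \<sigma> (drop_coord i y)"
      using eh [OF i] drop_coord_in_simplex [OF y i] unfolding edge_homotopy_def by blast
    then show "E i (drop_coord i y) 0 = \<sigma> y"
      using simplical_face_drop_coord [of y i] y(2) drop_coord_in_simplex [OF y i] by (simp add: singular_face_apply)
    fix t :: real and j :: nat assume j: "j \<le> 2" "y j = 0" and t: "t \<in> {0..1}"
    show "E i (drop_coord i y) t = E j (drop_coord j y) t"
    proof (cases "i = j")
      case False
      \<comment> \<open>Two different edges of a triangle meet in exactly one vertex, and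
        \<open>corner\<close> treats it.\<close>
      obtain l where l: "l \<le> 2" "l \<noteq> i" "l \<noteq> j"
      proof -
        have "\<exists>l\<le>2. l \<noteq> i \<and> l \<noteq> j" using i j(1) by presburger
        then show ?thesis using that by blast
      qed
      have "y = vertex l"
      proof
        fix m
        have "l = 0 \<or> l = 1 \<or> l = 2" "i = 0 \<or> i = 1 \<or> i = 2" "j = 0 \<or> j = 1 \<or> j = 2"
          using l i j by linarith+
        then have "y l = 1" "m \<le> 2 \<Longrightarrow> m \<noteq> l \<Longrightarrow> m = i \<or> m = j"
          using l y j(2) False standard_simplex_2D(1) [OF y(1)] by auto
        then show "y m = vertex l m"
          using y(2) j(2) standard_simplex_2D(2) [OF y(1), of m] l(1)
          by (cases "m \<le> 2"; cases "m = l") auto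
      qed
      then show ?thesis using corner l i j t by simp
    qed simp
  qed
  then obtain G where G: "continuous_map (top_of_set (standard_simplex 2 \<times> {0..1})) Y (case_prod G)"
     "\<forall>x\<in>standard_simplex 2. G x 0 = \<sigma> x"
     "\<And>i y t. \<lbrakk>i \<le> 2; y \<in> standard_simplex 2; t \<in> {0..1}; y i = 0\<rbrakk> \<Longrightarrow> G y t = E i (drop_coord i y) t" by blast
  have "G (simplical_face i x) t = E i x t" if "i \<le> 2" "x \<in> standard_simplex 1" "t \<in> {0..1}" for i x t
    using G(3) [OF that(1) face_in_simplex_2 [OF that(2,1)] that(3)]
    by (simp add: drop_coord_simplical_face) (simp add: simplical_face_def)
  from this [of 0] this [of 1] this [of 2]
  have "\<forall>x\<in>standard_simplex 1. \<forall>t\<in>{0..1}.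
        G (simplical_face 0 x) t = edge_slide (singular_face 2 0 \<sigma>) n1 n2 x t
      \<and> G (simplical_face 1 x) t = edge_slide (singular_face 2 1 \<sigma>) n0 n2 x t
      \<and> G (simplical_face 2 x) t = edge_slide (singular_face 2 2 \<sigma>) n0 n1 x t"
    unfolding E_def by simp
  with G(1,2) show ?thesis unfolding triangle_homotopy_def by blast
qed

end

section \<open>Averaging over slides\<close>

definition avg2 :: "nat \<Rightarrow> (int \<Rightarrow> int \<Rightarrow> real) \<Rightarrow> real" where
  "avg2 N f = (\<Sum>a<N. \<Sum>b<N. f (int a) (int b)) / real N ^ 2"

definition avg3 :: "nat \<Rightarrow> (int \<Rightarrow> int \<Rightarrow> int \<Rightarrow> real) \<Rightarrow> real" where
  "avg3 N f = (\<Sum>a<N. \<Sum>b<N. \<Sum>c<N. f (int a) (int b) (int c)) / real N ^ 3"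

text \<open>Every edge of a triangle sees two of the three numbers; summing over the third only
  gives a factor \<open>N\<close>. The average thus commutes with taking the coboundary.\<close>

lemma avg3_faces:
  assumes "N > 0"
  shows "avg3 N (\<lambda>a b c. f b c - g a c + h a b) = avg2 N f - avg2 N g + avg2 N h"
proof -
  have "(\<Sum>a<N. \<Sum>b<N. \<Sum>c<N. f (int b) (int c) - g (int a) (int c) + h (int a) (int b))
      = N * (\<Sum>b<N. \<Sum>c<N. f (int b) (int c)) - N * (\<Sum>a<N. \<Sum>c<N. g (int a) (int c))
        + N * (\<Sum>a<N. \<Sum>b<N. h (int a) (int b))"
    by (simp add: sum.distrib sum_subtractf sum_distrib_left)
  then show ?thesis using assms
    by (simp add: avg3_def avg2_def power3_eq_cube power2_eq_square add_divide_distrib diff_divide_distrib)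
qed

lemma avg3_add: "avg3 N (\<lambda>a b c. f a b c + g a b c) = avg3 N f + avg3 N g"
  by (simp add: avg3_def sum.distrib add_divide_distrib)

lemma avg3_add_faces:
  "N > 0 \<Longrightarrow> avg3 N (\<lambda>a b c. k a b c + (f b c - g a c + h a b)) = avg3 N k + (avg2 N f - avg2 N g + avg2 N h)"
  unfolding avg3_add [of N k "\<lambda>a b c. f b c - g a c + h a b"] by (simp add: avg3_faces)

lemma avg3_const: "N > 0 \<Longrightarrow> avg3 N (\<lambda>a b c. x) = x"
  by (simp add: avg3_def power3_eq_cube)

lemma abs_avg3_le:
  assumes "N > 0" "\<And>a b c. \<bar>f a b c\<bar> \<le> C"
  shows "\<bar>avg3 N f\<bar> \<le> C"
proof -
  have "\<bar>\<Sum>a<N. \<Sum>b<N. \<Sum>c<N. f (int a) (int b) (int c)\<bar> \<le> (\<Sum>a<N. \<Sum>b<N. \<Sum>c<N. C)"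
    using assms(2) by (intro order_trans [OF sum_abs] sum_mono)
  then show ?thesis using assms(1) by (simp add: avg3_def power3_eq_cube field_simps)
qed

text \<open>Moving a window of integers by one step replaces one value by another, at a cost of at
  most \<open>2 * B\<close>.\<close>

lemma sum_shift_bound:
  fixes f :: "int \<Rightarrow> real"
  assumes B: "\<And>i. \<bar>f i\<bar> \<le> B"
  shows "\<bar>(\<Sum>b<N. f (int b + c + int d)) - (\<Sum>b<N. f (int b + c))\<bar> \<le> 2 * B * real d"
proof (induction d)
  case (Suc d)
  have "(\<Sum>b<N. f (int b + c + int (Suc d)) - f (int b + c + int d)) = f (int N + c + int d) - f (c + int d)"
    using sum_lessThan_telescope [of "\<lambda>b. f (int b + c + int d)" N] by (simp add: algebra_simps)
  then have "\<bar>(\<Sum>b<N. f (int b + c + int (Suc d))) - (\<Sum>b<N. f (int b + c + int d))\<bar> \<le> 2 * B"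
    using B [of "int N + c + int d"] B [of "c + int d"] by (simp add: sum_subtractf)
  then show ?case using Suc by (simp add: algebra_simps)
qed simp

text \<open>For each fixed \<open>a\<close> the shift costs a constant free of \<open>N\<close>;
  summing over \<open>a\<close> and dividing by the square of \<open>N\<close> leaves
  O(1/N).\<close>

lemma avg2_shift_bound:
  fixes f :: "int \<Rightarrow> real"
  assumes B: "\<And>i. \<bar>f i\<bar> \<le> B" and N: "N > 0"
  shows "\<bar>avg2 N (\<lambda>a b. f (b - a + d)) - avg2 N (\<lambda>a b. f (b - a))\<bar> \<le> 2 * B * \<bar>of_int d\<bar> / real N"
proof -
  have *: "\<bar>(\<Sum>b<N. f (int b - int a + d)) - (\<Sum>b<N. f (int b - int a))\<bar> \<le> 2 * B * \<bar>of_int d\<bar>" for a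
  proof (cases "d \<ge> 0")
    case True
    then show ?thesis using sum_shift_bound [OF B, where N = N and c = "- int a" and d = "nat d"] by (simp add: algebra_simps)
  next
    \<comment> \<open>For negative \<open>d\<close> the two sums change roles: the shifted window is
      moved forward by \<open>- d\<close>.\<close>
    case False
    then show ?thesis using sum_shift_bound [OF B, where N = N and c = "- int a + d" and d = "nat (- d)"]
      by (simp add: algebra_simps abs_minus_commute)
  qed
  have "\<bar>(\<Sum>a<N. \<Sum>b<N. f (int b - int a + d)) - (\<Sum>a<N. \<Sum>b<N. f (int b - int a))\<bar>
      \<le> (\<Sum>a<N. 2 * B * \<bar>of_int d\<bar>)"
    unfolding sum_subtractf [symmetric] sum_subtractf [symmetric]
    by (rule order_trans [OF sum_abs sum_mono]) (use * in \<open>simp add: sum_subtractf\<close>)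
  then have "\<bar>(\<Sum>a<N. \<Sum>b<N. f (int b - int a + d)) - (\<Sum>a<N. \<Sum>b<N. f (int b - int a))\<bar> / real N ^ 2
      \<le> (real N * (2 * B * \<bar>of_int d\<bar>)) / real N ^ 2"
    by (intro divide_right_mono) simp_all
  then show ?thesis using N
    by (simp add: avg2_def power2_eq_square flip: diff_divide_distrib)
qed

section \<open>Straight simplices on the circles\<close>

context circle_end
begin

text \<open>All vertices lie over the only vertex of the 0-simplex, so just the heights matter, and
  they are read as angles. For an integer \<open>n\<close>, \<open>line j [0, n]\<close> is the
  straight loop with \<open>n\<close> turns.\<close>

definition line :: "nat \<Rightarrow> real list \<Rightarrow> 'b ssimplex" where
  "line j ts = pmap (map (\<lambda>t. (0, t)) ts) (\<lambda>x t. cA j t)"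

lemma singular_simplex_line:
  assumes "j < k" "length ts = Suc p"
  shows "singular_simplex p (subtopology Y A) (line j ts)"
  unfolding line_def
proof (rule singular_simplex_pmap [of 0 UNIV])
  show "continuous_map (top_of_set (standard_simplex 0 \<times> UNIV)) (subtopology Y A) (\<lambda>(x, t). cA j t)"
    using continuous_map_cA [OF assms(1) continuous_on_snd [OF continuous_on_id]] by (simp add: split_def)
qed (use assms in auto)

lemma line_shift:
  assumes "j < k" "m \<in> \<int>" "ts \<noteq> []"
  shows "line j (map (\<lambda>t. t + m) ts) = line j ts"
proof -
  have "vheight (map (\<lambda>t. (0, t)) (map (\<lambda>t. t + m) ts)) y = vheight (map (\<lambda>t. (0, t)) ts) y + m"
    if "y \<in> standard_simplex (length ts - 1)" for y
  proof -
    have "(\<Sum>j<length ts. y j) = 1"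
      using that assms(3) by (auto simp: standard_simplex_def lessThan_Suc_atMost [symmetric] Suc_diff_1)
    then have "(\<Sum>j<length ts. m * y j) = m" by (simp flip: sum_distrib_left)
    then show ?thesis by (simp add: vheight_def sum.distrib distrib_right)
  qed
  then show ?thesis unfolding line_def pmap_def using assms(1,2) by (auto simp: cA_shift)
qed

lemma pmap_straight_2:
  assumes j: "j < k" and G: "\<And>x. x \<in> standard_simplex 1 \<Longrightarrow> G x 1 = cA j (x 0 * a + x 1 * b)"
  shows "pmap [(0,1),(1,1)] G = line j [a, b]"
proof -
  have "pmap [(0,1),(1,1)] G = restrict (\<lambda>x. cA j (x 0 * a + x 1 * b)) (standard_simplex 1)"
    by (rule pmap_level_1) (simp_all add: G)
  also have "\<dots> = line j [a, b]"
    by (simp add: line_def pmap_def vheight_def mult.commute)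
  finally show ?thesis .
qed

definition slid_edge :: "'b ssimplex \<Rightarrow> int \<Rightarrow> int \<Rightarrow> 'b ssimplex" where
  "slid_edge e n0 n1 = pmap [(0,1),(1,1)] (edge_slide e n0 n1)"

lemma in_A_imp_in_Y: "singular_simplex p (subtopology Y A) \<sigma> \<Longrightarrow> singular_simplex p Y \<sigma>"
  by (simp add: singular_simplex_subtopology)

lemma winding_Ints:
  assumes "lifts p e j g" "vertex i \<in> standard_simplex p"
  shows "g (vertex i) - vangle (e (vertex i)) \<in> \<int>"
proof -
  have "j < k" "e (vertex i) = cA j (g (vertex i))" using assms unfolding lifts_def by blast+
  then show ?thesis using vangle_Ints by simp
qed

text \<open>The rise of the lift relative to the chosen angles at the two ends. It is already an
  integer by \<open>of_int_winding\<close>; the floor only changes the type.\<close>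

definition winding :: "'b ssimplex \<Rightarrow> ((nat \<Rightarrow> real) \<Rightarrow> real) \<Rightarrow> int" where
  "winding e g = \<lfloor>(g (vertex 1) - vangle (e (vertex 1))) - (g (vertex 0) - vangle (e (vertex 0)))\<rfloor>"

lemma of_int_winding:
  assumes "lifts 1 e j g"
  shows "of_int (winding e g) = (g (vertex 1) - vangle (e (vertex 1))) - (g (vertex 0) - vangle (e (vertex 0)))"
proof -
  have "(g (vertex 1) - vangle (e (vertex 1))) - (g (vertex 0) - vangle (e (vertex 0))) \<in> \<int>"
    by (rule Ints_diff; rule winding_Ints [OF assms]) simp_all
  then show ?thesis unfolding winding_def by (rule of_int_floor)
qed

text \<open>Both ends land on the base point and the edge has become straight, so only its number of
  turns is left. The edge enters this number only as a shift of \<open>n1 - n0\<close>, which the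
  averages nearly forget.\<close>

lemma slid_edge_line:
  assumes e: "singular_simplex 1 Y e" and l: "lifts 1 e j g"
  shows "slid_edge e n0 n1 = line j [0, of_int (n1 - n0 + winding e g)]"
proof -
  let ?a = "of_int n0 + (g (vertex 0) - vangle (e (vertex 0)))"
  let ?b = "of_int n1 + (g (vertex 1) - vangle (e (vertex 1)))"
  have j: "j < k" using l by (simp add: lifts_def)
  have E: "edge_homotopy e n0 n1 (edge_slide e n0 n1)" by (rule edge_homotopy_edge_slide [OF e])
  have "edge_slide e n0 n1 x 1 = cA j (x 0 * ?a + x 1 * ?b)" if "x \<in> standard_simplex 1" for x
  proof -
    have "edge_slide e n0 n1 x 1 = cA j (slide e g n0 n1 x 1)"
      using E l that unfolding edge_homotopy_def by simp
    then show ?thesis by (simp add: slide_def add_diff_eq)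
  qed
  then have "slid_edge e n0 n1 = line j [?a, ?b]" unfolding slid_edge_def by (rule pmap_straight_2 [OF j])
  also have "\<dots> = line j (map (\<lambda>t. t + ?a) [0, ?b - ?a])" by simp
  also have "\<dots> = line j [0, ?b - ?a]"
    by (rule line_shift [OF j]) (auto intro: Ints_add winding_Ints [OF l])
  also have "?b - ?a = of_int (n1 - n0 + winding e g)" using of_int_winding [OF l] by simp
  finally show ?thesis .
qed

definition triangle_slide :: "'b ssimplex \<Rightarrow> int \<Rightarrow> int \<Rightarrow> int \<Rightarrow> (nat \<Rightarrow> real) \<Rightarrow> real \<Rightarrow> 'b" where
  "triangle_slide \<sigma> n0 n1 n2 = (SOME G. triangle_homotopy \<sigma> n0 n1 n2 G)"

lemma triangle_slide:
  assumes "singular_simplex 2 Y \<sigma>"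
  shows "continuous_map (top_of_set (standard_simplex 2 \<times> {0..1})) Y (case_prod (triangle_slide \<sigma> n0 n1 n2))"
    and "x \<in> standard_simplex 2 \<Longrightarrow> triangle_slide \<sigma> n0 n1 n2 x 0 = \<sigma> x"
    and "\<lbrakk>x \<in> standard_simplex 1; t \<in> {0..1}\<rbrakk> \<Longrightarrow>
        triangle_slide \<sigma> n0 n1 n2 (simplical_face 0 x) t = edge_slide (singular_face 2 0 \<sigma>) n1 n2 x t"
    and "\<lbrakk>x \<in> standard_simplex 1; t \<in> {0..1}\<rbrakk> \<Longrightarrow>
        triangle_slide \<sigma> n0 n1 n2 (simplical_face 1 x) t = edge_slide (singular_face 2 1 \<sigma>) n0 n2 x t"
    and "\<lbrakk>x \<in> standard_simplex 1; t \<in> {0..1}\<rbrakk> \<Longrightarrow>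
        triangle_slide \<sigma> n0 n1 n2 (simplical_face 2 x) t = edge_slide (singular_face 2 2 \<sigma>) n0 n1 x t"
  using someI_ex [OF triangle_homotopy_exists [OF assms, of n0 n1 n2], folded triangle_slide_def]
  unfolding triangle_homotopy_def by blast+

definition slid_triangle :: "'b ssimplex \<Rightarrow> int \<Rightarrow> int \<Rightarrow> int \<Rightarrow> 'b ssimplex" where
  "slid_triangle \<sigma> n0 n1 n2 = pmap [(0,1),(1,1),(2,1)] (triangle_slide \<sigma> n0 n1 n2)"

lemma singular_simplex_slid_triangle: "singular_simplex 2 Y \<sigma> \<Longrightarrow> singular_simplex 2 Y (slid_triangle \<sigma> n0 n1 n2)"
  unfolding slid_triangle_def by (rule singular_simplex_pmap [OF triangle_slide(1)]) auto

lemma cocycle_slid_triangle: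
  assumes \<psi>: "\<And>\<sigma>. singular_simplex 3 Y \<sigma> \<Longrightarrow> cobd 2 \<psi> \<sigma> = 0" and \<sigma>: "singular_simplex 2 Y \<sigma>"
  shows "\<psi> (slid_triangle \<sigma> n0 n1 n2) = \<psi> \<sigma> + (prism_cochain \<psi> (edge_slide (singular_face 2 0 \<sigma>) n1 n2)
     - prism_cochain \<psi> (edge_slide (singular_face 2 1 \<sigma>) n0 n2)
     + prism_cochain \<psi> (edge_slide (singular_face 2 2 \<sigma>) n0 n1))"
proof -
  have "pmap [(0,0),(1,0),(2,0)] (triangle_slide \<sigma> n0 n1 n2) = \<sigma>"
    using triangle_slide(2) [OF \<sigma>] \<sigma> by (intro pmap_level) (auto simp: singular_simplex_def)
  moreover have "prism_cochain \<psi> (\<lambda>x t. triangle_slide \<sigma> n0 n1 n2 (simplical_face 0 x) t)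
      = prism_cochain \<psi> (edge_slide (singular_face 2 0 \<sigma>) n1 n2)"
    by (rule prism_cochain_cong) (rule triangle_slide(3) [OF \<sigma>])
  moreover have "prism_cochain \<psi> (\<lambda>x t. triangle_slide \<sigma> n0 n1 n2 (simplical_face 1 x) t)
      = prism_cochain \<psi> (edge_slide (singular_face 2 1 \<sigma>) n0 n2)"
    by (rule prism_cochain_cong) (rule triangle_slide(4) [OF \<sigma>])
  moreover have "prism_cochain \<psi> (\<lambda>x t. triangle_slide \<sigma> n0 n1 n2 (simplical_face 2 x) t)
      = prism_cochain \<psi> (edge_slide (singular_face 2 2 \<sigma>) n0 n1)"
    by (rule prism_cochain_cong) (rule triangle_slide(5) [OF \<sigma>])
  ultimately show ?thesis
    using prism_identity [OF \<psi> triangle_slide(1) [OF \<sigma>], of n0 n1 n2] unfolding slid_triangle_def by simp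
qed

lemma cobd_1_slid_triangle:
  assumes \<sigma>: "singular_simplex 2 Y \<sigma>"
  shows "cobd 1 \<phi> (slid_triangle \<sigma> n0 n1 n2) = \<phi> (slid_edge (singular_face 2 0 \<sigma>) n1 n2)
     - \<phi> (slid_edge (singular_face 2 1 \<sigma>) n0 n2) + \<phi> (slid_edge (singular_face 2 2 \<sigma>) n0 n1)"
proof -
  let ?G = "triangle_slide \<sigma> n0 n1 n2"
  have "pmap [(1,1),(2,1)] ?G = pmap [(0,1),(1,1)] (\<lambda>x t. ?G (simplical_face 0 x) t)"
    "pmap [(0,1),(2,1)] ?G = pmap [(0,1),(1,1)] (\<lambda>x t. ?G (simplical_face 1 x) t)"
    "pmap [(0,1),(1,1)] ?G = pmap [(0,1),(1,1)] (\<lambda>x t. ?G (simplical_face 2 x) t)"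
    by (simp_all add: pmap_face Suc_1 One_nat_def [symmetric] del: One_nat_def)
  moreover have "pmap [(0,1),(1,1)] (\<lambda>x t. ?G (simplical_face 0 x) t) = slid_edge (singular_face 2 0 \<sigma>) n1 n2"
    unfolding slid_edge_def by (rule pmap_cong [of 1 "{0..1}"]) (auto simp: triangle_slide(3) [OF \<sigma>])
  moreover have "pmap [(0,1),(1,1)] (\<lambda>x t. ?G (simplical_face 1 x) t) = slid_edge (singular_face 2 1 \<sigma>) n0 n2"
    unfolding slid_edge_def by (rule pmap_cong [of 1 "{0..1}"]) (use triangle_slide(4) [OF \<sigma>] in auto)
  moreover have "pmap [(0,1),(1,1)] (\<lambda>x t. ?G (simplical_face 2 x) t) = slid_edge (singular_face 2 2 \<sigma>) n0 n1"
    unfolding slid_edge_def by (rule pmap_cong [of 1 "{0..1}"]) (auto simp: triangle_slide(5) [OF \<sigma>])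
  ultimately show ?thesis unfolding slid_triangle_def cobd_1_pmap by simp
qed

text \<open>The slide of an edge of \<open>A\<close> stays in \<open>A\<close>, so a bound there is
  enough. \<open>B\<close> gives the bound of a primitive on the circles, and \<open>B = 0\<close>
  the vanishing for relative cocycles.\<close>

lemma abs_prism_cochain_edge_slide_le:
  assumes \<psi>: "\<And>\<sigma>. singular_simplex 2 (subtopology Y A) \<sigma> \<Longrightarrow> \<bar>\<psi> \<sigma>\<bar> \<le> B"
    and e: "singular_simplex 1 (subtopology Y A) e"
  shows "\<bar>prism_cochain \<psi> (edge_slide e n0 n1)\<bar> \<le> 2 * B"
proof -
  obtain j g where l: "lifts 1 e j g" using lift_exists [OF _ e] by (auto simp: lifts_def)
  then have j: "j < k" by (simp add: lifts_def)
  have "prism_cochain \<psi> (edge_slide e n0 n1) = prism_cochain \<psi> (\<lambda>x t. cA j (slide e g n0 n1 x t))"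
    using edge_homotopy_edge_slide [OF in_A_imp_in_Y [OF e], of n0 n1] l unfolding edge_homotopy_def
    by (intro prism_cochain_cong) blast
  moreover have "continuous_map (top_of_set (standard_simplex 1 \<times> {0..1})) (subtopology Y A)
      (\<lambda>(x, t). cA j (slide e g n0 n1 x t))"
    using continuous_map_cA [OF j continuous_on_slide [OF l, of n0 n1]] by (simp add: split_def)
  then have "\<bar>prism_cochain \<psi> (\<lambda>x t. cA j (slide e g n0 n1 x t))\<bar> \<le> 2 * B"
    by (rule abs_prism_cochain_le [rotated]) (rule \<psi>)
  ultimately show ?thesis by simp
qed

lemma prism_cochain_edge_slide_in_A:
  assumes "\<And>\<sigma>. singular_simplex 2 (subtopology Y A) \<sigma> \<Longrightarrow> \<psi> \<sigma> = 0"
    and "singular_simplex 1 (subtopology Y A) e"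
  shows "prism_cochain \<psi> (edge_slide e n0 n1) = 0"
  using abs_prism_cochain_edge_slide_le [of \<psi> 0 e n0 n1] assms by simp

lemma reindex_10_in_A:
  assumes "singular_simplex 1 (subtopology Y A) e"
  shows "singular_simplex 1 (subtopology Y A) (reindex [1,0] e)"
  by (rule singular_simplex_reindex [OF assms]) auto

text \<open>With \<open>f n\<close> the value of \<open>\<phi>\<close> on the loop with
  \<open>n\<close> turns, both averages are within O(1/N) of the average of
  \<open>f (b - a)\<close>, whatever the two winding numbers are. \<open>D\<close> depends on them
  but not on \<open>N\<close>.\<close>

lemma avg2_slid_edge_bound:
  assumes e: "singular_simplex 1 (subtopology Y A) e"
    and \<phi>: "\<And>e. singular_simplex 1 Y e \<Longrightarrow> \<bar>\<phi> e\<bar> \<le> B"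
  shows "\<exists>D. \<forall>N>0. \<bar>avg2 N (\<lambda>a b. \<phi> (slid_edge e a b)) - avg2 N (\<lambda>a b. \<phi> (slid_edge (reindex [1,0] e) a b))\<bar> \<le> D / real N"
proof -
  let ?r = "reindex [1,0] e"
  have r: "singular_simplex 1 (subtopology Y A) ?r" by (rule reindex_10_in_A [OF e])
  obtain j g where l: "lifts 1 e j g" using lift_exists [OF _ e] by (auto simp: lifts_def)
  obtain j' g' where l': "lifts 1 ?r j' g'" using lift_exists [OF _ r] by (auto simp: lifts_def)
  have jk: "j < k" "j' < k" using l l' by (simp_all add: lifts_def)
  \<comment> \<open>The reversed edge starts where \<open>e\<close> ends, so both lie on the same
    circle.\<close>
  have "vpoint [(1,0),(0,0)] (vertex 0) = vertex 1"
    by (auto simp: vpoint_def fun_eq_iff lessThan_Suc)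
  then have "?r (vertex 0) = e (vertex 1)"
    by (simp add: reindex_def pmap_def)
  then have "cA j' (g' (vertex 0)) = cA j (g (vertex 1))" using l l' by (simp add: lifts_def)
  then have j: "j' = j" using cA_eq jk by blast
  define f where "f = (\<lambda>n::int. \<phi> (line j [0, of_int n]))"
  have f: "\<bar>f n\<bar> \<le> B" for n
    unfolding f_def by (intro \<phi> in_A_imp_in_Y singular_simplex_line jk) simp
  let ?d = "winding e g" and ?d' = "winding ?r g'"
  have 1: "(\<lambda>a b. \<phi> (slid_edge e a b)) = (\<lambda>a b. f (b - a + ?d))"
    unfolding f_def slid_edge_line [OF in_A_imp_in_Y [OF e] l] ..
  have 2: "(\<lambda>a b. \<phi> (slid_edge ?r a b)) = (\<lambda>a b. f (b - a + ?d'))"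
    unfolding f_def slid_edge_line [OF in_A_imp_in_Y [OF r] l'] j ..
  have "\<bar>avg2 N (\<lambda>a b. \<phi> (slid_edge e a b)) - avg2 N (\<lambda>a b. \<phi> (slid_edge ?r a b))\<bar>
      \<le> (2 * B * \<bar>of_int ?d\<bar> + 2 * B * \<bar>of_int ?d'\<bar>) / real N" if "N > 0" for N
    unfolding 1 2 add_divide_distrib
    using avg2_shift_bound [of f B N ?d, OF f that] avg2_shift_bound [of f B N ?d', OF f that] by linarith
  then show ?thesis by blast
qed

text \<open>Twice the pairing is computed from each simplex and its reversal. The two averages of
  \<open>\<omega>\<close> contribute at most \<open>2 * C\<close> per simplex, and
  \<open>\<phi>\<close> contributes only through \<open>R N\<close> on the boundary edges, which
  tends to 0.\<close>

theorem abs_kronecker_le_of_cohomologous: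
  assumes z: "rrelcycle 2 Y A z" and \<psi>: "bcocycle 2 Y A \<psi>"
    and \<omega>: "\<And>\<sigma>. singular_simplex 2 Y \<sigma> \<Longrightarrow> \<bar>\<omega> \<sigma>\<bar> \<le> C"
    and \<phi>: "\<And>e. singular_simplex 1 Y e \<Longrightarrow> \<bar>\<phi> e\<bar> \<le> B"
    and eq: "\<And>\<sigma>. singular_simplex 2 Y \<sigma> \<Longrightarrow> \<psi> \<sigma> = \<omega> \<sigma> + cobd 1 \<phi> \<sigma>"
  shows "\<bar>kronecker z \<psi>\<bar> \<le> C * l1norm z"
proof -
  have coc: "cobd 2 \<psi> \<sigma> = 0" if "singular_simplex 3 Y \<sigma>" for \<sigma>
    using \<psi> that by (simp add: bcocycle_def)
  have \<psi>A: "\<psi> \<sigma> = 0" if "singular_simplex 2 (subtopology Y A) \<sigma>" for \<sigma>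
    using \<psi> that by (simp add: bcocycle_def)
  have zch: "singular_simplex 2 Y \<sigma>" if "z \<sigma> \<noteq> 0" for \<sigma>
    using z that by (simp add: rrelcycle_def rchain_def)
  have dz: "finite {e. rbd 2 z e \<noteq> 0}" "\<And>e. rbd 2 z e \<noteq> 0 \<Longrightarrow> singular_simplex 1 (subtopology Y A) e"
    using z by (simp_all add: rrelcycle_def rchain_def)
  let ?rev = "reindex [1,0] :: 'b ssimplex \<Rightarrow> 'b ssimplex"
  define P where "P = (\<lambda>N e. avg2 N (\<lambda>a b. \<phi> (slid_edge e a b)))"
  define H where "H = (\<lambda>N e. avg2 N (\<lambda>a b. prism_cochain \<psi> (edge_slide e a b)))"
  define Q where "Q = (\<lambda>N \<sigma>. avg3 N (\<lambda>a b c. \<omega> (slid_triangle \<sigma> a b c)))"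
  \<comment> \<open>The average of \<open>\<psi>\<close> over the slid triangles is evaluated twice:
    by the prism identity, and by \<open>eq\<close> applied to the slid triangles.\<close>
  have avg: "\<psi> \<sigma> = Q N \<sigma> + cobd 1 (P N) \<sigma> - cobd 1 (H N) \<sigma>"
    if \<sigma>: "singular_simplex 2 Y \<sigma>" and N: "N > 0" for \<sigma> N
  proof -
    have "avg3 N (\<lambda>a b c. \<psi> (slid_triangle \<sigma> a b c)) = avg3 N (\<lambda>a b c. \<psi> \<sigma>
        + (prism_cochain \<psi> (edge_slide (singular_face 2 0 \<sigma>) b c) - prism_cochain \<psi> (edge_slide (singular_face 2 1 \<sigma>) a c)
        + prism_cochain \<psi> (edge_slide (singular_face 2 2 \<sigma>) a b)))"
      by (intro arg_cong [of _ _ "avg3 N"] ext cocycle_slid_triangle [OF coc \<sigma>])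
    also have "\<dots> = \<psi> \<sigma> + cobd 1 (H N) \<sigma>"
      unfolding avg3_add_faces [OF N] avg3_const [OF N] cobd_1 H_def ..
    finally have 1: "avg3 N (\<lambda>a b c. \<psi> (slid_triangle \<sigma> a b c)) = \<psi> \<sigma> + cobd 1 (H N) \<sigma>" .
    have "avg3 N (\<lambda>a b c. \<psi> (slid_triangle \<sigma> a b c)) = avg3 N (\<lambda>a b c. \<omega> (slid_triangle \<sigma> a b c)
        + (\<phi> (slid_edge (singular_face 2 0 \<sigma>) b c) - \<phi> (slid_edge (singular_face 2 1 \<sigma>) a c)
        + \<phi> (slid_edge (singular_face 2 2 \<sigma>) a b)))"
      by (intro arg_cong [of _ _ "avg3 N"] ext) (simp only: eq [OF singular_simplex_slid_triangle [OF \<sigma>]] cobd_1_slid_triangle [OF \<sigma>])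
    also have "\<dots> = Q N \<sigma> + cobd 1 (P N) \<sigma>"
      unfolding avg3_add_faces [OF N] cobd_1 P_def Q_def ..
    finally have "avg3 N (\<lambda>a b c. \<psi> (slid_triangle \<sigma> a b c)) = Q N \<sigma> + cobd 1 (P N) \<sigma>" .
    moreover note 1
    ultimately show ?thesis by simp
  qed
  have Q: "\<bar>Q N \<sigma>\<bar> \<le> C" if "singular_simplex 2 Y \<sigma>" "N > 0" for \<sigma> N
    unfolding Q_def by (rule abs_avg3_le [OF that(2) \<omega> [OF singular_simplex_slid_triangle [OF that(1)]]])
  have rev2: "singular_simplex 2 Y (reindex [2,1,0] \<sigma>)" if "singular_simplex 2 Y \<sigma>" for \<sigma>
    by (rule singular_simplex_reindex [OF that]) auto
  define R where "R = (\<lambda>N e. P N e - P N (?rev e))"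
  have bound: "2 * \<bar>kronecker z \<psi>\<bar> \<le> 2 * C * l1norm z + \<bar>kronecker (rbd 2 z) (R N)\<bar>" if N: "N > 0" for N
  proof -
    \<comment> \<open>\<open>V\<close> gathers the edge cochains that vanish on \<open>A\<close>:
      the prisms of \<open>e\<close> and of its reversal, and the correction for reversing a
      cocycle.\<close>
    define V where "V = (\<lambda>e. H N (?rev e) - H N e + reverse_cochain \<psi> e)"
    have dec: "2 * \<psi> \<sigma> = (Q N \<sigma> - Q N (reindex [2,1,0] \<sigma>)) + (cobd 1 (R N) \<sigma> + cobd 1 V \<sigma>)"
      if \<sigma>: "singular_simplex 2 Y \<sigma>" for \<sigma>
    proof -
      have "2 * \<psi> \<sigma> = \<psi> \<sigma> - \<psi> (reindex [2,1,0] \<sigma>) + cobd 1 (reverse_cochain \<psi>) \<sigma>"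
        using reverse_identity [OF coc \<sigma>] by simp
      also have "\<dots> = (Q N \<sigma> - Q N (reindex [2,1,0] \<sigma>)) + (cobd 1 (R N) \<sigma> + cobd 1 V \<sigma>)"
        using avg [OF \<sigma> N] avg [OF rev2 [OF \<sigma>] N] unfolding cobd_1_reverse R_def V_def
        by (simp add: cobd_1 del: One_nat_def)
      finally show ?thesis .
    qed
    have "V e = 0" if "singular_simplex 1 (subtopology Y A) e" for e
    proof -
      have "prism_cochain \<psi> (edge_slide e a b) = 0" "prism_cochain \<psi> (edge_slide (?rev e) a b) = 0" for a b
        using prism_cochain_edge_slide_in_A [where \<psi> = \<psi>, OF \<psi>A that]
          prism_cochain_edge_slide_in_A [where \<psi> = \<psi>, OF \<psi>A reindex_10_in_A [OF that]] by simp_all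
      then have "H N e = 0" "H N (?rev e) = 0"
        unfolding H_def avg2_def by simp_all
      moreover have "\<psi> (reindex ls e) = 0" if "ls = [0,1,0] \<or> ls = [0,0,0]" for ls
        by (rule \<psi>A, rule singular_simplex_reindex [OF \<open>singular_simplex 1 (subtopology Y A) e\<close>]) (use that in auto)
      ultimately show ?thesis by (simp add: V_def reverse_cochain_def)
    qed
    then have V0: "kronecker z (cobd 1 V) = 0" by (rule kronecker_cobd_eq_0 [OF z])
    have "2 * kronecker z \<psi> = kronecker z (\<lambda>\<sigma>. 2 * \<psi> \<sigma>)"
      by (simp add: kronecker_def sum_distrib_left mult_ac)
    also have "\<dots> = kronecker z (\<lambda>\<sigma>. (Q N \<sigma> - Q N (reindex [2,1,0] \<sigma>)) + (cobd 1 (R N) \<sigma> + cobd 1 V \<sigma>))"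
      by (rule kronecker_cong) (rule dec [OF zch])
    also have "\<dots> = kronecker z (\<lambda>\<sigma>. Q N \<sigma> - Q N (reindex [2,1,0] \<sigma>)) + (kronecker z (cobd 1 (R N)) + 0)"
      unfolding kronecker_add_right V0 ..
    also have "kronecker z (cobd 1 (R N)) = kronecker (rbd 2 z) (R N)"
      using kronecker_rbd [of z 1 "R N"] z by (simp add: rrelcycle_def rchain_def Suc_1 One_nat_def [symmetric] del: One_nat_def)
    finally have "2 * kronecker z \<psi> = kronecker z (\<lambda>\<sigma>. Q N \<sigma> - Q N (reindex [2,1,0] \<sigma>)) + kronecker (rbd 2 z) (R N)"
      by simp
    moreover have "\<bar>kronecker z (\<lambda>\<sigma>. Q N \<sigma> - Q N (reindex [2,1,0] \<sigma>))\<bar> \<le> (2 * C) * l1norm z"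
    proof (rule abs_kronecker_le)
      fix \<sigma> assume "z \<sigma> \<noteq> 0"
      then show "\<bar>Q N \<sigma> - Q N (reindex [2,1,0] \<sigma>)\<bar> \<le> 2 * C"
        using Q [OF zch N, of \<sigma>] Q [OF rev2 [OF zch] N, of \<sigma>] by linarith
    qed
    ultimately show ?thesis by linarith
  qed
  \<comment> \<open>The constant varies with the edge through winding numbers, but the boundary has
    finite support, so one constant \<open>K\<close> serves all \<open>N\<close>.\<close>
  have "\<forall>e. \<exists>D. rbd 2 z e \<noteq> 0 \<longrightarrow> (\<forall>N>0. \<bar>R N e\<bar> \<le> D / real N)"
    unfolding R_def P_def
  proof
    fix e
    show "\<exists>D. rbd 2 z e \<noteq> 0 \<longrightarrow> (\<forall>N>0. \<bar>avg2 N (\<lambda>a b. \<phi> (slid_edge e a b))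
        - avg2 N (\<lambda>a b. \<phi> (slid_edge (?rev e) a b))\<bar> \<le> D / real N)"
    proof (cases "rbd 2 z e = 0")
      case False
      show ?thesis using avg2_slid_edge_bound [OF dz(2) [OF False], of \<phi> B] \<phi> by blast
    qed simp
  qed
  then obtain D where D: "\<And>e N. rbd 2 z e \<noteq> 0 \<Longrightarrow> N > 0 \<Longrightarrow> \<bar>R N e\<bar> \<le> D e / real N" by metis
  define K where "K = (\<Sum>e | rbd 2 z e \<noteq> 0. \<bar>rbd 2 z e\<bar> * D e)"
  have K: "\<bar>kronecker (rbd 2 z) (R N)\<bar> \<le> K / real N" if "N > 0" for N
  proof -
    have "\<bar>kronecker (rbd 2 z) (R N)\<bar> \<le> (\<Sum>e | rbd 2 z e \<noteq> 0. \<bar>rbd 2 z e * R N e\<bar>)"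
      unfolding kronecker_def by (rule sum_abs)
    also have "\<dots> \<le> (\<Sum>e | rbd 2 z e \<noteq> 0. \<bar>rbd 2 z e\<bar> * (D e / real N))"
      unfolding abs_mult using D that by (intro sum_mono mult_left_mono) auto
    also have "\<dots> = K / real N" by (simp add: K_def sum_divide_distrib)
    finally show ?thesis .
  qed
  have "(\<lambda>N. K / real N) \<longlonglongrightarrow> 0" by (rule lim_const_over_n)
  then have lim: "(\<lambda>N. 2 * C * l1norm z + K / real N) \<longlonglongrightarrow> 2 * C * l1norm z + 0"
    by (intro tendsto_add tendsto_const)
  have "2 * \<bar>kronecker z \<psi>\<bar> \<le> 2 * C * l1norm z + 0"
  proof (rule LIMSEQ_le_const [OF lim])
    show "\<exists>M. \<forall>N\<ge>M. 2 * \<bar>kronecker z \<psi>\<bar> \<le> 2 * C * l1norm z + K / real N"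
    proof (intro exI [of _ 1] allI impI)
      fix N :: nat assume "1 \<le> N"
      then show "2 * \<bar>kronecker z \<psi>\<bar> \<le> 2 * C * l1norm z + K / real N"
        using bound [of N] K [of N] by linarith
    qed
  qed
  then show ?thesis by simp
qed

end

section \<open>Bounded primitives on the circles\<close>

text \<open>Amenability of the integers: the primitive is the mean of \<open>f a\<close> in its
  second argument. Since the integers are countable, limits of averages along one subsequence
  replace an invariant mean, and the bound \<open>B\<close> is inherited.\<close>

lemma bounded_int_cocycle_primitive:
  fixes f :: "int \<Rightarrow> int \<Rightarrow> real"
  assumes B: "\<And>a b. \<bar>f a b\<bar> \<le> B"
    and coc: "\<And>a b c. f b c - f (a + b) c + f a (b + c) - f a b = 0"
  shows "\<exists>\<Phi>. (\<forall>a. \<bar>\<Phi> a\<bar> \<le> B) \<and> (\<forall>a b. f a b = \<Phi> b - \<Phi> (a + b) + \<Phi> a)"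
proof -
  define s where "s = (\<lambda>N a. (\<Sum>n<Suc N. f a (int n)) / real (Suc N))"
  have s: "norm (s N a) \<le> B" for N a
  proof -
    have "\<bar>\<Sum>n<Suc N. f a (int n)\<bar> \<le> (\<Sum>n<Suc N. B)"
      by (rule order_trans [OF sum_abs sum_mono]) (rule B)
    then show ?thesis by (simp add: s_def abs_divide pos_divide_le_eq mult.commute del: sum.lessThan_Suc)
  qed
  \<comment> \<open>One subsequence must work for all \<open>a\<close> simultaneously, because the
    identity for \<open>\<Phi>\<close> relates three arguments.\<close>
  obtain r where r: "strict_mono (r :: nat \<Rightarrow> nat)" "\<And>a. a \<in> UNIV \<Longrightarrow> \<exists>l. (\<lambda>n. s (r n) a) \<longlonglongrightarrow> l"
    using function_convergent_subsequence [of "UNIV :: int set" s B] s by auto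
  then obtain \<Phi> where \<Phi>: "\<And>a. (\<lambda>n. s (r n) a) \<longlonglongrightarrow> \<Phi> a" by (metis UNIV_I)
  have bd: "\<bar>\<Phi> a\<bar> \<le> B" for a
  proof -
    have "(\<lambda>n. \<bar>s (r n) a\<bar>) \<longlonglongrightarrow> \<bar>\<Phi> a\<bar>" by (intro tendsto_rabs \<Phi>)
    then show ?thesis by (rule LIMSEQ_le_const2) (use s in auto)
  qed
  have "f a b = \<Phi> b - \<Phi> (a + b) + \<Phi> a" for a b
  proof -
    \<comment> \<open>The cocycle identity is summed over its third argument. Just one of the sums
      is over a shifted window, and this shift is the whole error.\<close>
    have close: "\<bar>f a b - (s N b - s N (a + b) + s N a)\<bar> \<le> (2 * B * \<bar>of_int b\<bar>) / real (Suc N)" for N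
    proof -
      have "(\<Sum>n<Suc N. f b (int n) - f (a + b) (int n) + f a (b + int n) - f a b) = 0"
        by (intro sum.neutral ballI) (rule coc)
      then have 1: "real (Suc N) * f a b = (\<Sum>n<Suc N. f b (int n)) - (\<Sum>n<Suc N. f (a + b) (int n))
          + (\<Sum>n<Suc N. f a (b + int n))"
        by (simp only: sum.distrib sum_subtractf sum_constant card_lessThan)
      have 2: "\<bar>(\<Sum>n<Suc N. f a (b + int n)) - (\<Sum>n<Suc N. f a (int n))\<bar> \<le> 2 * B * \<bar>of_int b\<bar>"
      proof (cases "b \<ge> 0")
        case True
        then show ?thesis
          using sum_shift_bound [OF B [of a], where N = "Suc N" and c = 0 and d = "nat b"]
          by (simp add: add.commute del: sum.lessThan_Suc)
      next
        case False
        then show ?thesis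
          using sum_shift_bound [OF B [of a], where N = "Suc N" and c = b and d = "nat (- b)"]
          by (simp add: add.commute abs_minus_commute del: sum.lessThan_Suc)
      qed
      have "real (Suc N) * (f a b - (s N b - s N (a + b) + s N a))
         = (\<Sum>n<Suc N. f a (b + int n)) - (\<Sum>n<Suc N. f a (int n))"
        using 1 by (simp add: s_def right_diff_distrib distrib_left del: sum.lessThan_Suc of_nat_Suc)
      then have "real (Suc N) * \<bar>f a b - (s N b - s N (a + b) + s N a)\<bar> \<le> 2 * B * \<bar>of_int b\<bar>"
        using 2 by (metis abs_mult abs_of_nat)
      then show ?thesis by (simp add: pos_le_divide_eq mult.commute)
    qed
    have "(\<lambda>N. (2 * B * \<bar>of_int b\<bar>) / real (Suc N)) \<longlonglongrightarrow> 0"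
      using lim_const_over_n [of "2 * B * \<bar>real_of_int b\<bar>"] by (rule LIMSEQ_Suc)
    then have "(\<lambda>n. (2 * B * \<bar>of_int b\<bar>) / real (Suc (r n))) \<longlonglongrightarrow> 0"
      using LIMSEQ_subseq_LIMSEQ [OF _ r(1)] by (auto simp: o_def)
    then have "(\<lambda>n. f a b - (s (r n) b - s (r n) (a + b) + s (r n) a)) \<longlonglongrightarrow> 0"
      by (rule Lim_null_comparison [rotated]) (use close in auto)
    moreover have "(\<lambda>n. f a b - (s (r n) b - s (r n) (a + b) + s (r n) a))
        \<longlonglongrightarrow> f a b - (\<Phi> b - \<Phi> (a + b) + \<Phi> a)"
      by (intro tendsto_intros \<Phi>)
    ultimately have "f a b - (\<Phi> b - \<Phi> (a + b) + \<Phi> a) = 0" using LIMSEQ_unique by blast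
    then show ?thesis by simp
  qed
  with bd show ?thesis by blast
qed

context circle_end
begin

lemma winding_independent:
  assumes "lifts 1 e j g" "lifts 1 e j' g'"
  shows "winding e g' = winding e g"
proof -
  obtain m where "\<And>x. x \<in> standard_simplex 1 \<Longrightarrow> g' x = g x + m"
    using lifts_unique(2) [OF assms] by blast
  then have "g' (vertex 0) = g (vertex 0) + m" "g' (vertex 1) = g (vertex 1) + m" by simp_all
  then show ?thesis unfolding winding_def by (intro arg_cong [of _ _ floor]) linarith
qed

text \<open>The tetrahedron with angles 0, a, a + b, a + b + c turns the simplicial cocycle
  condition into that of group cohomology; its face opposite 0 is moved back to 0 by an integer
  translation.\<close>

lemma line_cocycle:
  assumes \<psi>: "\<And>\<sigma>. singular_simplex 3 (subtopology Y A) \<sigma> \<Longrightarrow> cobd 2 \<psi> \<sigma> = 0" and j: "j < k"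
  shows "\<psi> (line j [0, of_int b, of_int (b + c)]) - \<psi> (line j [0, of_int (a + b), of_int ((a + b) + c)])
     + \<psi> (line j [0, of_int a, of_int (a + (b + c))]) - \<psi> (line j [0, of_int a, of_int (a + b)]) = 0"
proof -
  have "singular_simplex 3 (subtopology Y A) (line j [0, of_int a, of_int (a + b), of_int (a + b + c)])"
    by (rule singular_simplex_line [OF j]) simp
  then have "cobd 2 \<psi> (line j [0, of_int a, of_int (a + b), of_int (a + b + c)]) = 0" by (rule \<psi>)
  moreover have "line j [of_int a, of_int (a + b), of_int (a + b + c)] = line j [0, of_int b, of_int (b + c)]"
    using line_shift [OF j, of "of_int a" "[0, of_int b, of_int (b + c)]"] by (simp add: add_ac)
  ultimately show ?thesis unfolding line_def by (simp add: cobd_2_pmap add.assoc)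
qed

text \<open>A triangle on a circle lifts as a whole, so its straightening can be written down. On
  each side it restricts to \<open>edge_slide\<close> with both numbers 0, and the prism identity
  then compares the triangle with a straight one given by its winding numbers.\<close>

lemma straighten_triangle:
  assumes \<psi>: "\<And>\<sigma>. singular_simplex 3 (subtopology Y A) \<sigma> \<Longrightarrow> cobd 2 \<psi> \<sigma> = 0"
    and \<sigma>: "singular_simplex 2 (subtopology Y A) \<sigma>" and l: "lifts 2 \<sigma> j g"
  defines "w \<equiv> \<lambda>i. winding (singular_face 2 i \<sigma>) (\<lambda>x. g (simplical_face i x))"
  shows "w 1 = w 2 + w 0"
    and "\<psi> \<sigma> = \<psi> (line j [0, of_int (w 2), of_int (w 2 + w 0)])
      - cobd 1 (\<lambda>e. prism_cochain \<psi> (edge_slide e 0 0)) \<sigma>"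
proof -
  \<comment> \<open>The integer by which the lift exceeds the chosen angle at a vertex. The homotopy
    ends at the affine function with these values, which puts all vertices on the base
    point.\<close>
  define m where "m = (\<lambda>i. g (vertex i) - vangle (\<sigma> (vertex i)))"
  have j: "j < k" using l by (simp add: lifts_def)
  have m: "m i \<in> \<int>" if "i \<le> 2" for i
    unfolding m_def using that by (intro winding_Ints [OF l]) simp
  have lf: "lifts 1 (singular_face 2 i \<sigma>) j (\<lambda>x. g (simplical_face i x))" if "i \<le> 2" for i
    by (rule lifts_face [OF l that])
  have wi: "of_int (w i) = (g (simplical_face i (vertex 1)) - vangle (\<sigma> (simplical_face i (vertex 1))))
      - (g (simplical_face i (vertex 0)) - vangle (\<sigma> (simplical_face i (vertex 0))))" if "i \<le> 2" for i
    using of_int_winding [OF lf [OF that]] unfolding w_def by (simp add: singular_face_apply)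
  have w: "of_int (w 0) = m 2 - m 1" "of_int (w 1) = m 2 - m 0" "of_int (w 2) = m 1 - m 0"
    using wi [of 0] wi [of 1] wi [of 2] unfolding simplical_face_vertex m_def by simp_all
  then have "real_of_int (w 1) = of_int (w 2 + w 0)" by simp
  then show w1: "w 1 = w 2 + w 0" by (simp only: of_int_eq_iff)
  define G where "G = (\<lambda>x t. cA j ((1 - t) * g x + t * (x 0 * m 0 + x 1 * m 1 + x 2 * m 2)))"
  have cont: "continuous_map (top_of_set (standard_simplex 2 \<times> {0..1})) (subtopology Y A) (case_prod G)"
  proof -
    have "continuous_on (standard_simplex 2 \<times> {0..1::real}) (\<lambda>w. g (fst w))"
      by (rule continuous_on_compose2 [of "standard_simplex 2" g])
        (use l in \<open>auto simp: lifts_def intro: continuous_on_fst\<close>)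
    moreover have "continuous_on S (\<lambda>w. fst w i)" for S :: "((nat \<Rightarrow> real) \<times> real) set" and i
      by (intro continuous_on_coordinate continuous_on_fst continuous_on_id)
    ultimately have "continuous_on (standard_simplex 2 \<times> {0..1}) (\<lambda>w. (1 - snd w) * g (fst w)
        + snd w * (fst w 0 * m 0 + fst w 1 * m 1 + fst w 2 * m 2))"
      by (intro continuous_on_add continuous_on_mult continuous_on_diff continuous_on_const
          continuous_on_snd continuous_on_id)
    from continuous_map_cA [OF j this] show ?thesis by (simp add: G_def split_def)
  qed
  have face: "prism_cochain \<psi> (\<lambda>x t. G (simplical_face i x) t) = prism_cochain \<psi> (edge_slide (singular_face 2 i \<sigma>) 0 0)"
    if i: "i \<le> 2" for i
  proof (rule prism_cochain_cong)
    fix x :: "nat \<Rightarrow> real" and t :: real assume x: "x \<in> standard_simplex 1" and t: "t \<in> {0..1}"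
    let ?e = "singular_face 2 i \<sigma>"
    have "singular_simplex 1 Y ?e"
      using singular_simplex_singular_face [OF in_A_imp_in_Y [OF \<sigma>], of i] i by simp
    then have "edge_slide ?e 0 0 x t = cA j (slide ?e (\<lambda>x. g (simplical_face i x)) 0 0 x t)"
      using edge_homotopy_edge_slide [of ?e 0 0] lf [OF i] x t unfolding edge_homotopy_def by blast
    moreover have "?e (vertex 0) = \<sigma> (simplical_face i (vertex 0))" "?e (vertex 1) = \<sigma> (simplical_face i (vertex 1))"
      by (simp_all add: singular_face_apply)
    moreover have "simplical_face i x 0 * m 0 + simplical_face i x 1 * m 1 + simplical_face i x 2 * m 2
      = x 0 * (g (simplical_face i (vertex 0)) - vangle (\<sigma> (simplical_face i (vertex 0))))
      + x 1 * (g (simplical_face i (vertex 1)) - vangle (\<sigma> (simplical_face i (vertex 1))))"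
    proof -
      consider "i = 0" | "i = 1" | "i = 2" using i by linarith
      then show ?thesis
      proof cases
        case 1
        have "simplical_face 0 x 0 = 0" "simplical_face 0 x 1 = x 0" "simplical_face 0 x 2 = x 1"
          by (simp_all add: simplical_face_def)
        then show ?thesis unfolding 1 simplical_face_vertex m_def by simp
      next
        case 2
        have "simplical_face 1 x 0 = x 0" "simplical_face 1 x 1 = 0" "simplical_face 1 x 2 = x 1"
          by (simp_all add: simplical_face_def)
        then show ?thesis unfolding 2 simplical_face_vertex m_def by simp
      next
        case 3
        have "simplical_face 2 x 0 = x 0" "simplical_face 2 x 1 = x 1" "simplical_face 2 x 2 = 0"
          by (simp_all add: simplical_face_def)
        then show ?thesis unfolding 3 simplical_face_vertex m_def by simp
      qed
    qed
    ultimately show "G (simplical_face i x) t = edge_slide ?e 0 0 x t"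
      by (simp add: G_def slide_def)
  qed
  have "pmap [(0,0),(1,0),(2,0)] G = \<sigma>"
    using l \<sigma> by (intro pmap_level) (auto simp: G_def lifts_def singular_simplex_def)
  moreover have "pmap [(0,1),(1,1),(2,1)] G = line j [0, of_int (w 2), of_int (w 2 + w 0)]"
  proof -
    have "pmap [(0,1),(1,1),(2,1)] G = restrict (\<lambda>x. G x 1) (standard_simplex 2)"
      by (rule pmap_level) simp_all
    also have "\<dots> = line j [m 0, m 1, m 2]"
      by (simp add: line_def pmap_def vheight_def G_def mult.commute numeral_2_eq_2)
    also have "\<dots> = line j (map (\<lambda>t. t + m 0) [0, of_int (w 2), of_int (w 1)])" by (simp add: w del: One_nat_def)
    also have "\<dots> = line j [0, of_int (w 2), of_int (w 2 + w 0)]"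
      unfolding w1 [symmetric] by (rule line_shift [OF j m]) simp_all
    finally show ?thesis .
  qed
  ultimately show "\<psi> \<sigma> = \<psi> (line j [0, of_int (w 2), of_int (w 2 + w 0)])
      - cobd 1 (\<lambda>e. prism_cochain \<psi> (edge_slide e 0 0)) \<sigma>"
    using prism_identity [where \<psi> = \<psi>, OF \<psi> cont] face [of 0] face [of 1] face [of 2]
    unfolding cobd_1 by simp
qed

text \<open>Straightening reduces \<open>\<psi>\<close> on each circle to a bounded 2-cocycle of the
  integers. The primitive is that of the integer cocycle at the winding number, corrected by the
  prism; hence the bound \<open>B + 2 * B\<close>.\<close>

theorem bounded_primitive_on_circles:
  assumes \<psi>: "\<And>\<sigma>. singular_simplex 3 (subtopology Y A) \<sigma> \<Longrightarrow> cobd 2 \<psi> \<sigma> = 0"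
    and B: "\<And>\<sigma>. singular_simplex 2 (subtopology Y A) \<sigma> \<Longrightarrow> \<bar>\<psi> \<sigma>\<bar> \<le> B"
  shows "\<exists>\<phi> C. (\<forall>e. singular_simplex 1 (subtopology Y A) e \<longrightarrow> \<bar>\<phi> e\<bar> \<le> C) \<and>
     (\<forall>\<sigma>. singular_simplex 2 (subtopology Y A) \<sigma> \<longrightarrow> \<psi> \<sigma> = cobd 1 \<phi> \<sigma>)"
proof -
  define f where "f = (\<lambda>j (a::int) (b::int). \<psi> (line j [0, of_int a, of_int (a + b)]))"
  have "\<forall>j. \<exists>\<Phi>. j < k \<longrightarrow> (\<forall>a. \<bar>\<Phi> a\<bar> \<le> B) \<and> (\<forall>a b. f j a b = \<Phi> b - \<Phi> (a + b) + \<Phi> a)"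
  proof
    fix j
    show "\<exists>\<Phi>. j < k \<longrightarrow> (\<forall>a. \<bar>\<Phi> a\<bar> \<le> B) \<and> (\<forall>a b. f j a b = \<Phi> b - \<Phi> (a + b) + \<Phi> a)"
    proof (cases "j < k")
      case True
      have "\<exists>\<Phi>. (\<forall>a. \<bar>\<Phi> a\<bar> \<le> B) \<and> (\<forall>a b. f j a b = \<Phi> b - \<Phi> (a + b) + \<Phi> a)"
      proof (rule bounded_int_cocycle_primitive)
        show "\<bar>f j a b\<bar> \<le> B" for a b
          unfolding f_def by (intro B singular_simplex_line True) simp
        show "f j b c - f j (a + b) c + f j a (b + c) - f j a b = 0" for a b c
          unfolding f_def by (rule line_cocycle [where \<psi> = \<psi>, OF \<psi> True])
      qed
      then show ?thesis by blast
    qed simp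
  qed
  then obtain \<Phi> where \<Phi>: "\<And>j a. j < k \<Longrightarrow> \<bar>\<Phi> j a\<bar> \<le> B"
    "\<And>j a b. j < k \<Longrightarrow> f j a b = \<Phi> j b - \<Phi> j (a + b) + \<Phi> j a" by metis
  have "\<forall>e. \<exists>jg. singular_simplex 1 (subtopology Y A) e \<longrightarrow> lifts 1 e (fst jg) (snd jg)"
    using lift_exists [of 1] by (auto simp: lifts_def)
  then obtain jg where jg: "\<And>e. singular_simplex 1 (subtopology Y A) e \<Longrightarrow> lifts 1 e (fst (jg e)) (snd (jg e))"
    by metis
  define F where "F = (\<lambda>e. \<Phi> (fst (jg e)) (winding e (snd (jg e))))"
  \<comment> \<open>\<open>F\<close> is defined by one chosen lift per edge, while the sides of a
    triangle come with the lift of the triangle; circle and winding number are the same for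
    both.\<close>
  have F: "F e = \<Phi> j (winding e g)" if "singular_simplex 1 (subtopology Y A) e" "lifts 1 e j g" for e j g
    unfolding F_def using lifts_unique(1) [OF that(2) jg [OF that(1)]] winding_independent [OF that(2) jg [OF that(1)]]
    by simp
  define \<phi> where "\<phi> = (\<lambda>e. F e - prism_cochain \<psi> (edge_slide e 0 0))"
  have "\<bar>\<phi> e\<bar> \<le> B + 2 * B" if e: "singular_simplex 1 (subtopology Y A) e" for e
  proof -
    have l: "lifts 1 e (fst (jg e)) (snd (jg e))" by (rule jg [OF e])
    then have j: "fst (jg e) < k" by (simp add: lifts_def)
    have "\<bar>prism_cochain \<psi> (edge_slide e 0 0)\<bar> \<le> 2 * B" by (rule abs_prism_cochain_edge_slide_le [OF B e])
    moreover have "\<bar>F e\<bar> \<le> B" unfolding F_def by (rule \<Phi>(1) [OF j])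
    ultimately show ?thesis unfolding \<phi>_def by linarith
  qed
  moreover have "\<psi> \<sigma> = cobd 1 \<phi> \<sigma>" if \<sigma>: "singular_simplex 2 (subtopology Y A) \<sigma>" for \<sigma>
  proof -
    obtain j g where l: "lifts 2 \<sigma> j g" using lift_exists [OF _ \<sigma>] by (auto simp: lifts_def)
    then have j: "j < k" by (simp add: lifts_def)
    let ?w = "\<lambda>i. winding (singular_face 2 i \<sigma>) (\<lambda>x. g (simplical_face i x))"
    have Fi: "F (singular_face 2 i \<sigma>) = \<Phi> j (?w i)" if "i \<le> 2" for i
      using singular_simplex_singular_face [OF \<sigma>, of i] that by (intro F lifts_face [OF l]) simp_all
    have "\<psi> \<sigma> = f j (?w 2) (?w 0) - cobd 1 (\<lambda>e. prism_cochain \<psi> (edge_slide e 0 0)) \<sigma>"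
      unfolding f_def by (rule straighten_triangle(2) [where \<psi> = \<psi>, OF \<psi> \<sigma> l])
    also have "f j (?w 2) (?w 0) = \<Phi> j (?w 0) - \<Phi> j (?w 1) + \<Phi> j (?w 2)"
      using \<Phi>(2) [OF j] straighten_triangle(1) [where \<psi> = \<psi>, OF \<psi> \<sigma> l] by simp
    also have "\<dots> = cobd 1 F \<sigma>" unfolding cobd_1 using Fi by simp
    finally show ?thesis unfolding \<phi>_def cobd_1 by simp
  qed
  ultimately show ?thesis by blast
qed

end

section \<open>The mapping cylinder\<close>

lemma continuous_map_apply: "continuous_map S T f \<Longrightarrow> x \<in> topspace S \<Longrightarrow> f x \<in> topspace T"
  using continuous_map_funspace by blast

text \<open>\<open>topology\<close> returns the given open sets only for a predicate that is closed
  under intersections and unions; both pass through the preimages that define it.\<close>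

lemma openin_mapping_cylinder:
  "openin (mapping_cylinder X k \<gamma>) U \<longleftrightarrow>
      U \<subseteq> Inl ` topspace X \<union> Inr ` (topspace (circles k) \<times> {0<..1}) \<and>
      openin X {x. Inl x \<in> U} \<and>
      openin (prod_topology (circles k) (top_of_set {0..1}))
             {w \<in> topspace (circles k) \<times> {0..1}. cyl_proj \<gamma> w \<in> U}"
proof -
  let ?T = "\<lambda>U. U \<subseteq> Inl ` topspace X \<union> Inr ` (topspace (circles k) \<times> {0<..1}) \<and>
      openin X {x. Inl x \<in> U} \<and>
      openin (prod_topology (circles k) (top_of_set {0..1}))
             {w \<in> topspace (circles k) \<times> {0..1}. cyl_proj \<gamma> w \<in> U}"
  have "istopology ?T"
    unfolding istopology_def
  proof (intro conjI allI impI)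
    fix S T assume S: "?T S" and T: "?T T"
    show "S \<inter> T \<subseteq> Inl ` topspace X \<union> Inr ` (topspace (circles k) \<times> {0<..1})" using S by blast
    have "{x. Inl x \<in> S \<inter> T} = {x. Inl x \<in> S} \<inter> {x. Inl x \<in> T}" by blast
    then show "openin X {x. Inl x \<in> S \<inter> T}" using S T by (simp only: openin_Int)
    have "{w \<in> topspace (circles k) \<times> {0..1}. cyl_proj \<gamma> w \<in> S \<inter> T}
      = {w \<in> topspace (circles k) \<times> {0..1}. cyl_proj \<gamma> w \<in> S} \<inter> {w \<in> topspace (circles k) \<times> {0..1}. cyl_proj \<gamma> w \<in> T}"
      by blast
    then show "openin (prod_topology (circles k) (top_of_set {0..1}))
        {w \<in> topspace (circles k) \<times> {0..1}. cyl_proj \<gamma> w \<in> S \<inter> T}" using S T by (simp only: openin_Int)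
  next
    fix \<K> assume K: "\<forall>K\<in>\<K>. ?T K"
    show "\<Union>\<K> \<subseteq> Inl ` topspace X \<union> Inr ` (topspace (circles k) \<times> {0<..1})" using K by blast
    have "{x. Inl x \<in> \<Union>\<K>} = (\<Union>K\<in>\<K>. {x. Inl x \<in> K})" by blast
    then show "openin X {x. Inl x \<in> \<Union>\<K>}" using K by (auto intro!: openin_Union)
    have "{w \<in> topspace (circles k) \<times> {0..1}. cyl_proj \<gamma> w \<in> \<Union>\<K>}
      = (\<Union>K\<in>\<K>. {w \<in> topspace (circles k) \<times> {0..1}. cyl_proj \<gamma> w \<in> K})"
      by blast
    then show "openin (prod_topology (circles k) (top_of_set {0..1}))
        {w \<in> topspace (circles k) \<times> {0..1}. cyl_proj \<gamma> w \<in> \<Union>\<K>}"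
      using K by (auto intro!: openin_Union)
  qed
  then show ?thesis unfolding mapping_cylinder_def by (simp add: topology_inverse')
qed

lemma topspace_mapping_cylinder:
  assumes "continuous_map (circles k) X \<gamma>"
  shows "topspace (mapping_cylinder X k \<gamma>) = Inl ` topspace X \<union> Inr ` (topspace (circles k) \<times> {0<..1})"
    (is "_ = ?W")
proof
  show "topspace (mapping_cylinder X k \<gamma>) \<subseteq> ?W"
    using openin_topspace [of "mapping_cylinder X k \<gamma>"] unfolding openin_mapping_cylinder by blast
  have "{x. Inl x \<in> ?W} = topspace X" by auto
  moreover have "{w \<in> topspace (circles k) \<times> {0..1}. cyl_proj \<gamma> w \<in> ?W}
      = topspace (prod_topology (circles k) (top_of_set {0..1}))"
    using continuous_map_apply [OF assms] by (auto simp: cyl_proj_def)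
  ultimately have "openin (mapping_cylinder X k \<gamma>) ?W"
    unfolding openin_mapping_cylinder by (simp only: openin_topspace subset_refl simp_thms)
  then show "?W \<subseteq> topspace (mapping_cylinder X k \<gamma>)" by (rule openin_subset)
qed

lemma continuous_map_Inl_cylinder:
  assumes "continuous_map (circles k) X \<gamma>"
  shows "continuous_map X (mapping_cylinder X k \<gamma>) Inl"
  unfolding continuous_map
proof (intro conjI allI impI)
  show "Inl ` topspace X \<subseteq> topspace (mapping_cylinder X k \<gamma>)"
    by (simp add: topspace_mapping_cylinder [OF assms])
  fix U assume "openin (mapping_cylinder X k \<gamma>) U"
  then have "openin X {x. Inl x \<in> U}" by (simp add: openin_mapping_cylinder)
  moreover from this have "{x \<in> topspace X. Inl x \<in> U} = {x. Inl x \<in> U}" using openin_subset by blast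
  ultimately show "openin X {x \<in> topspace X. Inl x \<in> U}" by simp
qed

lemma continuous_map_cyl_proj:
  assumes "continuous_map (circles k) X \<gamma>"
  shows "continuous_map (prod_topology (circles k) (top_of_set {0..1})) (mapping_cylinder X k \<gamma>) (cyl_proj \<gamma>)"
  unfolding continuous_map
proof (intro conjI allI impI)
  show "cyl_proj \<gamma> ` topspace (prod_topology (circles k) (top_of_set {0..1})) \<subseteq> topspace (mapping_cylinder X k \<gamma>)"
    using continuous_map_apply [OF assms] by (auto simp: topspace_mapping_cylinder [OF assms] cyl_proj_def)
  fix U assume "openin (mapping_cylinder X k \<gamma>) U"
  then show "openin (prod_topology (circles k) (top_of_set {0..1}))
      {w \<in> topspace (prod_topology (circles k) (top_of_set {0..1})). cyl_proj \<gamma> w \<in> U}"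
    by (simp add: openin_mapping_cylinder)
qed

section \<open>Deformation of the cylinder onto its base\<close>

definition cyl_retract :: "('c \<Rightarrow> 'a) \<Rightarrow> 'a + 'c \<times> real \<Rightarrow> 'a" where
  "cyl_retract \<gamma> = case_sum (\<lambda>x. x) (\<lambda>(u, t). \<gamma> u)"

lemma cyl_retract_Inl [simp]: "cyl_retract \<gamma> (Inl x) = x"
  by (simp add: cyl_retract_def)

lemma continuous_map_cyl_retract:
  assumes "continuous_map (circles k) X \<gamma>"
  shows "continuous_map (mapping_cylinder X k \<gamma>) X (cyl_retract \<gamma>)"
  unfolding continuous_map
proof (intro conjI allI impI)
  have \<gamma>: "\<gamma> u \<in> topspace X" if "u \<in> topspace (circles k)" for u
    using continuous_map_funspace [OF assms] that by auto
  then show "cyl_retract \<gamma> ` topspace (mapping_cylinder X k \<gamma>) \<subseteq> topspace X"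
    by (auto simp: topspace_mapping_cylinder [OF assms] cyl_retract_def)
  fix U assume U: "openin X U"
  let ?W = "{y \<in> topspace (mapping_cylinder X k \<gamma>). cyl_retract \<gamma> y \<in> U}"
  have "{x. Inl x \<in> ?W} = U"
    using openin_subset [OF U] by (auto simp: topspace_mapping_cylinder [OF assms])
  moreover have "{w \<in> topspace (circles k) \<times> {0..1}. cyl_proj \<gamma> w \<in> ?W}
     = {w \<in> topspace (prod_topology (circles k) (top_of_set {0..1})). (\<gamma> \<circ> fst) w \<in> U}"
    using \<gamma> by (auto simp: topspace_mapping_cylinder [OF assms] cyl_proj_def cyl_retract_def split: if_splits)
  moreover have "openin (prod_topology (circles k) (top_of_set {0..1}))
     {w \<in> topspace (prod_topology (circles k) (top_of_set {0..1})). (\<gamma> \<circ> fst) w \<in> U}"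
    by (rule openin_continuous_map_preimage [OF _ U])
      (rule continuous_map_compose [OF continuous_map_fst assms])
  ultimately show "openin (mapping_cylinder X k \<gamma>) ?W"
    unfolding openin_mapping_cylinder using U topspace_mapping_cylinder [OF assms] by auto
qed

text \<open>It passes through \<open>cyl_proj\<close> because a point whose height reaches 0 has to
  become the point of \<open>X\<close> to which it is glued.\<close>

definition cyl_contract :: "(nat \<times> (nat \<Rightarrow> real) \<Rightarrow> 'a) \<Rightarrow> 'a + (nat \<times> (nat \<Rightarrow> real)) \<times> real \<Rightarrow> real
    \<Rightarrow> 'a + (nat \<times> (nat \<Rightarrow> real)) \<times> real" where
  "cyl_contract \<gamma> y s = (case y of Inl x \<Rightarrow> Inl x | Inr (u, t) \<Rightarrow> cyl_proj \<gamma> (u, (1 - s) * t))"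

lemma cyl_contract_cyl_proj: "cyl_contract \<gamma> (cyl_proj \<gamma> (u, t)) s = cyl_proj \<gamma> (u, (1 - s) * t)"
  by (simp add: cyl_contract_def cyl_proj_def)

text \<open>The cylinder carries a quotient topology, so continuity on its product with the interval rests on
  a tube argument.\<close>

lemma continuous_map_cyl_contract:
  assumes \<gamma>: "continuous_map (circles k) X \<gamma>"
  shows "continuous_map (prod_topology (mapping_cylinder X k \<gamma>) (top_of_set {0..1})) (mapping_cylinder X k \<gamma>)
     (\<lambda>(y, s). cyl_contract \<gamma> y s)"
proof -
  let ?Y = "mapping_cylinder X k \<gamma>" and ?CI = "prod_topology (circles k) (top_of_set {0..1::real})"
  \<comment> \<open>The contraction before passing to the quotient, on circles times two intervals,
    where continuity is elementary.\<close>
  define h where "h = (\<lambda>(w, s). cyl_proj \<gamma> (fst w, (1 - s) * snd w))"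
  have h: "continuous_map (prod_topology ?CI (top_of_set J)) ?Y h" if J: "J \<subseteq> {0..1}" for J
  proof -
    have "continuous_map (prod_topology ?CI (top_of_set J)) euclideanreal (\<lambda>p. (1 - snd p) * snd (fst p))"
    proof (intro continuous_map_real_mult continuous_map_diff continuous_map_const [THEN iffD2])
      show "continuous_map (prod_topology ?CI (top_of_set J)) euclideanreal snd"
        using continuous_map_snd [of ?CI "top_of_set J"] continuous_map_into_fulltopology by blast
      have "continuous_map (prod_topology ?CI (top_of_set J)) (top_of_set {0..1}) (snd \<circ> fst)"
        by (rule continuous_map_compose [OF continuous_map_fst continuous_map_snd])
      then show "continuous_map (prod_topology ?CI (top_of_set J)) euclideanreal (\<lambda>p. snd (fst p))"
        using continuous_map_into_fulltopology by (auto simp: o_def)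
    qed auto
    moreover have "0 \<le> (1 - s) * t \<and> (1 - s) * t \<le> 1" if "s \<in> J" "t \<in> {0..1}" for s t
      using J that mult_mono [of "1 - s" 1 t 1] by auto
    ultimately have "continuous_map (prod_topology ?CI (top_of_set J)) (top_of_set {0..1}) (\<lambda>p. (1 - snd p) * snd (fst p))"
      by (auto simp: continuous_map_in_subtopology)
    moreover have "continuous_map (prod_topology ?CI (top_of_set J)) (circles k) (\<lambda>p. fst (fst p))"
      using continuous_map_compose [OF continuous_map_fst [of ?CI "top_of_set J"] continuous_map_fst] by (simp add: o_def)
    ultimately have "continuous_map (prod_topology ?CI (top_of_set J)) ?CI (\<lambda>p. (fst (fst p), (1 - snd p) * snd (fst p)))"
      by (simp add: continuous_map_pairwise o_def)
    from continuous_map_compose [OF this continuous_map_cyl_proj [OF \<gamma>]]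
    show ?thesis by (simp add: h_def o_def split_def)
  qed
  have hK: "cyl_contract \<gamma> (cyl_proj \<gamma> w) s = h (w, s)" for w s
    by (cases w) (simp add: h_def cyl_contract_cyl_proj)
  have surj: "\<exists>w\<in>topspace ?CI. y = cyl_proj \<gamma> w" if "y \<in> topspace ?Y" "y \<notin> Inl ` topspace X" for y
  proof -
    have "y \<in> Inr ` (topspace (circles k) \<times> {0<..1})"
      using that unfolding topspace_mapping_cylinder [OF \<gamma>] by blast
    then obtain u t where "y = Inr (u, t)" "u \<in> topspace (circles k)" "0 < t" "t \<le> 1" by auto
    then show ?thesis by (intro bexI [of _ "(u, t)"]) (auto simp: cyl_proj_def)
  qed
  have maps: "cyl_contract \<gamma> y s \<in> topspace ?Y" if y: "y \<in> topspace ?Y" and s: "s \<in> {0..1}" for y s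
  proof (cases "y \<in> Inl ` topspace X")
    case True
    then show ?thesis using y by (auto simp: cyl_contract_def)
  next
    case False
    then obtain w where w: "w \<in> topspace ?CI" "y = cyl_proj \<gamma> w" using surj [OF y] by blast
    have "h (w, s) \<in> topspace ?Y"
      using continuous_map_apply [OF h [OF subset_refl], of "(w, s)"] w s by simp
    then show ?thesis using w hK by simp
  qed
  show ?thesis
    unfolding continuous_map
  proof (intro conjI allI impI)
    show "(\<lambda>(y, s). cyl_contract \<gamma> y s) ` topspace (prod_topology ?Y (top_of_set {0..1})) \<subseteq> topspace ?Y"
      using maps by auto
    fix O' assume O: "openin ?Y O'"
    show "openin (prod_topology ?Y (top_of_set {0..1}))
        {p \<in> topspace (prod_topology ?Y (top_of_set {0..1})). (\<lambda>(y, s). cyl_contract \<gamma> y s) p \<in> O'}"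
      unfolding openin_prod_topology_alt
    proof (intro allI impI)
      fix y0 s0 assume "(y0, s0) \<in> {p \<in> topspace (prod_topology ?Y (top_of_set {0..1})). (\<lambda>(y, s). cyl_contract \<gamma> y s) p \<in> O'}"
      then have y0: "y0 \<in> topspace ?Y" and s0: "s0 \<in> {0..1}" and in_O: "cyl_contract \<gamma> y0 s0 \<in> O'" by auto
      have "openin (top_of_set {0..1}) {s \<in> {0..1}. cyl_contract \<gamma> y0 s \<in> O'}"
      proof (cases "y0 \<in> Inl ` topspace X")
        case True
        then have "cyl_contract \<gamma> y0 s = y0" for s by (auto simp: cyl_contract_def)
        then have "{s \<in> {0..1}. cyl_contract \<gamma> y0 s \<in> O'} = {0..1}" using in_O by auto
        then show ?thesis by simp
      next
        case False
        then obtain w where w: "w \<in> topspace ?CI" "y0 = cyl_proj \<gamma> w" using surj y0 by blast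
        have "continuous_map (top_of_set {0..1}) (prod_topology ?CI (top_of_set {0..1})) (\<lambda>s. (w, s))"
          using w(1) by (simp add: continuous_map_pairwise o_def)
        from continuous_map_compose [OF this h [OF subset_refl]]
        have "openin (top_of_set {0..1}) {s \<in> topspace (top_of_set {0..1}). (h \<circ> (\<lambda>s. (w, s))) s \<in> O'}"
          by (rule openin_continuous_map_preimage [OF _ O])
        then show ?thesis using w(2) hK by (simp add: o_def)
      qed
      then obtain e where e: "e > 0" "cball s0 e \<inter> {0..1} \<subseteq> {s \<in> {0..1}. cyl_contract \<gamma> y0 s \<in> O'}"
        using s0 in_O unfolding openin_contains_cball by blast
      \<comment> \<open>A closed ball is used because the tube argument needs a compact time
        interval around \<open>s0\<close>; the open ball inside it serves as the neighbourhood in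
        the end.\<close>
      define J where "J = cball s0 e \<inter> {0..1}"
      have J: "J \<subseteq> {0..1}" "compact J" "s0 \<in> J"
        using s0 e(1) by (auto simp: J_def intro: compact_Int)
      define U where "U = {y \<in> topspace ?Y. \<forall>s\<in>J. cyl_contract \<gamma> y s \<in> O'}"
      have "openin ?Y U"
        unfolding openin_mapping_cylinder
      proof (intro conjI)
        show "U \<subseteq> Inl ` topspace X \<union> Inr ` (topspace (circles k) \<times> {0<..1})"
          unfolding U_def topspace_mapping_cylinder [OF \<gamma>] by blast
        have "{x. Inl x \<in> U} = {x. Inl x \<in> O'}"
          using J(3) openin_subset [OF O] by (auto simp: U_def cyl_contract_def)
        then show "openin X {x. Inl x \<in> U}" using O by (simp add: openin_mapping_cylinder)
        \<comment> \<open>Projection along the compact \<open>J\<close> is a closed map, so the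
          points that leave \<open>O'\<close> at some time in \<open>J\<close> form a closed
          set.\<close>
        let ?B = "{p \<in> topspace (prod_topology ?CI (top_of_set J)). h p \<in> topspace ?Y - O'}"
        have "closedin (prod_topology ?CI (top_of_set J)) ?B"
          using O by (intro closedin_continuous_map_preimage [OF h [OF J(1)]]) auto
        moreover have "closed_map (prod_topology ?CI (top_of_set J)) ?CI fst"
          using J(2) by (intro closed_map_fst) (simp add: compact_space_subtopology)
        ultimately have "closedin ?CI (fst ` ?B)" by (auto simp: closed_map_def)
        moreover have "{w \<in> topspace (circles k) \<times> {0..1}. cyl_proj \<gamma> w \<in> U} = topspace ?CI - fst ` ?B"
        proof -
          have "cyl_proj \<gamma> w \<in> U \<longleftrightarrow> w \<notin> fst ` ?B" if w: "w \<in> topspace ?CI" for w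
          proof -
            have "cyl_proj \<gamma> w \<in> topspace ?Y"
              using continuous_map_funspace [OF continuous_map_cyl_proj [OF \<gamma>]] w by blast
            then have "cyl_proj \<gamma> w \<in> U \<longleftrightarrow> (\<forall>s\<in>J. h (w, s) \<in> O')" by (simp add: U_def hK)
            also have "\<dots> \<longleftrightarrow> (\<forall>s\<in>J. (w, s) \<notin> ?B)"
            proof -
              have "h (w, s) \<in> topspace ?Y" if "s \<in> J" for s
                using continuous_map_funspace [OF h [OF J(1)]] w that by (auto simp: Pi_iff)
              then show ?thesis using w by auto
            qed
            also have "\<dots> \<longleftrightarrow> w \<notin> fst ` ?B" by force
            finally show ?thesis .
          qed
          then show ?thesis by auto
        qed
        ultimately show "openin ?CI {w \<in> topspace (circles k) \<times> {0..1}. cyl_proj \<gamma> w \<in> U}"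
          by (simp only: openin_diff openin_topspace)
      qed
      moreover have "openin (top_of_set {0..1}) (ball s0 e \<inter> {0..1})"
        unfolding Int_commute [of "ball s0 e"] by (rule openin_open_Int) (rule open_ball)
      moreover have "y0 \<in> U" using y0 e(2) by (auto simp: U_def J_def)
      moreover have "U \<times> (ball s0 e \<inter> {0..1}) \<subseteq> {p \<in> topspace (prod_topology ?Y (top_of_set {0..1})). (\<lambda>(y, s). cyl_contract \<gamma> y s) p \<in> O'}"
      proof -
        have "ball s0 e \<inter> {0..1} \<subseteq> J" unfolding J_def by auto
        then show ?thesis unfolding U_def by auto
      qed
      ultimately show "\<exists>U V. openin ?Y U \<and> openin (top_of_set {0..1}) V \<and> y0 \<in> U \<and> s0 \<in> V \<and>
          U \<times> V \<subseteq> {p \<in> topspace (prod_topology ?Y (top_of_set {0..1})). (\<lambda>(y, s). cyl_contract \<gamma> y s) p \<in> O'}"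
        using s0 e(1) by (intro exI [of _ U] exI [of _ "ball s0 e \<inter> {0..1}"]) auto
    qed
  qed
qed

section \<open>The circles at the end of the cylinder\<close>

definition circle_point :: "real \<Rightarrow> nat \<Rightarrow> real" where
  "circle_point s = (\<lambda>i. if i = 0 then cos (2 * pi * s) else if i = 1 then sin (2 * pi * s) else 0)"

lemma circle_point_eq_iff: "circle_point s = circle_point t \<longleftrightarrow> s - t \<in> \<int>"
proof -
  have "circle_point s = circle_point t \<longleftrightarrow> sin (2 * pi * s) = sin (2 * pi * t) \<and> cos (2 * pi * s) = cos (2 * pi * t)"
    by (auto simp: circle_point_def fun_eq_iff)
  also have "\<dots> \<longleftrightarrow> (\<exists>n::int. 2 * pi * s = 2 * pi * t + 2 * pi * n)" by (rule sin_cos_eq_iff)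
  also have "\<dots> \<longleftrightarrow> (\<exists>n::int. s - t = of_int n)"
  proof -
    have "2 * pi * s = 2 * pi * t + 2 * pi * n \<longleftrightarrow> s - t = n" for n :: real
    proof -
      have "2 * pi * s = 2 * pi * t + 2 * pi * n \<longleftrightarrow> (2 * pi) * (s - t) = (2 * pi) * n"
        by (auto simp: right_diff_distrib)
      then show ?thesis by simp
    qed
    then show ?thesis by simp
  qed
  finally show ?thesis by (auto simp: Ints_def)
qed

lemma topspace_nsphere_1: "topspace (nsphere 1) = {x. (\<forall>i>1. x i = 0) \<and> x 0 ^ 2 + x 1 ^ 2 = (1::real)}"
  by (auto simp: nsphere)

lemma continuous_map_circle_point: "continuous_map euclideanreal (nsphere 1) circle_point"
proof -
  have "continuous_on UNIV circle_point"
    unfolding circle_point_def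
    by (rule continuous_on_coordinatewise_then_product) (intro continuous_on_if_const continuous_intros)
  moreover have "circle_point s \<in> topspace (nsphere 1)" for s
    unfolding topspace_nsphere_1 by (simp add: circle_point_def)
  ultimately show ?thesis
    unfolding nsphere by (auto simp: continuous_map_in_subtopology euclidean_product_topology nsphere)
qed

definition cyl_circle :: "nat \<Rightarrow> real \<Rightarrow> 'a + (nat \<times> (nat \<Rightarrow> real)) \<times> real" where
  "cyl_circle j s = Inr ((j, circle_point s), 1)"

lemma topspace_circles: "topspace (circles k) = {..<k} \<times> topspace (nsphere 1)"
  by (auto simp: circles_def)

lemma continuous_map_snd_circles: "continuous_map (circles k) (nsphere 1) snd"
  unfolding continuous_map
proof (intro conjI allI impI)
  show "snd ` topspace (circles k) \<subseteq> topspace (nsphere 1)" by (auto simp: topspace_circles)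
  fix U assume U: "openin (nsphere 1) U"
  have "{x. (i, x) \<in> {w \<in> topspace (circles k). snd w \<in> U}} = U" if "i < k" for i
    using that openin_subset [OF U] by (auto simp: topspace_circles)
  then show "openin (circles k) {w \<in> topspace (circles k). snd w \<in> U}"
    using U unfolding circles_def openin_sum_topology by auto
qed

text \<open>The index of the circle, as a real function, is locally constant. On a connected simplex
  it is therefore constant, which puts the simplex on one circle.\<close>

lemma continuous_map_fst_circles: "continuous_map (circles k) euclideanreal (\<lambda>w. real (fst w))"
  unfolding continuous_map
proof (intro conjI allI impI)
  fix U :: "real set"
  have "{x. (i, x) \<in> {w \<in> topspace (circles k). real (fst w) \<in> U}} = (if real i \<in> U then topspace (nsphere 1) else {})"
    if "i < k" for i
    using that by (auto simp: topspace_circles)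
  then show "openin (circles k) {w \<in> topspace (circles k). real (fst w) \<in> U}"
    unfolding circles_def openin_sum_topology by auto
qed auto

definition end_point :: "'a + 'c \<times> real \<Rightarrow> 'c" where
  "end_point y = fst (projr y)"

text \<open>An open set \<open>U\<close> of the circles is the trace on the end of the half-open
  collar \<open>U \<times> {0<..1}\<close>. The collar avoids the base, so it is open in the
  cylinder.\<close>

lemma continuous_map_end_point:
  assumes \<gamma>: "continuous_map (circles k) X \<gamma>"
  shows "continuous_map (subtopology (mapping_cylinder X k \<gamma>) (cyl_end k)) (circles k) end_point"
  unfolding continuous_map
proof (intro conjI allI impI)
  show "end_point ` topspace (subtopology (mapping_cylinder X k \<gamma>) (cyl_end k)) \<subseteq> topspace (circles k)"
    by (auto simp: cyl_end_def end_point_def)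
  fix U assume U: "openin (circles k) U"
  have sub: "U \<subseteq> topspace (circles k)" by (rule openin_subset [OF U])
  let ?V = "Inr ` (U \<times> {0<..1}) :: ('a + (nat \<times> (nat \<Rightarrow> real)) \<times> real) set"
  have "{w \<in> topspace (circles k) \<times> {0..1}. cyl_proj \<gamma> w \<in> ?V} = U \<times> {0<..1}"
    using sub by (auto simp: cyl_proj_def split: if_splits)
  moreover have "openin (prod_topology (circles k) (top_of_set {0..1})) (U \<times> {0<..1::real})"
  proof -
    have "openin (top_of_set {0..1}) ({0..1} \<inter> {0<..} :: real set)" by (intro openin_open_Int) simp
    moreover have "{0..1} \<inter> {0<..} = {0<..1::real}" by auto
    ultimately have "openin (top_of_set {0..1}) {0<..1::real}" by (simp only:)
    then show ?thesis using U by (simp add: openin_prod_Times_iff)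
  qed
  moreover have "{x. Inl x \<in> ?V} = {}" by auto
  ultimately have "openin (mapping_cylinder X k \<gamma>) ?V"
    unfolding openin_mapping_cylinder using sub by auto
  moreover have "{y \<in> topspace (subtopology (mapping_cylinder X k \<gamma>) (cyl_end k)). end_point y \<in> U} = ?V \<inter> cyl_end k"
    using sub by (auto simp: cyl_end_def end_point_def topspace_mapping_cylinder [OF \<gamma>])
  ultimately show "openin (subtopology (mapping_cylinder X k \<gamma>) (cyl_end k))
      {y \<in> topspace (subtopology (mapping_cylinder X k \<gamma>) (cyl_end k)). end_point y \<in> U}"
    by (auto simp: openin_subtopology)
qed

text \<open>A nonvanishing function on a contractible subset of a normed space has a continuous
  logarithm. The coordinates 1 and 2 identify the simplex with a convex set \<open>D\<close> in the
  plane, which is where \<open>p \<le> 2\<close> enters; modulus 1 makes the logarithm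
  imaginary.\<close>

lemma lift_to_angle:
  fixes F :: "(nat \<Rightarrow> real) \<Rightarrow> complex"
  assumes p: "p \<le> 2" and F: "continuous_on (standard_simplex p) F" "\<And>x. x \<in> standard_simplex p \<Longrightarrow> cmod (F x) = 1"
  shows "\<exists>g. continuous_on (standard_simplex p) g \<and> (\<forall>x\<in>standard_simplex p. F x = cis (2 * pi * g x))"
proof -
  define \<pi> where "\<pi> = (\<lambda>(s :: real, t) i. if i = (0::nat) then 1 - s - t else if i = 1 then s else if i = 2 then t else (0::real))"
  define D where "D = {w. \<pi> w \<in> standard_simplex p}"
  have "convex D"
  proof (rule convexI)
    fix w w' u v assume w: "w \<in> D" "w' \<in> D" and u: "0 \<le> u" "0 \<le> v" "u + v = (1::real)"
    have "\<pi> (u *\<^sub>R w + v *\<^sub>R w') = (\<lambda>i. (1 - v) * \<pi> w i + v * \<pi> w' i)"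
    proof -
      have uv: "u = 1 - v" using u by simp
      show ?thesis unfolding uv by (cases w; cases w') (auto simp: \<pi>_def fun_eq_iff algebra_simps)
    qed
    then show "u *\<^sub>R w + v *\<^sub>R w' \<in> D"
      using convex_standard_simplex [of "\<pi> w" p "\<pi> w'" v] w u by (simp add: D_def)
  qed
  have "continuous_on D \<pi>"
    unfolding \<pi>_def split_def
    by (rule continuous_on_coordinatewise_then_product) (intro continuous_on_if_const continuous_intros)
  then have "continuous_on D (\<lambda>w. F (\<pi> w))"
    by (rule continuous_on_compose2 [OF F(1)]) (auto simp: D_def)
  moreover have "F (\<pi> w) \<noteq> 0" if "w \<in> D" for w
    using F(2) [of "\<pi> w"] that by (auto simp: D_def)
  ultimately have "\<exists>h. continuous_on D h \<and> (\<forall>w\<in>D. F (\<pi> w) = exp (h w))"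
    using continuous_logarithm_on_contractible [OF _ convex_imp_contractible [OF \<open>convex D\<close>], of "\<lambda>w. F (\<pi> w)"]
    by (metis (no_types, lifting))
  then obtain h where h: "continuous_on D h" "\<And>w. w \<in> D \<Longrightarrow> F (\<pi> w) = exp (h w)" by blast
  have \<pi>: "\<pi> (x 1, x 2) = x" if "x \<in> standard_simplex p" for x
  proof
    fix i :: nat
    have x: "x \<in> standard_simplex 2" using standard_simplex_mono [OF p] that by blast
    consider "i = 0" | "i = 1" | "i = 2" | "i > 2" by linarith
    then show "\<pi> (x 1, x 2) i = x i"
      using standard_simplex_2D [OF x] by cases (auto simp: \<pi>_def)
  qed
  define g where "g = (\<lambda>x :: nat \<Rightarrow> real. Im (h (x 1, x 2)) / (2 * pi))"
  have "continuous_on (standard_simplex p) (\<lambda>x. h (x 1, x 2))"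
    by (rule continuous_on_compose2 [OF h(1)])
      (auto simp: D_def \<pi> simp del: One_nat_def intro!: continuous_on_Pair continuous_on_coordinate continuous_on_id)
  then have "continuous_on (standard_simplex p) g"
    unfolding g_def by (intro continuous_intros) auto
  moreover have "F x = cis (2 * pi * g x)" if x: "x \<in> standard_simplex p" for x
  proof -
    have D: "(x 1, x 2) \<in> D" using \<pi> [OF x] x by (simp add: D_def)
    have Fx: "F x = exp (h (x 1, x 2))" using h(2) [OF D] \<pi> [OF x] by simp
    then have "exp (Re (h (x 1, x 2))) = 1" using F(2) [OF x] by simp
    then have "Re (h (x 1, x 2)) = 0" by simp
    then have "F x = cis (Im (h (x 1, x 2)))" using Fx by (simp add: exp_eq_polar)
    then show ?thesis by (simp add: g_def)
  qed
  ultimately show ?thesis by blast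
qed

lemma circle_end_mapping_cylinder:
  assumes \<gamma>: "continuous_map (circles k) X \<gamma>"
  shows "circle_end (mapping_cylinder X k \<gamma>) (cyl_end k) k cyl_circle"
proof
  let ?Y = "mapping_cylinder X k \<gamma>"
  show "continuous_map euclideanreal (subtopology ?Y (cyl_end k)) (cyl_circle j)" if "j < k" for j
  proof -
    have "continuous_map euclideanreal (circles k) (\<lambda>s. (j, circle_point s))"
      using continuous_map_compose [OF continuous_map_circle_point
          continuous_map_component_injection [of j "{..<k}" "\<lambda>_. nsphere 1"]] that
      by (simp add: circles_def o_def)
    then have "continuous_map euclideanreal (prod_topology (circles k) (top_of_set {0..1})) (\<lambda>s. ((j, circle_point s), 1::real))"
      by (auto simp: continuous_map_pairwise o_def)
    from continuous_map_compose [OF this continuous_map_cyl_proj [OF \<gamma>]]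
    have "continuous_map euclideanreal ?Y (cyl_circle j)"
      by (simp add: o_def cyl_proj_def cyl_circle_def [abs_def])
    moreover have "cyl_circle j s \<in> cyl_end k" for s
      using continuous_map_funspace [OF continuous_map_circle_point] that
      by (auto simp: cyl_circle_def cyl_end_def topspace_circles)
    ultimately show ?thesis by (auto simp: continuous_map_in_subtopology)
  qed
  show "(cyl_circle j s = cyl_circle j' t) = (j = j' \<and> s - t \<in> \<int>)" for j j' s t
    by (simp add: cyl_circle_def circle_point_eq_iff)
  fix p :: nat and \<sigma> assume p: "p \<le> 2" and \<sigma>: "singular_simplex p (subtopology ?Y (cyl_end k)) \<sigma>"
  let ?S = "standard_simplex p"
  have cont: "continuous_map (top_of_set ?S) (subtopology ?Y (cyl_end k)) \<sigma>"
    using \<sigma> by (simp add: singular_simplex_iff_top_of_set)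
  define q where "q = (\<lambda>x. end_point (\<sigma> x))"
  have q: "continuous_map (top_of_set ?S) (circles k) q"
    using continuous_map_compose [OF cont continuous_map_end_point [OF \<gamma>]] by (simp add: q_def o_def)
  have \<sigma>q: "\<sigma> x = Inr (q x, 1)" "q x \<in> topspace (circles k)" if "x \<in> ?S" for x
  proof -
    have "\<sigma> x \<in> cyl_end k"
      using continuous_map_funspace [OF cont] that by auto
    then show "\<sigma> x = Inr (q x, 1)" by (auto simp: cyl_end_def q_def end_point_def)
    show "q x \<in> topspace (circles k)" using continuous_map_funspace [OF q] that by auto
  qed
  \<comment> \<open>Connectedness puts the simplex on a single circle; only then can an angle be
    lifted.\<close>
  have "(\<lambda>x. real (fst (q x))) constant_on ?S"
  proof (rule continuous_discrete_range_constant)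
    show "connected ?S" using connectedin_standard_simplex [of p] by (simp add: euclidean_product_topology)
    show "continuous_on ?S (\<lambda>x. real (fst (q x)))"
      using continuous_map_compose [OF q continuous_map_fst_circles] by (simp add: o_def)
    fix x
    have "1 \<le> norm (real m - real n)" if "real m \<noteq> real n" for m n
      using that by (cases "m < n") (auto simp: nat_neq_iff)
    then show "\<exists>e>0. \<forall>y. y \<in> ?S \<and> real (fst (q y)) \<noteq> real (fst (q x)) \<longrightarrow> e \<le> norm (real (fst (q y)) - real (fst (q x)))"
      by (intro exI [of _ 1]) auto
  qed
  then obtain c where c: "\<And>x. x \<in> ?S \<Longrightarrow> real (fst (q x)) = c" by (auto simp: constant_on_def)
  obtain x0 where x0: "x0 \<in> ?S" using nonempty_standard_simplex by blast
  define j where "j = fst (q x0)"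
  have j: "fst (q x) = j" if "x \<in> ?S" for x using c [OF that] c [OF x0] by (simp add: j_def)
  have jk: "j < k" using \<sigma>q(2) [OF x0] by (auto simp: topspace_circles j_def)
  define F where "F = (\<lambda>x. Complex (snd (q x) 0) (snd (q x) 1))"
  have sq: "continuous_map (top_of_set ?S) (nsphere 1) (\<lambda>x. snd (q x))"
    using continuous_map_compose [OF q continuous_map_snd_circles] by (simp add: o_def)
  have "continuous_on ?S (\<lambda>x. snd (q x) i)" for i
    using continuous_map_compose [OF sq continuous_map_nsphere_projection [of 1 i]] by (simp add: o_def)
  then have "continuous_on ?S F" unfolding F_def by (intro continuous_on_Complex) auto
  moreover have "cmod (F x) = 1" if "x \<in> ?S" for x
    using \<sigma>q(2) [OF that] by (auto simp: topspace_circles topspace_nsphere_1 F_def cmod_def simp del: One_nat_def)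
  ultimately obtain g where g: "continuous_on ?S g" "\<And>x. x \<in> ?S \<Longrightarrow> F x = cis (2 * pi * g x)"
    using lift_to_angle [OF p] by blast
  have "\<sigma> x = cyl_circle j (g x)" if x: "x \<in> ?S" for x
  proof -
    have "Complex (snd (q x) 0) (snd (q x) 1) = Complex (cos (2 * pi * g x)) (sin (2 * pi * g x))"
      using g(2) [OF x] by (simp add: F_def complex_eq_iff)
    moreover have "snd (q x) i = 0" if "i > 1" for i
      using \<sigma>q(2) [OF x] that by (auto simp: topspace_circles topspace_nsphere_1 simp del: One_nat_def)
    ultimately have "snd (q x) = circle_point (g x)"
      by (auto simp: circle_point_def fun_eq_iff)
    then have "q x = (j, circle_point (g x))" using j [OF x] by (simp add: prod_eq_iff)
    then show ?thesis using \<sigma>q(1) [OF x] by (simp add: cyl_circle_def)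
  qed
  with g(1) jk show "\<exists>j<k. \<exists>g. continuous_on ?S g \<and> (\<forall>x\<in>?S. \<sigma> x = cyl_circle j (g x))" by blast
qed

section \<open>A Hahn--Banach theorem for spaces of real functions\<close>

locale function_space =
  fixes V :: "('x \<Rightarrow> real) set"
  assumes zero_mem: "(\<lambda>_. 0) \<in> V"
    and add_mem: "\<lbrakk>x \<in> V; y \<in> V\<rbrakk> \<Longrightarrow> (\<lambda>i. x i + y i) \<in> V"
    and scale_mem: "x \<in> V \<Longrightarrow> (\<lambda>i. r * x i) \<in> V"
begin

text \<open>Homogeneity is required only as an inequality for positive factors, which is easy to
  check for infima; applying it to \<open>1 / r\<close> gives equality.\<close>

definition sublinear :: "(('x \<Rightarrow> real) \<Rightarrow> real) \<Rightarrow> bool" where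
  "sublinear q \<longleftrightarrow> (\<forall>x\<in>V. \<forall>y\<in>V. q (\<lambda>i. x i + y i) \<le> q x + q y) \<and>
     (\<forall>x\<in>V. \<forall>r>0. q (\<lambda>i. r * x i) \<le> r * q x)"

lemma sublinear_add: "\<lbrakk>sublinear q; x \<in> V; y \<in> V\<rbrakk> \<Longrightarrow> q (\<lambda>i. x i + y i) \<le> q x + q y"
  by (simp add: sublinear_def)

lemma sublinear_scale_le: "\<lbrakk>sublinear q; x \<in> V; r > 0\<rbrakk> \<Longrightarrow> q (\<lambda>i. r * x i) \<le> r * q x"
  by (simp add: sublinear_def)

lemma sublinear_scale:
  assumes "sublinear q" "x \<in> V" "r > 0"
  shows "q (\<lambda>i. r * x i) = r * q x"
proof (rule antisym [OF sublinear_scale_le [OF assms]])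
  have "q (\<lambda>i. (1 / r) * (r * x i)) \<le> (1 / r) * q (\<lambda>i. r * x i)"
    using sublinear_scale_le [OF assms(1) scale_mem [OF assms(2)], of "1 / r" r] assms(3) by simp
  then show "r * q x \<le> q (\<lambda>i. r * x i)" using assms(3) by (simp add: field_simps)
qed

lemma sublinear_minus:
  assumes "sublinear q" "x \<in> V"
  shows "- q (\<lambda>i. - x i) \<le> q x"
proof -
  have "0 \<le> q (\<lambda>_. 0)"
    using sublinear_scale_le [OF assms(1) zero_mem, of 2] by simp
  also have "\<dots> \<le> q x + q (\<lambda>i. - x i)"
    using sublinear_add [OF assms scale_mem [OF assms(2), of "-1"]] by simp
  finally show ?thesis by simp
qed

lemma minus_mem: "x \<in> V \<Longrightarrow> (\<lambda>i. - x i) \<in> V"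
  using scale_mem [of x "-1"] by simp

text \<open>The largest drop of \<open>q\<close> that is possible along the ray of \<open>y\<close>.
  It is again sublinear and lies below \<open>q\<close>, and taking \<open>t = 1\<close> shows that
  its value at \<open>- y\<close> is at most \<open>- q y\<close>.\<close>

definition lowered :: "(('x \<Rightarrow> real) \<Rightarrow> real) \<Rightarrow> ('x \<Rightarrow> real) \<Rightarrow> ('x \<Rightarrow> real) \<Rightarrow> real" where
  "lowered q y x = (INF t\<in>{0..}. q (\<lambda>i. x i + t * y i) - t * q y)"

context
  fixes q y assumes q: "sublinear q" and y: "y \<in> V"
begin

lemma lowered_bdd:
  assumes x: "x \<in> V"
  shows "bdd_below ((\<lambda>t. q (\<lambda>i. x i + t * y i) - t * q y) ` {0..})"
proof (rule bdd_belowI2)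
  fix t :: real assume "t \<in> {0..}"
  show "- q (\<lambda>i. - x i) \<le> q (\<lambda>i. x i + t * y i) - t * q y"
  proof (cases "t = 0")
    case True
    then show ?thesis using sublinear_minus [OF q x] by simp
  next
    case False
    then have "t * q y = q (\<lambda>i. t * y i)" using \<open>t \<in> {0..}\<close> sublinear_scale [OF q y, of t] by simp
    also have "\<dots> \<le> q (\<lambda>i. x i + t * y i) + q (\<lambda>i. - x i)"
      using sublinear_add [OF q add_mem [OF x scale_mem [OF y, of t]] minus_mem [OF x]] by simp
    finally show ?thesis by simp
  qed
qed

lemma lowered_le: "x \<in> V \<Longrightarrow> t \<ge> 0 \<Longrightarrow> lowered q y x \<le> q (\<lambda>i. x i + t * y i) - t * q y"
  unfolding lowered_def by (rule cINF_lower [OF lowered_bdd]) auto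

lemma lowered_le_self: "x \<in> V \<Longrightarrow> lowered q y x \<le> q x"
  using lowered_le [of x 0] by simp

lemma le_lowered: "(\<And>t. t \<ge> 0 \<Longrightarrow> c \<le> q (\<lambda>i. x i + t * y i) - t * q y) \<Longrightarrow> c \<le> lowered q y x"
  unfolding lowered_def by (rule cINF_greatest) auto

lemma sublinear_lowered: "sublinear (lowered q y)"
  unfolding sublinear_def
proof (intro conjI ballI allI impI)
  fix x x' assume x: "x \<in> V" "x' \<in> V"
  have "lowered q y (\<lambda>i. x i + x' i) - (q (\<lambda>i. x' i + t * y i) - t * q y) \<le> q (\<lambda>i. x i + s * y i) - s * q y"
    if "s \<ge> 0" "t \<ge> 0" for s t
  proof -
    have "lowered q y (\<lambda>i. x i + x' i) \<le> q (\<lambda>i. (x i + x' i) + (s + t) * y i) - (s + t) * q y"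
      using that by (intro lowered_le add_mem x) auto
    also have "(\<lambda>i. (x i + x' i) + (s + t) * y i) = (\<lambda>i. (x i + s * y i) + (x' i + t * y i))"
      by (simp add: algebra_simps)
    also have "q \<dots> \<le> q (\<lambda>i. x i + s * y i) + q (\<lambda>i. x' i + t * y i)"
      by (intro sublinear_add [OF q] add_mem x scale_mem y)
    finally show ?thesis by (simp add: algebra_simps)
  qed
  then have "lowered q y (\<lambda>i. x i + x' i) - (q (\<lambda>i. x' i + t * y i) - t * q y) \<le> lowered q y x" if "t \<ge> 0" for t
    using that by (intro le_lowered) auto
  then have "lowered q y (\<lambda>i. x i + x' i) - lowered q y x \<le> lowered q y x'"
    by (intro le_lowered) (simp add: algebra_simps)
  then show "lowered q y (\<lambda>i. x i + x' i) \<le> lowered q y x + lowered q y x'" by simp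
next
  fix x and r :: real assume x: "x \<in> V" and r: "r > 0"
  have "lowered q y (\<lambda>i. r * x i) / r \<le> q (\<lambda>i. x i + t * y i) - t * q y" if "t \<ge> 0" for t
  proof -
    have "lowered q y (\<lambda>i. r * x i) \<le> q (\<lambda>i. r * x i + (r * t) * y i) - (r * t) * q y"
      using that r by (intro lowered_le scale_mem x) auto
    also have "(\<lambda>i. r * x i + (r * t) * y i) = (\<lambda>i. r * (x i + t * y i))"
      by (simp add: algebra_simps)
    also have "q \<dots> = r * q (\<lambda>i. x i + t * y i)"
      using r by (intro sublinear_scale [OF q] add_mem x scale_mem y)
    finally show ?thesis using r by (simp add: field_simps)
  qed
  then have "lowered q y (\<lambda>i. r * x i) / r \<le> lowered q y x" by (rule le_lowered)
  then show "lowered q y (\<lambda>i. r * x i) \<le> r * lowered q y x" using r by (simp add: field_simps)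
qed

end

lemma minimal_sublinear_exists:
  assumes p: "sublinear p"
  obtains q where "sublinear q" "\<And>x. x \<in> V \<Longrightarrow> q x \<le> p x"
    "\<And>q' x. \<lbrakk>sublinear q'; \<And>x. x \<in> V \<Longrightarrow> q' x \<le> q x; x \<in> V\<rbrakk> \<Longrightarrow> q' x = q x"
proof -
  have sub_cong: "sublinear (restrict q V)" if "sublinear q" for q
    using that add_mem scale_mem by (auto simp: sublinear_def)
  \<comment> \<open>Extensionality on \<open>V\<close> turns equality on \<open>V\<close> into
    equality of functions, as antisymmetry of the order requires.\<close>
  define S where "S = {q \<in> extensional V. sublinear q \<and> (\<forall>x\<in>V. q x \<le> p x)}"
  let ?R = "\<lambda>q q'. \<forall>x\<in>V. q' x \<le> q x"
  have "\<exists>m\<in>S. \<forall>a\<in>S. ?R m a \<longrightarrow> a = m"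
  proof (rule predicate_Zorn)
    show "partial_order_on S (relation_of ?R S)"
    proof (rule partial_order_on_relation_ofI)
      fix a b assume "a \<in> S" "b \<in> S" "?R a b" "?R b a"
      then show "a = b" by (intro extensionalityI [of a V b]) (auto simp: S_def intro: antisym)
    qed (use order_trans in blast)+
    fix C assume C: "C \<in> Chains (relation_of ?R S)"
    then have CS: "C \<subseteq> S" by (auto simp: Chains_def relation_of_def)
    have chain: "?R a b \<or> ?R b a" if "a \<in> C" "b \<in> C" for a b
      using C that by (auto simp: Chains_def relation_of_def)
    show "\<exists>u\<in>S. \<forall>a\<in>C. ?R a u"
    proof (cases "C = {}")
      case True
      then show ?thesis using sub_cong [OF p] by (intro bexI [of _ "restrict p V"]) (auto simp: S_def)
    next
      case False
      define u where "u = (\<lambda>x. INF q\<in>C. q x)"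
      have bdd: "bdd_below ((\<lambda>q. q x) ` C)" if x: "x \<in> V" for x
      proof (rule bdd_belowI2)
        fix q assume "q \<in> C"
        then have q: "sublinear q" "q (\<lambda>i. - x i) \<le> p (\<lambda>i. - x i)" using CS minus_mem [OF x] by (auto simp: S_def)
        show "- p (\<lambda>i. - x i) \<le> q x" using sublinear_minus [OF q(1) x] q(2) by linarith
      qed
      have ule: "u x \<le> q x" if "x \<in> V" "q \<in> C" for x q
        unfolding u_def by (rule cINF_lower [OF bdd [OF that(1)] that(2)])
      have leu: "c \<le> u x" if "\<And>q. q \<in> C \<Longrightarrow> c \<le> q x" for c x
        unfolding u_def using False that by (rule cINF_greatest)
      have "sublinear u"
        unfolding sublinear_def
      proof (intro conjI ballI allI impI)
        fix x y assume xy: "x \<in> V" "y \<in> V"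
        \<comment> \<open>Two members of a chain have a common lower bound \<open>r\<close> within
          the chain, and subadditivity is applied to that one.\<close>
        have "u (\<lambda>i. x i + y i) - q' y \<le> q x" if q: "q \<in> C" "q' \<in> C" for q q'
        proof -
          obtain r where r: "r \<in> C" "?R q r" "?R q' r" using chain [OF q] q by blast
          have "u (\<lambda>i. x i + y i) \<le> r (\<lambda>i. x i + y i)" using r(1) by (intro ule add_mem xy)
          also have "\<dots> \<le> r x + r y" using r(1) CS xy by (intro sublinear_add) (auto simp: S_def)
          also have "\<dots> \<le> q x + q' y" using r xy by (intro add_mono) auto
          finally show ?thesis by simp
        qed
        then have "u (\<lambda>i. x i + y i) - q' y \<le> u x" if "q' \<in> C" for q' using that by (intro leu)
        then have "u (\<lambda>i. x i + y i) - u x \<le> u y" by (intro leu) (simp add: algebra_simps)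
        then show "u (\<lambda>i. x i + y i) \<le> u x + u y" by simp
      next
        fix x and r :: real assume x: "x \<in> V" and r: "r > 0"
        have "u (\<lambda>i. r * x i) / r \<le> q x" if q: "q \<in> C" for q
        proof -
          have "u (\<lambda>i. r * x i) \<le> q (\<lambda>i. r * x i)" using q by (intro ule scale_mem x)
          also have "\<dots> \<le> r * q x" using q CS x r by (intro sublinear_scale_le) (auto simp: S_def)
          finally show ?thesis using r by (simp add: field_simps)
        qed
        then have "u (\<lambda>i. r * x i) / r \<le> u x" by (rule leu)
        then show "u (\<lambda>i. r * x i) \<le> r * u x" using r by (simp add: field_simps)
      qed
      moreover have "u x \<le> p x" if x: "x \<in> V" for x
      proof -
        obtain q where q: "q \<in> C" using False by blast
        have "u x \<le> q x" by (rule ule [OF x q])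
        also have "\<dots> \<le> p x" using q CS x by (auto simp: S_def)
        finally show ?thesis .
      qed
      ultimately show ?thesis
        using sub_cong ule by (intro bexI [of _ "restrict u V"]) (auto simp: S_def)
    qed
  qed
  then obtain m where m: "m \<in> S" "\<And>a. a \<in> S \<Longrightarrow> ?R m a \<Longrightarrow> a = m" by blast
  have minimal: "q' x = m x" if q': "sublinear q'" "\<And>x. x \<in> V \<Longrightarrow> q' x \<le> m x" and x: "x \<in> V" for q' x
  proof -
    have "q' x \<le> p x" if "x \<in> V" for x
    proof -
      have "m x \<le> p x" using m(1) that by (simp add: S_def)
      then show ?thesis using q'(2) [OF that] by linarith
    qed
    then have "restrict q' V \<in> S" using sub_cong [OF q'(1)] by (simp add: S_def)
    then have "restrict q' V = m" by (rule m(2)) (simp add: q'(2))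
    from fun_cong [OF this, of x] show ?thesis using x by simp
  qed
  have "sublinear m" "\<And>x. x \<in> V \<Longrightarrow> m x \<le> p x" using m(1) by (simp_all add: S_def)
  then show ?thesis using minimal by (rule that)
qed

text \<open>A minimal sublinear functional cannot be lowered along any \<open>y\<close>, which
  forces additivity. Minimising below \<open>lowered p z\<close> instead of \<open>p\<close> bounds
  the value at \<open>- z\<close> by \<open>- p z\<close>, so that the functional attains
  \<open>p z\<close>.\<close>

theorem hahn_banach:
  assumes p: "sublinear p" and z: "z \<in> V"
  obtains F where "\<And>x y. \<lbrakk>x \<in> V; y \<in> V\<rbrakk> \<Longrightarrow> F (\<lambda>i. x i + y i) = F x + F y"
    "\<And>x r. x \<in> V \<Longrightarrow> F (\<lambda>i. r * x i) = r * F x"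
    "\<And>x. x \<in> V \<Longrightarrow> F x \<le> p x" "F z = p z"
proof -
  obtain q where q: "sublinear q" "\<And>x. x \<in> V \<Longrightarrow> q x \<le> lowered p z x"
    and min: "\<And>q' x. \<lbrakk>sublinear q'; \<And>x. x \<in> V \<Longrightarrow> q' x \<le> q x; x \<in> V\<rbrakk> \<Longrightarrow> q' x = q x"
    using minimal_sublinear_exists [OF sublinear_lowered [OF p z]] by blast
  have add: "q (\<lambda>i. x i + y i) = q x + q y" if x: "x \<in> V" and y: "y \<in> V" for x y
  proof (rule antisym [OF sublinear_add [OF q(1) x y]])
    have "q x = lowered q y x"
      using min [OF sublinear_lowered [OF q(1) y] lowered_le_self [OF q(1) y] x] by simp
    also have "\<dots> \<le> q (\<lambda>i. x i + 1 * y i) - 1 * q y"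
      by (rule lowered_le [OF q(1) y x]) simp
    finally show "q x + q y \<le> q (\<lambda>i. x i + y i)" by simp
  qed
  have q0: "q (\<lambda>_. 0) = 0" using add [OF zero_mem zero_mem] by simp
  have neg: "q (\<lambda>i. - x i) = - q x" if "x \<in> V" for x
    using add [OF that minus_mem [OF that]] q0 by simp
  have scale: "q (\<lambda>i. r * x i) = r * q x" if x: "x \<in> V" for x r
  proof -
    consider "r > 0" | "r = 0" | "r < 0" by linarith
    then show ?thesis
    proof cases
      case 1 then show ?thesis by (rule sublinear_scale [OF q(1) x])
    next
      case 2 then show ?thesis using q0 by simp
    next
      case 3
      have "q (\<lambda>i. (- r) * (- x i)) = (- r) * q (\<lambda>i. - x i)"
        using 3 by (intro sublinear_scale [OF q(1) minus_mem [OF x]]) simp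
      then show ?thesis using neg [OF x] by simp
    qed
  qed
  have le: "q x \<le> p x" if "x \<in> V" for x
    using q(2) [OF that] lowered_le_self [OF p z that] by linarith
  have "- q z \<le> - p z"
  proof -
    have "lowered p z (\<lambda>i. - z i) \<le> p (\<lambda>i. - z i + 1 * z i) - 1 * p z"
      by (rule lowered_le [OF p z minus_mem [OF z]]) simp
    moreover have "p (\<lambda>_. 0) \<le> 0"
      using sublinear_scale [OF p zero_mem, of 2] by simp
    ultimately show ?thesis using q(2) [OF minus_mem [OF z]] neg [OF z] by simp
  qed
  then have "q z = p z" using le [OF z] by simp
  with add scale le show ?thesis by (rule that)
qed

end

section \<open>Norm-attaining relative cocycles\<close>

abbreviation single :: "'x \<Rightarrow> 'x \<Rightarrow> real" where
  "single s \<equiv> (\<lambda>x. if x = s then 1 else 0)"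

lemma kronecker_single: "kronecker (single s) f = f s"
  by (simp add: kronecker_def)

lemma kronecker_single_right:
  assumes "finite {\<sigma>. c \<sigma> \<noteq> 0}"
  shows "kronecker c (single s) = c s"
  using kronecker_superset [of "insert s {\<sigma>. c \<sigma> \<noteq> 0}" c "single s", OF _ subset_insertI] assms
  by (simp add: if_distrib [of "\<lambda>x. _ * x"] cong: if_cong)

lemma rbd_eq_kronecker:
  assumes "finite {\<sigma>. c \<sigma> \<noteq> 0}"
  shows "rbd (Suc p) c s = kronecker c (cobd p (single s))"
  using kronecker_single_right [OF finite_rbd_support [OF assms], of "Suc p" s] kronecker_rbd [OF assms] by simp

lemma rchain_add:
  assumes "rchain p Y c" "rchain p Y d"
  shows "rchain p Y (\<lambda>\<sigma>. c \<sigma> + d \<sigma>)"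
proof -
  have "{\<sigma>. c \<sigma> + d \<sigma> \<noteq> 0} \<subseteq> {\<sigma>. c \<sigma> \<noteq> 0} \<union> {\<sigma>. d \<sigma> \<noteq> 0}" by auto
  moreover have "finite ({\<sigma>. c \<sigma> \<noteq> 0} \<union> {\<sigma>. d \<sigma> \<noteq> 0})" using assms by (simp add: rchain_def)
  ultimately have "finite {\<sigma>. c \<sigma> + d \<sigma> \<noteq> 0}" by (rule finite_subset)
  moreover have "singular_simplex p Y \<sigma>" if "c \<sigma> + d \<sigma> \<noteq> 0" for \<sigma>
  proof (cases "c \<sigma> = 0")
    case True
    then have "d \<sigma> \<noteq> 0" using that by simp
    then show ?thesis using assms(2) by (simp add: rchain_def)
  qed (use assms(1) in \<open>simp add: rchain_def\<close>)
  ultimately show ?thesis by (simp add: rchain_def)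
qed

lemma rchain_scale: "rchain p Y c \<Longrightarrow> rchain p Y (\<lambda>\<sigma>. r * c \<sigma>)"
  by (cases "r = 0") (simp_all add: rchain_def)

lemma rchain_zero: "rchain p Y (\<lambda>_. 0)"
  by (simp add: rchain_def)

lemma rchain_single: "singular_simplex p Y \<sigma> \<Longrightarrow> rchain p Y (single \<sigma>)"
  by (simp add: rchain_def)

lemma rbd_add:
  assumes "rchain q Y c" "rchain q Y d"
  shows "rbd (Suc p) (\<lambda>\<sigma>. c \<sigma> + d \<sigma>) s = rbd (Suc p) c s + rbd (Suc p) d s"
proof -
  have fin: "finite {\<sigma>. c \<sigma> \<noteq> 0}" "finite {\<sigma>. d \<sigma> \<noteq> 0}" "finite {\<sigma>. c \<sigma> + d \<sigma> \<noteq> 0}"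
    using assms rchain_add [OF assms] by (simp_all add: rchain_def)
  show ?thesis
    unfolding rbd_eq_kronecker [OF fin(1)] rbd_eq_kronecker [OF fin(2)] rbd_eq_kronecker [OF fin(3)]
    by (rule kronecker_add_left [OF fin(1,2)])
qed

lemma rbd_scale:
  assumes "rchain q Y c"
  shows "rbd (Suc p) (\<lambda>\<sigma>. r * c \<sigma>) s = r * rbd (Suc p) c s"
proof -
  have fin: "finite {\<sigma>. c \<sigma> \<noteq> 0}" "finite {\<sigma>. r * c \<sigma> \<noteq> 0}"
    using assms rchain_scale [OF assms, of r] by (simp_all only: rchain_def)
  show ?thesis
    unfolding rbd_eq_kronecker [OF fin(1)] rbd_eq_kronecker [OF fin(2)] by (rule kronecker_scale_left)
qed

lemma l1norm_superset:
  assumes "finite S" "{\<sigma>. c \<sigma> \<noteq> 0} \<subseteq> S"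
  shows "l1norm c = (\<Sum>\<sigma>\<in>S. \<bar>c \<sigma>\<bar>)"
  unfolding l1norm_def using assms by (intro sum.mono_neutral_left) auto

lemma l1norm_add_le:
  assumes "rchain p Y c" "rchain p Y d"
  shows "l1norm (\<lambda>\<sigma>. c \<sigma> + d \<sigma>) \<le> l1norm c + l1norm d"
proof -
  let ?S = "{\<sigma>. c \<sigma> \<noteq> 0} \<union> {\<sigma>. d \<sigma> \<noteq> 0}"
  have S: "finite ?S" using assms by (simp add: rchain_def)
  have "l1norm (\<lambda>\<sigma>. c \<sigma> + d \<sigma>) = (\<Sum>\<sigma>\<in>?S. \<bar>c \<sigma> + d \<sigma>\<bar>)" by (rule l1norm_superset [OF S]) auto
  also have "\<dots> \<le> (\<Sum>\<sigma>\<in>?S. \<bar>c \<sigma>\<bar> + \<bar>d \<sigma>\<bar>)" by (intro sum_mono abs_triangle_ineq)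
  also have "\<dots> = l1norm c + l1norm d"
    unfolding sum.distrib l1norm_superset [OF S Un_upper1] l1norm_superset [OF S Un_upper2] ..
  finally show ?thesis .
qed

lemma l1norm_scale: "l1norm (\<lambda>\<sigma>. r * c \<sigma>) = \<bar>r\<bar> * l1norm c"
  by (cases "r = 0") (simp_all add: l1norm_def abs_mult sum_distrib_left)

lemma l1norm_single: "l1norm (single s) = 1"
  by (simp add: l1norm_def)

lemma rhomologous_add:
  assumes "rhomologous p Y A c c'" "rhomologous p Y A d d'"
  shows "rhomologous p Y A (\<lambda>\<sigma>. c \<sigma> + d \<sigma>) (\<lambda>\<sigma>. c' \<sigma> + d' \<sigma>)"
proof -
  obtain b a where b: "rchain (Suc p) Y b" "rchain p (subtopology Y A) a"
    "\<And>\<sigma>. c \<sigma> - c' \<sigma> = rbd (Suc p) b \<sigma> + a \<sigma>" using assms(1) unfolding rhomologous_def by blast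
  obtain b' a' where b': "rchain (Suc p) Y b'" "rchain p (subtopology Y A) a'"
    "\<And>\<sigma>. d \<sigma> - d' \<sigma> = rbd (Suc p) b' \<sigma> + a' \<sigma>" using assms(2) unfolding rhomologous_def by blast
  show ?thesis unfolding rhomologous_def
  proof (intro exI conjI allI)
    show "rchain (Suc p) Y (\<lambda>\<sigma>. b \<sigma> + b' \<sigma>)" by (rule rchain_add [OF b(1) b'(1)])
    show "rchain p (subtopology Y A) (\<lambda>\<sigma>. a \<sigma> + a' \<sigma>)" by (rule rchain_add [OF b(2) b'(2)])
    show "c \<sigma> + d \<sigma> - (c' \<sigma> + d' \<sigma>) = rbd (Suc p) (\<lambda>\<sigma>. b \<sigma> + b' \<sigma>) \<sigma> + (a \<sigma> + a' \<sigma>)" for \<sigma>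
      unfolding rbd_add [OF b(1) b'(1)] using b(3) [of \<sigma>] b'(3) [of \<sigma>] by linarith
  qed
qed

lemma rhomologous_scale:
  assumes "rhomologous p Y A c c'"
  shows "rhomologous p Y A (\<lambda>\<sigma>. r * c \<sigma>) (\<lambda>\<sigma>. r * c' \<sigma>)"
proof -
  obtain b a where b: "rchain (Suc p) Y b" "rchain p (subtopology Y A) a"
    "\<And>\<sigma>. c \<sigma> - c' \<sigma> = rbd (Suc p) b \<sigma> + a \<sigma>" using assms(1) unfolding rhomologous_def by blast
  show ?thesis unfolding rhomologous_def
  proof (intro exI conjI allI)
    show "rchain (Suc p) Y (\<lambda>\<sigma>. r * b \<sigma>)" by (rule rchain_scale [OF b(1)])
    show "rchain p (subtopology Y A) (\<lambda>\<sigma>. r * a \<sigma>)" by (rule rchain_scale [OF b(2)])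
    show "r * c \<sigma> - r * c' \<sigma> = rbd (Suc p) (\<lambda>\<sigma>. r * b \<sigma>) \<sigma> + r * a \<sigma>" for \<sigma>
      unfolding rbd_scale [OF b(1)] using arg_cong [OF b(3) [of \<sigma>], of "\<lambda>x. r * x"] by (simp add: algebra_simps)
  qed
qed

lemma rbd_zero: "rbd p (\<lambda>_. 0) s = 0"
  by (simp add: rbd_def)

lemma rhomologous_refl: "rhomologous p Y A c c"
  unfolding rhomologous_def
  by (intro exI [of _ "\<lambda>_. 0"]) (simp add: rchain_zero rbd_zero)

text \<open>The difference from \<open>z\<close> is a boundary, which has no boundary, plus a chain
  of \<open>A\<close>.\<close>

lemma rrelcycle_of_homologous:
  assumes z: "rrelcycle 2 Y A z" and c: "rchain 2 Y c" and h: "rhomologous 2 Y A c z"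
  shows "rrelcycle 2 Y A c"
proof -
  obtain b a where b: "rchain 3 Y b" and a: "rchain 2 (subtopology Y A) a"
    and eq: "\<And>\<sigma>. c \<sigma> - z \<sigma> = rbd 3 b \<sigma> + a \<sigma>"
    using h by (auto simp: rhomologous_def numeral_3_eq_3 numeral_2_eq_2)
  have zc: "rchain 2 Y z" and dz: "rchain 1 (subtopology Y A) (rbd 2 z)"
    using z by (simp_all add: rrelcycle_def)
  have ac: "rchain 2 Y a" using a by (simp add: rchain_def singular_simplex_subtopology)
  have db: "rchain 2 Y (rbd 3 b)"
    using rchain_rbd [of 2 Y b] b by (simp add: numeral_3_eq_3 numeral_2_eq_2)
  have "c = (\<lambda>\<sigma>. z \<sigma> + (rbd 3 b \<sigma> + a \<sigma>))"
  proof
    fix \<sigma> show "c \<sigma> = z \<sigma> + (rbd 3 b \<sigma> + a \<sigma>)" using eq [of \<sigma>] by simp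
  qed
  then have "rbd (Suc 1) c s = rbd (Suc 1) z s + (rbd (Suc 1) (rbd 3 b) s + rbd (Suc 1) a s)" for s
    using rbd_add [OF zc rchain_add [OF db ac], of 1 s] rbd_add [OF db ac, of 1 s] by simp
  moreover have "rbd 2 (rbd 3 b) s = 0" for s
    using b by (intro rbd_rbd) (simp add: rchain_def)
  ultimately have "rbd 2 c = (\<lambda>s. rbd 2 z s + rbd 2 a s)"
    by (simp add: fun_eq_iff numeral_2_eq_2)
  moreover have "rchain 1 (subtopology Y A) (rbd 2 a)"
    using rchain_rbd [of 1 "subtopology Y A" a] a by (simp add: numeral_2_eq_2)
  ultimately show ?thesis using c dz by (simp add: rrelcycle_def rchain_add)
qed

text \<open>The quotient seminorm modulo boundaries and chains of \<open>A\<close>, on all 2-chains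
  instead of relative cycles. The functional extracted from it then has a value on every single
  simplex.\<close>

definition class_norm :: "'b topology \<Rightarrow> 'b set \<Rightarrow> ('b ssimplex \<Rightarrow> real) \<Rightarrow> real" where
  "class_norm Y A c = Inf (l1norm ` {c'. rchain 2 Y c' \<and> rhomologous 2 Y A c' c})"

lemma class_norm_le: "\<lbrakk>rchain 2 Y c'; rhomologous 2 Y A c' c\<rbrakk> \<Longrightarrow> class_norm Y A c \<le> l1norm c'"
  unfolding class_norm_def by (rule cINF_lower) (auto intro: bdd_belowI2 [of _ 0] l1norm_nonneg)

lemma le_class_norm:
  assumes "rchain 2 Y c" "\<And>c'. \<lbrakk>rchain 2 Y c'; rhomologous 2 Y A c' c\<rbrakk> \<Longrightarrow> x \<le> l1norm c'"
  shows "x \<le> class_norm Y A c"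
  unfolding class_norm_def
  by (rule cINF_greatest) (use assms rhomologous_refl in blast)+

lemma gromov_norm_eq_class_norm:
  assumes "rrelcycle 2 Y A z"
  shows "gromov_norm 2 Y A z = class_norm Y A z"
proof -
  have "rrelcycle 2 Y A c \<and> rhomologous 2 Y A c z \<longleftrightarrow> rchain 2 Y c \<and> rhomologous 2 Y A c z" for c
    using rrelcycle_of_homologous [OF assms] by (auto simp: rrelcycle_def)
  then have "{l1norm c |c. rrelcycle 2 Y A c \<and> rhomologous 2 Y A c z}
      = l1norm ` {c'. rchain 2 Y c' \<and> rhomologous 2 Y A c' z}" by auto
  then show ?thesis unfolding gromov_norm_def class_norm_def by simp
qed

interpretation chains: function_space "Collect (rchain 2 Y)" for Y
  by unfold_locales (simp_all add: rchain_zero rchain_add rchain_scale)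

lemma sublinear_class_norm: "chains.sublinear Y (class_norm Y A)"
  unfolding chains.sublinear_def
proof (intro conjI ballI allI impI)
  fix c d assume "c \<in> Collect (rchain 2 Y)" "d \<in> Collect (rchain 2 Y)"
  then have c: "rchain 2 Y c" and d: "rchain 2 Y d" by simp_all
  have "class_norm Y A (\<lambda>i. c i + d i) - l1norm d' \<le> l1norm c'"
    if "rchain 2 Y c'" "rhomologous 2 Y A c' c" "rchain 2 Y d'" "rhomologous 2 Y A d' d" for c' d'
    using class_norm_le [OF rchain_add [OF that(1,3)] rhomologous_add [OF that(2,4)]] l1norm_add_le [OF that(1,3)]
    by linarith
  then have "class_norm Y A (\<lambda>i. c i + d i) - l1norm d' \<le> class_norm Y A c"
    if "rchain 2 Y d'" "rhomologous 2 Y A d' d" for d'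
    using that by (intro le_class_norm [OF c]) blast
  then have "class_norm Y A (\<lambda>i. c i + d i) - class_norm Y A c \<le> class_norm Y A d"
    by (intro le_class_norm [OF d]) (simp add: algebra_simps)
  then show "class_norm Y A (\<lambda>i. c i + d i) \<le> class_norm Y A c + class_norm Y A d" by simp
next
  fix c and r :: real assume "c \<in> Collect (rchain 2 Y)" and r: "r > 0"
  then have c: "rchain 2 Y c" by simp
  have "class_norm Y A (\<lambda>i. r * c i) / r \<le> l1norm c'" if "rchain 2 Y c'" "rhomologous 2 Y A c' c" for c'
    using class_norm_le [OF rchain_scale [OF that(1), of r] rhomologous_scale [OF that(2)]] r
    by (simp add: l1norm_scale field_simps)
  then have "class_norm Y A (\<lambda>i. r * c i) / r \<le> class_norm Y A c" by (intro le_class_norm [OF c])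
  then show "class_norm Y A (\<lambda>i. r * c i) \<le> r * class_norm Y A c" using r by (simp add: field_simps)
qed

text \<open>A functional dominated by \<open>class_norm\<close> vanishes on chains of
  \<open>A\<close> and on boundaries. For the cochain of its values on single simplices this is
  exactly the condition of a relative cocycle.\<close>

theorem norm_attaining_cocycle:
  assumes z: "rrelcycle 2 Y A z"
  obtains \<psi> where "bcocycle 2 Y A \<psi>" "\<And>\<sigma>. singular_simplex 2 Y \<sigma> \<Longrightarrow> \<bar>\<psi> \<sigma>\<bar> \<le> 1"
    "kronecker z \<psi> = gromov_norm 2 Y A z"
proof -
  have zc: "rchain 2 Y z" using z by (simp add: rrelcycle_def)
  then have "z \<in> Collect (rchain 2 Y)" by simp
  then obtain F where "\<And>x y. \<lbrakk>x \<in> Collect (rchain 2 Y); y \<in> Collect (rchain 2 Y)\<rbrakk> \<Longrightarrow> F (\<lambda>i. x i + y i) = F x + F y"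
    "\<And>x r. x \<in> Collect (rchain 2 Y) \<Longrightarrow> F (\<lambda>i. r * x i) = r * F x"
    "\<And>x. x \<in> Collect (rchain 2 Y) \<Longrightarrow> F x \<le> class_norm Y A x" "F z = class_norm Y A z"
    by (rule chains.hahn_banach [OF sublinear_class_norm]) (rule that)
  note F = this [unfolded mem_Collect_eq]
  define \<psi> where "\<psi> = (\<lambda>\<sigma>. F (single \<sigma>))"
  have F0: "F (\<lambda>_. 0) = 0" using F(2) [OF rchain_zero, of 0] by simp
  have Fpart: "F (\<lambda>\<tau>. if \<tau> \<in> S then c \<tau> else 0) = (\<Sum>\<sigma>\<in>S. c \<sigma> * \<psi> \<sigma>)"
    if "finite S" "\<And>\<sigma>. \<sigma> \<in> S \<Longrightarrow> singular_simplex 2 Y \<sigma>" for S c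
    using that
  proof (induction S rule: finite_induct)
    case empty
    then show ?case using F0 by simp
  next
    case (insert s S)
    have eq: "(\<lambda>\<tau>. if \<tau> \<in> insert s S then c \<tau> else 0)
        = (\<lambda>\<tau>. c s * single s \<tau> + (if \<tau> \<in> S then c \<tau> else 0))"
      using insert.hyps(2) by auto
    have "rchain 2 Y (\<lambda>\<tau>. if \<tau> \<in> S then c \<tau> else 0)"
      using insert.prems insert.hyps(1) by (auto simp: rchain_def)
    moreover have s: "rchain 2 Y (single s)" by (rule rchain_single) (simp add: insert.prems)
    ultimately have "F (\<lambda>\<tau>. c s * single s \<tau> + (if \<tau> \<in> S then c \<tau> else 0))
        = F (\<lambda>\<tau>. c s * single s \<tau>) + F (\<lambda>\<tau>. if \<tau> \<in> S then c \<tau> else 0)"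
      by (intro F(1) rchain_scale)
    also have "F (\<lambda>\<tau>. c s * single s \<tau>) = c s * \<psi> s" unfolding \<psi>_def by (rule F(2) [OF s])
    also have "F (\<lambda>\<tau>. if \<tau> \<in> S then c \<tau> else 0) = (\<Sum>\<sigma>\<in>S. c \<sigma> * \<psi> \<sigma>)"
      using insert.IH insert.prems by simp
    finally show ?case unfolding eq using insert.hyps by simp
  qed
  have Fk: "F c = kronecker c \<psi>" if "rchain 2 Y c" for c
  proof -
    have "(\<lambda>\<tau>. if \<tau> \<in> {\<sigma>. c \<sigma> \<noteq> 0} then c \<tau> else 0) = c" by auto
    then show ?thesis using Fpart [of "{\<sigma>. c \<sigma> \<noteq> 0}" c] that by (simp add: rchain_def kronecker_def)
  qed
  have Fabs: "\<bar>F c\<bar> \<le> l1norm c'" if "rchain 2 Y c" "rchain 2 Y c'" "rhomologous 2 Y A c' c" for c c'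
  proof -
    have "F (\<lambda>i. (-1) * c i) \<le> class_norm Y A (\<lambda>i. (-1) * c i)" by (intro F(3) rchain_scale that(1))
    also have "\<dots> \<le> l1norm (\<lambda>i. (-1) * c' i)"
      by (intro class_norm_le rchain_scale rhomologous_scale that)
    finally have "- F c \<le> l1norm c'" unfolding F(2) [OF that(1)] l1norm_scale by simp
    moreover have "F c \<le> l1norm c'" using F(3) [OF that(1)] class_norm_le [OF that(2,3)] by linarith
    ultimately show ?thesis by linarith
  qed
  \<comment> \<open>The zero chain is allowed as representative in \<open>Fabs\<close>, and its norm
    is 0.\<close>
  have Fnull: "F c = 0" if c: "rchain 2 Y c" and h: "rhomologous 2 Y A (\<lambda>_. 0) c" for c
    using Fabs [OF c rchain_zero h] by (simp add: l1norm_def)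
  have bd: "\<bar>\<psi> \<sigma>\<bar> \<le> 1" if "singular_simplex 2 Y \<sigma>" for \<sigma>
    using Fabs [OF rchain_single [OF that] rchain_single [OF that] rhomologous_refl] unfolding \<psi>_def l1norm_single .
  have "\<psi> \<sigma> = 0" if \<sigma>: "singular_simplex 2 (subtopology Y A) \<sigma>" for \<sigma>
  proof -
    have \<sigma>Y: "singular_simplex 2 Y \<sigma>" using \<sigma> by (simp add: singular_simplex_subtopology)
    have "rhomologous 2 Y A (\<lambda>_. 0) (single \<sigma>)"
      unfolding rhomologous_def
    proof (intro exI conjI allI)
      show "rchain 2 (subtopology Y A) (\<lambda>\<tau>. (-1) * single \<sigma> \<tau>)" by (intro rchain_scale rchain_single \<sigma>)
      show "0 - single \<sigma> \<tau> = rbd (Suc 2) (\<lambda>_. 0) \<tau> + (-1) * single \<sigma> \<tau>" for \<tau>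
        by (simp add: rbd_zero)
    qed (rule rchain_zero)
    then show ?thesis unfolding \<psi>_def by (rule Fnull [OF rchain_single [OF \<sigma>Y]])
  qed
  moreover have "cobd 2 \<psi> \<tau> = 0" if \<tau>: "singular_simplex (Suc 2) Y \<tau>" for \<tau>
  proof -
    have c: "rchain 2 Y (rbd (Suc 2) (single \<tau>))" by (rule rchain_rbd [OF rchain_single [OF \<tau>]])
    have "rhomologous 2 Y A (\<lambda>_. 0) (rbd (Suc 2) (single \<tau>))"
      unfolding rhomologous_def
    proof (intro exI conjI allI)
      show "rchain (Suc 2) Y (\<lambda>\<sigma>. (-1) * single \<tau> \<sigma>)" by (intro rchain_scale rchain_single \<tau>)
      show "0 - rbd (Suc 2) (single \<tau>) \<sigma> = rbd (Suc 2) (\<lambda>\<sigma>. (-1) * single \<tau> \<sigma>) \<sigma> + 0" for \<sigma>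
        unfolding rbd_scale [OF rchain_single [OF \<tau>]] by simp
    qed (rule rchain_zero)
    then have "F (rbd (Suc 2) (single \<tau>)) = 0" by (rule Fnull [OF c])
    moreover have "kronecker (rbd (Suc 2) (single \<tau>)) \<psi> = cobd 2 \<psi> \<tau>"
      using kronecker_rbd [of "single \<tau>" 2 \<psi>] by (simp add: kronecker_single)
    ultimately show ?thesis using Fk [OF c] by simp
  qed
  ultimately have "bcocycle 2 Y A \<psi>" using bd by (auto simp: bcocycle_def bounded_cochain_def)
  moreover have "kronecker z \<psi> = gromov_norm 2 Y A z"
    using Fk [OF zc] F(4) gromov_norm_eq_class_norm [OF z] by simp
  ultimately show ?thesis using that bd by blast
qed

section \<open>Transport between the cylinder and its base\<close>

lemma singular_face_2_simplex_map:
  "k \<le> 2 \<Longrightarrow> singular_face 2 k (simplex_map 2 f \<sigma>) = simplex_map 1 f (singular_face 2 k \<sigma>)"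
  using face_in_simplex_2 by (auto simp: singular_face_def simplex_map_def restrict_def fun_eq_iff)

lemma singular_face_3_simplex_map:
  "k \<le> 3 \<Longrightarrow> singular_face 3 k (simplex_map 3 f \<sigma>) = simplex_map 2 f (singular_face 3 k \<sigma>)"
  using simplical_face_in_standard_simplex [of 3 k]
  by (auto simp: singular_face_def simplex_map_def restrict_def fun_eq_iff)

lemma cobd_1_pullback: "cobd 1 (pullback 1 f \<phi>) \<sigma> = cobd 1 \<phi> (simplex_map 2 f \<sigma>)"
  by (simp add: cobd_1 pullback_def singular_face_2_simplex_map del: One_nat_def)

lemma cobd_2_pullback: "cobd 2 (pullback 2 f \<psi>) \<sigma> = cobd 2 \<psi> (simplex_map 3 f \<sigma>)"
  by (simp add: cobd_2 pullback_def singular_face_3_simplex_map)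

lemma no_simplex_in_trivial: "\<not> singular_simplex p trivial_topology \<sigma>"
  by (rule singular_simplex_empty) simp

lemma bcocycle_empty_iff:
  "bcocycle 2 X {} \<psi> \<longleftrightarrow> bounded_cochain 2 X \<psi> \<and> (\<forall>\<sigma>. singular_simplex 3 X \<sigma> \<longrightarrow> cobd 2 \<psi> \<sigma> = 0)"
  by (simp add: bcocycle_def no_simplex_in_trivial)

lemma bcohomologous_empty_iff:
  "bcohomologous 2 X {} \<psi> \<psi>' \<longleftrightarrow> (\<exists>\<phi>. bounded_cochain 1 X \<phi> \<and>
     (\<forall>\<sigma>. singular_simplex 2 X \<sigma> \<longrightarrow> \<psi> \<sigma> - \<psi>' \<sigma> = cobd 1 \<phi> \<sigma>))"
  by (simp add: bcohomologous_def no_simplex_in_trivial)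

lemma bounded_cochain_add:
  assumes "bounded_cochain p X \<phi>" "bounded_cochain p X \<phi>'"
  shows "bounded_cochain p X (\<lambda>\<sigma>. \<phi> \<sigma> + \<phi>' \<sigma>)"
proof -
  obtain B B' where B: "\<And>\<sigma>. singular_simplex p X \<sigma> \<Longrightarrow> \<bar>\<phi> \<sigma>\<bar> \<le> B" "\<And>\<sigma>. singular_simplex p X \<sigma> \<Longrightarrow> \<bar>\<phi>' \<sigma>\<bar> \<le> B'"
    using assms by (auto simp: bounded_cochain_def)
  have "\<bar>\<phi> \<sigma> + \<phi>' \<sigma>\<bar> \<le> B + B'" if "singular_simplex p X \<sigma>" for \<sigma>
    using B(1) [OF that] B(2) [OF that] by linarith
  then show ?thesis by (auto simp: bounded_cochain_def)
qed

lemma bounded_cochain_uminus: "bounded_cochain p X \<phi> \<Longrightarrow> bounded_cochain p X (\<lambda>\<sigma>. - \<phi> \<sigma>)"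
  by (simp add: bounded_cochain_def)

lemma bounded_cochain_diff:
  "\<lbrakk>bounded_cochain p X \<phi>; bounded_cochain p X \<phi>'\<rbrakk> \<Longrightarrow> bounded_cochain p X (\<lambda>\<sigma>. \<phi> \<sigma> - \<phi>' \<sigma>)"
  using bounded_cochain_add [of p X \<phi> "\<lambda>\<sigma>. - \<phi>' \<sigma>"] bounded_cochain_uminus [of p X \<phi>'] by simp

lemma bounded_cochain_pullback:
  assumes "bounded_cochain p X \<phi>" "continuous_map Y X f"
  shows "bounded_cochain p Y (pullback p f \<phi>)"
  using assms singular_simplex_simplex_map unfolding bounded_cochain_def pullback_def by blast

lemma bcohomologous_trans:
  assumes "bcohomologous 2 X {} \<psi> \<psi>'" "bcohomologous 2 X {} \<psi>' \<psi>''"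
  shows "bcohomologous 2 X {} \<psi> \<psi>''"
proof -
  obtain \<phi> \<phi>' where *: "bounded_cochain 1 X \<phi>" "bounded_cochain 1 X \<phi>'"
    "\<And>\<sigma>. singular_simplex 2 X \<sigma> \<Longrightarrow> \<psi> \<sigma> - \<psi>' \<sigma> = cobd 1 \<phi> \<sigma>"
    "\<And>\<sigma>. singular_simplex 2 X \<sigma> \<Longrightarrow> \<psi>' \<sigma> - \<psi>'' \<sigma> = cobd 1 \<phi>' \<sigma>"
    using assms unfolding bcohomologous_empty_iff by blast
  have "\<psi> \<sigma> - \<psi>'' \<sigma> = cobd 1 (\<lambda>e. \<phi> e + \<phi>' e) \<sigma>" if "singular_simplex 2 X \<sigma>" for \<sigma>
    using *(3) [OF that] *(4) [OF that] unfolding cobd_1 by linarith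
  then show ?thesis unfolding bcohomologous_empty_iff using bounded_cochain_add [OF *(1,2)] by blast
qed

lemma bcohomologous_diff:
  assumes "bcohomologous 2 X {} \<psi> \<omega>" "bcohomologous 2 X {} \<psi>' \<omega>"
  shows "bcohomologous 2 X {} (\<lambda>\<sigma>. \<psi> \<sigma> - \<psi>' \<sigma>) (\<lambda>_. 0)"
proof -
  obtain \<phi> \<phi>' where *: "bounded_cochain 1 X \<phi>" "bounded_cochain 1 X \<phi>'"
    "\<And>\<sigma>. singular_simplex 2 X \<sigma> \<Longrightarrow> \<psi> \<sigma> - \<omega> \<sigma> = cobd 1 \<phi> \<sigma>"
    "\<And>\<sigma>. singular_simplex 2 X \<sigma> \<Longrightarrow> \<psi>' \<sigma> - \<omega> \<sigma> = cobd 1 \<phi>' \<sigma>"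
    using assms unfolding bcohomologous_empty_iff by blast
  have "\<psi> \<sigma> - \<psi>' \<sigma> - 0 = cobd 1 (\<lambda>e. \<phi> e - \<phi>' e) \<sigma>" if "singular_simplex 2 X \<sigma>" for \<sigma>
    using *(3) [OF that] *(4) [OF that] unfolding cobd_1 by linarith
  then show ?thesis unfolding bcohomologous_empty_iff using bounded_cochain_diff [OF *(1,2)] by blast
qed

lemma bcohomologous_refl: "bcohomologous 2 X {} \<psi> \<psi>"
  unfolding bcohomologous_empty_iff
  by (intro exI [of _ "\<lambda>_. 0"]) (auto simp: bounded_cochain_def cobd_1 simp del: One_nat_def)

lemma bcocycle_diff:
  assumes "bcocycle 2 Y A \<psi>" "bcocycle 2 Y A \<psi>'"
  shows "bcocycle 2 Y A (\<lambda>\<sigma>. \<psi> \<sigma> - \<psi>' \<sigma>)"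
proof -
  have "cobd 2 (\<lambda>\<sigma>. \<psi> \<sigma> - \<psi>' \<sigma>) \<sigma> = cobd 2 \<psi> \<sigma> - cobd 2 \<psi>' \<sigma>" for \<sigma>
    by (simp add: cobd_2)
  then show ?thesis using assms bounded_cochain_diff [of 2 Y \<psi> \<psi>'] by (simp add: bcocycle_def)
qed

lemma bcocycle_pullback:
  assumes "bcocycle 2 Y A \<psi>" "continuous_map X Y f"
  shows "bcocycle 2 X {} (pullback 2 f \<psi>)"
proof -
  have "cobd 2 (pullback 2 f \<psi>) \<sigma> = 0" if "singular_simplex 3 X \<sigma>" for \<sigma>
    unfolding cobd_2_pullback using assms(1) singular_simplex_simplex_map [OF that assms(2)]
    by (simp add: bcocycle_def)
  then show ?thesis unfolding bcocycle_empty_iff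
    using assms bounded_cochain_pullback by (auto simp: bcocycle_def)
qed

section \<open>Relative cocycles on the cylinder and the pairing\<close>

locale cylinder =
  fixes X :: "'a topology" and k :: nat and \<gamma> :: "nat \<times> (nat \<Rightarrow> real) \<Rightarrow> 'a"
  assumes \<gamma>: "continuous_map (circles k) X \<gamma>"
begin

abbreviation "Y \<equiv> mapping_cylinder X k \<gamma>"
abbreviation "A \<equiv> cyl_end k :: ('a + (nat \<times> (nat \<Rightarrow> real)) \<times> real) set"
abbreviation "r \<equiv> cyl_retract \<gamma>"

sublocale circle_end Y A k cyl_circle
  by (rule circle_end_mapping_cylinder [OF \<gamma>])

lemma r_continuous: "continuous_map Y X r"
  by (rule continuous_map_cyl_retract [OF \<gamma>])

lemma Inl_continuous: "continuous_map X Y Inl"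
  by (rule continuous_map_Inl_cylinder [OF \<gamma>])

lemma simplex_map_r_Inl:
  assumes "singular_simplex p X \<sigma>"
  shows "simplex_map p r (simplex_map p Inl \<sigma>) = \<sigma>"
  using assms unfolding singular_simplex_def simplex_map_def
  by (auto simp: fun_eq_iff restrict_def extensional_def)

text \<open>The pullback of \<open>\<psi>\<close> along the retraction has a bounded primitive on
  the circles. Once this is extended to the whole cylinder, subtracting its coboundary makes the
  cocycle vanish on \<open>A\<close> without changing the class.\<close>

lemma relative_representative_exists:
  assumes \<psi>: "bcocycle 2 X {} \<psi>"
  shows "\<exists>\<psi>'. bcocycle 2 Y A \<psi>' \<and> bcohomologous 2 X {} (pullback 2 Inl \<psi>') \<psi>"
proof -
  let ?\<psi> = "pullback 2 r \<psi>"
  have coc: "bcocycle 2 Y {} ?\<psi>" by (rule bcocycle_pullback [OF \<psi> r_continuous])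
  then have bd: "bounded_cochain 2 Y ?\<psi>" and c0: "\<And>\<sigma>. singular_simplex 3 Y \<sigma> \<Longrightarrow> cobd 2 ?\<psi> \<sigma> = 0"
    unfolding bcocycle_empty_iff by blast+
  obtain B where B: "\<And>\<sigma>. singular_simplex 2 Y \<sigma> \<Longrightarrow> \<bar>?\<psi> \<sigma>\<bar> \<le> B"
    using bd by (auto simp: bounded_cochain_def)
  have "\<exists>\<phi> C. (\<forall>e. singular_simplex 1 (subtopology Y A) e \<longrightarrow> \<bar>\<phi> e\<bar> \<le> C) \<and>
     (\<forall>\<sigma>. singular_simplex 2 (subtopology Y A) \<sigma> \<longrightarrow> ?\<psi> \<sigma> = cobd 1 \<phi> \<sigma>)"
    using c0 B by (intro bounded_primitive_on_circles) (use in_A_imp_in_Y in blast)+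
  then obtain \<phi> C where \<phi>: "\<And>e. singular_simplex 1 (subtopology Y A) e \<Longrightarrow> \<bar>\<phi> e\<bar> \<le> C"
    "\<And>\<sigma>. singular_simplex 2 (subtopology Y A) \<sigma> \<Longrightarrow> ?\<psi> \<sigma> = cobd 1 \<phi> \<sigma>" by blast
  \<comment> \<open>Extension by zero: cochains are subject to no continuity, and boundedness is
    preserved.\<close>
  define \<phi>' where "\<phi>' = (\<lambda>e. if singular_simplex 1 (subtopology Y A) e then \<phi> e else 0)"
  \<comment> \<open>If there are no circles, nothing forces \<open>C\<close> to be nonnegative;
    hence its absolute value.\<close>
  have "\<bar>\<phi>' e\<bar> \<le> \<bar>C\<bar>" for e using \<phi>(1) [of e] by (cases "singular_simplex 1 (subtopology Y A) e") (simp_all add: \<phi>'_def del: One_nat_def)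
  then have b1: "\<bar>cobd 1 \<phi>' \<sigma>\<bar> \<le> 3 * \<bar>C\<bar>" and bphi: "bounded_cochain 1 Y' \<phi>'" for \<sigma> and Y' :: "('a + (nat \<times> (nat \<Rightarrow> real)) \<times> real) topology"
  proof -
    assume *: "\<And>e. \<bar>\<phi>' e\<bar> \<le> \<bar>C\<bar>"
    show "\<bar>cobd 1 \<phi>' \<sigma>\<bar> \<le> 3 * \<bar>C\<bar>"
      using * [of "singular_face 2 0 \<sigma>"] * [of "singular_face 2 1 \<sigma>"] * [of "singular_face 2 2 \<sigma>"]
      unfolding cobd_1 by linarith
    show "bounded_cochain 1 Y' \<phi>'" using * by (auto simp: bounded_cochain_def)
  qed
  define \<psi>' where "\<psi>' = (\<lambda>\<sigma>. ?\<psi> \<sigma> - cobd 1 \<phi>' \<sigma>)"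
  have "bounded_cochain 2 Y (cobd 1 \<phi>')" using b1 by (auto simp: bounded_cochain_def)
  then have "bounded_cochain 2 Y \<psi>'" unfolding \<psi>'_def by (rule bounded_cochain_diff [OF bd])
  moreover have "\<psi>' \<sigma> = 0" if \<sigma>: "singular_simplex 2 (subtopology Y A) \<sigma>" for \<sigma>
  proof -
    have "\<phi>' (singular_face 2 i \<sigma>) = \<phi> (singular_face 2 i \<sigma>)" if "i \<le> 2" for i
      using singular_simplex_singular_face [OF \<sigma>, of i] that by (simp add: \<phi>'_def)
    then have "cobd 1 \<phi>' \<sigma> = cobd 1 \<phi> \<sigma>" unfolding cobd_1 by simp
    then show ?thesis using \<phi>(2) [OF \<sigma>] by (simp add: \<psi>'_def)
  qed
  moreover have "cobd 2 \<psi>' \<sigma> = 0" if "singular_simplex (Suc 2) Y \<sigma>" for \<sigma>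
  proof -
    have "cobd 2 \<psi>' \<sigma> = cobd 2 ?\<psi> \<sigma> - cobd 2 (cobd 1 \<phi>') \<sigma>"
      unfolding cobd_2 \<psi>'_def by simp
    then show ?thesis using c0 [of \<sigma>] that cobd_cobd [of \<phi>' \<sigma>] by simp
  qed
  ultimately have "bcocycle 2 Y A \<psi>'" by (simp add: bcocycle_def)
  moreover have "bcohomologous 2 X {} (pullback 2 Inl \<psi>') \<psi>"
    unfolding bcohomologous_empty_iff
  proof (intro exI conjI allI impI)
    show "bounded_cochain 1 X (\<lambda>e. - pullback 1 Inl \<phi>' e)"
      by (intro bounded_cochain_uminus bounded_cochain_pullback [OF bphi Inl_continuous])
    fix \<sigma> assume \<sigma>: "singular_simplex 2 X \<sigma>"
    have "pullback 2 Inl \<psi>' \<sigma> = \<psi> \<sigma> - cobd 1 \<phi>' (simplex_map 2 Inl \<sigma>)"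
      by (simp add: pullback_def \<psi>'_def simplex_map_r_Inl [OF \<sigma>])
    moreover have "cobd 1 (\<lambda>e. - pullback 1 Inl \<phi>' e) \<sigma> = - cobd 1 (pullback 1 Inl \<phi>') \<sigma>"
      unfolding cobd_1 by simp
    ultimately show "pullback 2 Inl \<psi>' \<sigma> - \<psi> \<sigma> = cobd 1 (\<lambda>e. - pullback 1 Inl \<phi>' e) \<sigma>"
      unfolding cobd_1_pullback by simp
  qed
  ultimately show ?thesis by blast
qed

lemma continuous_map_contract_simplex:
  assumes "singular_simplex p Y \<sigma>"
  shows "continuous_map (top_of_set (standard_simplex p \<times> {0..1})) Y (\<lambda>(x, t). cyl_contract \<gamma> (\<sigma> x) t)"
proof -
  have c: "continuous_map (top_of_set (standard_simplex p)) Y \<sigma>"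
    using assms by (simp add: singular_simplex_iff_top_of_set)
  have "continuous_map (top_of_set (standard_simplex p \<times> {0..1})) (top_of_set {0..1}) (snd :: (nat \<Rightarrow> real) \<times> real \<Rightarrow> real)"
    by (auto simp: continuous_map_in_subtopology intro: continuous_on_snd)
  moreover have "continuous_map (top_of_set (standard_simplex p \<times> {0..1::real})) Y (\<lambda>w. \<sigma> (fst w))"
    by (rule continuous_map_compose_on [OF c]) (auto intro: continuous_on_fst)
  ultimately have "continuous_map (top_of_set (standard_simplex p \<times> {0..1})) (prod_topology Y (top_of_set {0..1::real}))
      (\<lambda>w. (\<sigma> (fst w), snd w))"
    by (simp add: continuous_map_pairwise o_def)
  from continuous_map_compose [OF this continuous_map_cyl_contract [OF \<gamma>]]
  show ?thesis by (simp add: o_def split_def)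
qed

lemma cyl_contract_0: "y \<in> topspace Y \<Longrightarrow> cyl_contract \<gamma> y 0 = y"
  by (auto simp: topspace_mapping_cylinder [OF \<gamma>] cyl_contract_def cyl_proj_def)

lemma cyl_contract_1: "cyl_contract \<gamma> y 1 = Inl (r y)"
  by (auto simp: cyl_contract_def cyl_proj_def cyl_retract_def split: sum.split)

text \<open>The contraction of the cylinder exhibits \<open>\<psi>'\<close> as the pullback of
  \<open>\<psi>\<close> along the retraction plus the coboundary of a bounded cochain. Pulling back
  does not enlarge the bound \<open>C\<close>, so the main estimate applies.\<close>

lemma abs_kronecker_le_sup:
  assumes z: "rrelcycle 2 Y A z" and \<psi>': "bcocycle 2 Y A \<psi>'"
    and h: "bcohomologous 2 X {} (pullback 2 Inl \<psi>') \<psi>"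
    and C: "\<And>\<sigma>. singular_simplex 2 X \<sigma> \<Longrightarrow> \<bar>\<psi> \<sigma>\<bar> \<le> C"
  shows "\<bar>kronecker z \<psi>'\<bar> \<le> C * l1norm z"
proof -
  obtain \<phi> where \<phi>: "bounded_cochain 1 X \<phi>"
    "\<And>\<sigma>. singular_simplex 2 X \<sigma> \<Longrightarrow> pullback 2 Inl \<psi>' \<sigma> - \<psi> \<sigma> = cobd 1 \<phi> \<sigma>"
    using h unfolding bcohomologous_empty_iff by blast
  define P where "P = (\<lambda>e. prism_cochain \<psi>' (\<lambda>x t. cyl_contract \<gamma> (e x) t))"
  have coc: "cobd 2 \<psi>' \<sigma> = 0" if "singular_simplex 3 Y \<sigma>" for \<sigma>
    using \<psi>' that by (simp add: bcocycle_def)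
  obtain B where B: "\<And>\<sigma>. singular_simplex 2 Y \<sigma> \<Longrightarrow> \<bar>\<psi>' \<sigma>\<bar> \<le> B"
    using \<psi>' by (auto simp: bcocycle_def bounded_cochain_def)
  have "\<bar>P e\<bar> \<le> 2 * B" if "singular_simplex 1 Y e" for e
    unfolding P_def by (rule abs_prism_cochain_le [OF B continuous_map_contract_simplex [OF that]])
  then have P: "bounded_cochain 1 Y P" by (auto simp: bounded_cochain_def)
  have bd: "bounded_cochain 1 Y (\<lambda>e. pullback 1 r \<phi> e - P e)"
    by (intro bounded_cochain_diff P bounded_cochain_pullback [OF \<phi>(1) r_continuous])
  obtain D where D: "\<And>e. singular_simplex 1 Y e \<Longrightarrow> \<bar>pullback 1 r \<phi> e - P e\<bar> \<le> D"
    using bd by (auto simp: bounded_cochain_def)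
  have eq: "\<psi>' \<sigma> = pullback 2 r \<psi> \<sigma> + cobd 1 (\<lambda>e. pullback 1 r \<phi> e - P e) \<sigma>"
    if \<sigma>: "singular_simplex 2 Y \<sigma>" for \<sigma>
  proof -
    let ?G = "\<lambda>x t. cyl_contract \<gamma> (\<sigma> x) t"
    have \<sigma>Y: "\<sigma> x \<in> topspace Y" if "x \<in> standard_simplex 2" for x
      using \<sigma> that unfolding singular_simplex_iff_top_of_set
      by (metis continuous_map_apply topspace_euclidean_subtopology)
    have 0: "pmap [(0,0),(1,0),(2,0)] ?G = \<sigma>"
      using \<sigma> by (intro pmap_level) (auto simp: cyl_contract_0 \<sigma>Y singular_simplex_def)
    have 1: "pmap [(0,1),(1,1),(2,1)] ?G = simplex_map 2 Inl (simplex_map 2 r \<sigma>)"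
      by (rule pmap_level) (simp_all add: cyl_contract_1 simplex_map_def)
    have face: "prism_cochain \<psi>' (\<lambda>x t. ?G (simplical_face i x) t) = P (singular_face 2 i \<sigma>)" for i
      unfolding P_def by (rule prism_cochain_cong) (simp add: singular_face_apply)
    have "\<psi>' (simplex_map 2 Inl (simplex_map 2 r \<sigma>)) - \<psi>' \<sigma> = cobd 1 P \<sigma>"
      using prism_identity [where \<psi> = \<psi>', OF coc continuous_map_contract_simplex [OF \<sigma>]]
      unfolding 0 1 face cobd_1 .
    moreover have "\<psi>' (simplex_map 2 Inl (simplex_map 2 r \<sigma>)) - \<psi> (simplex_map 2 r \<sigma>) = cobd 1 (pullback 1 r \<phi>) \<sigma>"
      using \<phi>(2) [OF singular_simplex_simplex_map [OF \<sigma> r_continuous]]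
      unfolding cobd_1_pullback by (simp only: pullback_def)
    ultimately show ?thesis unfolding pullback_def [of 2] cobd_1 by linarith
  qed
  have "\<bar>pullback 2 r \<psi> \<sigma>\<bar> \<le> C" if "singular_simplex 2 Y \<sigma>" for \<sigma>
    unfolding pullback_def by (rule C [OF singular_simplex_simplex_map [OF that r_continuous]])
  from abs_kronecker_le_of_cohomologous [OF z \<psi>' this D eq] show ?thesis .
qed

text \<open>Two admissible relative cocycles differ by one whose restriction to \<open>X\<close> is
  cohomologous to zero, and the estimate with \<open>C = 0\<close> makes their pairings with
  \<open>z\<close> equal.\<close>

lemma transported_pairing_eq:
  assumes z: "rrelcycle 2 Y A z" and \<psi>': "bcocycle 2 Y A \<psi>'"
    and h: "bcohomologous 2 X {} (pullback 2 Inl \<psi>') \<psi>"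
  shows "transported_pairing 2 Y A Inl X \<psi> z = kronecker z \<psi>'"
  unfolding transported_pairing_def
proof (rule the_equality)
  show "\<exists>\<psi>''. bcocycle 2 Y A \<psi>'' \<and> bcohomologous 2 X {} (pullback 2 Inl \<psi>'') \<psi> \<and> kronecker z \<psi>' = kronecker z \<psi>''"
    using assms by blast
  fix x assume "\<exists>\<psi>''. bcocycle 2 Y A \<psi>'' \<and> bcohomologous 2 X {} (pullback 2 Inl \<psi>'') \<psi> \<and> x = kronecker z \<psi>''"
  then obtain \<psi>'' where \<psi>'': "bcocycle 2 Y A \<psi>''" "bcohomologous 2 X {} (pullback 2 Inl \<psi>'') \<psi>" "x = kronecker z \<psi>''"
    by blast
  have "bcohomologous 2 X {} (\<lambda>\<sigma>. pullback 2 Inl \<psi>'' \<sigma> - pullback 2 Inl \<psi>' \<sigma>) (\<lambda>_. 0)"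
    by (rule bcohomologous_diff [OF \<psi>''(2) h])
  then have d: "bcohomologous 2 X {} (pullback 2 Inl (\<lambda>\<sigma>. \<psi>'' \<sigma> - \<psi>' \<sigma>)) (\<lambda>_. 0)"
    by (simp add: pullback_def)
  have "\<bar>kronecker z (\<lambda>\<sigma>. \<psi>'' \<sigma> - \<psi>' \<sigma>)\<bar> \<le> 0 * l1norm z"
    by (rule abs_kronecker_le_sup [OF z bcocycle_diff [OF \<psi>''(1) \<psi>'] d]) simp
  then show "x = kronecker z \<psi>'" unfolding \<psi>''(3) kronecker_diff_right by simp
qed

end

text \<open>The infima are brought in one factor at a time by division; a factor 0 has to be treated
  apart, and there \<open>a \<le> 0\<close> suffices.\<close>

lemma le_mult_Inf:
  fixes M L :: "real set"
  assumes "M \<noteq> {}" "L \<noteq> {}" "\<And>m. m \<in> M \<Longrightarrow> 0 \<le> m" "\<And>l. l \<in> L \<Longrightarrow> 0 \<le> l"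
    and "\<And>m l. \<lbrakk>m \<in> M; l \<in> L\<rbrakk> \<Longrightarrow> a \<le> m * l"
  shows "a \<le> Inf M * Inf L"
proof -
  have *: "a \<le> m * Inf L'" if "0 \<le> m" "L' \<noteq> {}" "\<And>l. l \<in> L' \<Longrightarrow> a \<le> m * l" for m :: real and L' :: "real set"
  proof (cases "m = 0")
    case True
    then show ?thesis using that by auto
  next
    case False
    then have m: "m > 0" using that(1) by simp
    have "a / m \<le> Inf L'" using that(2,3) m by (intro cInf_greatest) (auto simp: field_simps)
    then show ?thesis using m by (simp add: field_simps)
  qed
  have "0 \<le> Inf L" using assms(2,4) by (rule cInf_greatest)
  moreover have "a \<le> m * Inf L" if "m \<in> M" for m
    using assms that by (intro *) auto
  ultimately have "a \<le> Inf L * Inf M" using assms(1) by (intro *) (auto simp: mult.commute)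
  then show ?thesis by (simp add: mult.commute)
qed

lemma singular_simplex_set_nonempty:
  assumes "topspace X \<noteq> {}"
  shows "singular_simplex_set p X \<noteq> {}"
proof -
  obtain x where "x \<in> topspace X" using assms by blast
  then have "singular_simplex p X (restrict (\<lambda>_. x) (standard_simplex p))"
    by (simp add: singular_simplex_def)
  then show ?thesis by blast
qed

lemma le_sup_cocycle:
  assumes "bcocycle 2 X {} \<psi>" "singular_simplex 2 X \<sigma>"
  shows "\<bar>\<psi> \<sigma>\<bar> \<le> (SUP \<sigma>\<in>singular_simplex_set 2 X. \<bar>\<psi> \<sigma>\<bar>)"
proof (rule cSUP_upper)
  show "\<sigma> \<in> singular_simplex_set 2 X" using assms(2) by simp
  show "bdd_above ((\<lambda>\<sigma>. \<bar>\<psi> \<sigma>\<bar>) ` singular_simplex_set 2 X)"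
    using assms(1) unfolding bcocycle_empty_iff bounded_cochain_def by (auto intro: bdd_aboveI2)
qed

lemma sup_cocycle_nonneg:
  assumes "bcocycle 2 X {} \<psi>" "topspace X \<noteq> {}"
  shows "0 \<le> (SUP \<sigma>\<in>singular_simplex_set 2 X. \<bar>\<psi> \<sigma>\<bar>)"
proof -
  obtain \<sigma> where "singular_simplex 2 X \<sigma>" using singular_simplex_set_nonempty [OF assms(2), of 2] by blast
  then show ?thesis using le_sup_cocycle [OF assms(1)] abs_ge_zero order_trans by blast
qed

section \<open>The duality formula\<close>

context cylinder
begin

text \<open>The pairing is unchanged when \<open>\<psi>\<close> or \<open>z\<close> is replaced by
  another representative, so the estimate holds for every pair of representatives and passes to both
  infima.\<close>

lemma abs_pairing_le:
  assumes z: "rrelcycle 2 Y A z" and \<psi>: "bcocycle 2 X {} \<psi>" and X: "topspace X \<noteq> {}"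
  shows "\<bar>transported_pairing 2 Y A Inl X \<psi> z\<bar> \<le> binfnorm 2 X \<psi> * gromov_norm 2 Y A z"
    and "0 \<le> binfnorm 2 X \<psi>"
proof -
  let ?sup = "\<lambda>\<psi>'. SUP \<sigma>\<in>singular_simplex_set 2 X. \<bar>\<psi>' \<sigma>\<bar>"
  let ?M = "{?sup \<psi>' | \<psi>'. bcocycle 2 X {} \<psi>' \<and> bcohomologous 2 X {} \<psi> \<psi>'}"
  let ?L = "{l1norm c | c. rrelcycle 2 Y A c \<and> rhomologous 2 Y A c z}"
  obtain \<psi>' where \<psi>': "bcocycle 2 Y A \<psi>'" "bcohomologous 2 X {} (pullback 2 Inl \<psi>') \<psi>"
    using relative_representative_exists [OF \<psi>] by blast
  have nonneg: "0 \<le> m" if "m \<in> ?M" for m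
    using that sup_cocycle_nonneg [OF _ X] by blast
  have M: "?M \<noteq> {}" using \<psi> bcohomologous_refl by blast
  have L: "?L \<noteq> {}" using z rhomologous_refl by blast
  show "0 \<le> binfnorm 2 X \<psi>" unfolding binfnorm_def using M nonneg by (rule cInf_greatest)
  have "\<bar>kronecker z \<psi>'\<bar> \<le> Inf ?M * Inf ?L"
  proof (rule le_mult_Inf [OF M L nonneg])
    show "0 \<le> l" if "l \<in> ?L" for l using that l1norm_nonneg by auto
    fix m l assume "m \<in> ?M" "l \<in> ?L"
    then obtain \<psi>0 c where \<psi>0: "m = ?sup \<psi>0" "bcocycle 2 X {} \<psi>0" "bcohomologous 2 X {} \<psi> \<psi>0"
      and c: "l = l1norm c" "rrelcycle 2 Y A c" "rhomologous 2 Y A c z" by blast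
    have "kronecker z \<psi>' = kronecker c \<psi>'"
      using kronecker_bcocycle_homologous [OF \<psi>'(1) _ _ c(3)] c(2) z by (simp add: rrelcycle_def)
    moreover have "\<bar>kronecker c \<psi>'\<bar> \<le> ?sup \<psi>0 * l1norm c"
      by (rule abs_kronecker_le_sup [OF c(2) \<psi>'(1) bcohomologous_trans [OF \<psi>'(2) \<psi>0(3)] le_sup_cocycle [OF \<psi>0(2)]])
    ultimately show "\<bar>kronecker z \<psi>'\<bar> \<le> m * l" using \<psi>0(1) c(1) by simp
  qed
  then show "\<bar>transported_pairing 2 Y A Inl X \<psi> z\<bar> \<le> binfnorm 2 X \<psi> * gromov_norm 2 Y A z"
    unfolding transported_pairing_eq [OF z \<psi>'] binfnorm_def gromov_norm_def .
qed

theorem gromov_norm_duality: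
  assumes z: "rrelcycle 2 Y A z"
  defines "S \<equiv> {transported_pairing 2 Y A Inl X \<psi> z / binfnorm 2 X \<psi> | \<psi>.
      bcocycle 2 X {} \<psi> \<and> \<not> bcohomologous 2 X {} \<psi> (\<lambda>_. 0)}"
  shows "gromov_norm 2 Y A z = (if S = {} then 0 else Sup S)"
proof -
  let ?n = "gromov_norm 2 Y A z"
  obtain \<psi>' where \<psi>': "bcocycle 2 Y A \<psi>'" "\<And>\<sigma>. singular_simplex 2 Y \<sigma> \<Longrightarrow> \<bar>\<psi>' \<sigma>\<bar> \<le> 1"
    "kronecker z \<psi>' = ?n" by (rule norm_attaining_cocycle [OF z]) (rule that)
  have n0: "0 \<le> ?n"
  proof -
    have "{l1norm c | c. rrelcycle 2 Y A c \<and> rhomologous 2 Y A c z} \<noteq> {}" using z rhomologous_refl by blast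
    then show ?thesis unfolding gromov_norm_def by (rule cInf_greatest) (auto intro: l1norm_nonneg)
  qed
  define u where "u = pullback 2 Inl \<psi>'"
  have u: "bcocycle 2 X {} u" unfolding u_def by (rule bcocycle_pullback [OF \<psi>'(1) Inl_continuous])
  have pair: "transported_pairing 2 Y A Inl X u z = ?n"
    using transported_pairing_eq [OF z \<psi>'(1) bcohomologous_refl] unfolding u_def \<psi>'(3) .
  \<comment> \<open>If \<open>u\<close> were cohomologous to zero, the estimate with
    \<open>C = 0\<close> would make its pairing with \<open>z\<close>, which is the norm,
    vanish.\<close>
  have nontrivial: "\<not> bcohomologous 2 X {} u (\<lambda>_. 0)" if "?n > 0"
  proof
    assume "bcohomologous 2 X {} u (\<lambda>_. 0)"
    then have "\<bar>kronecker z \<psi>'\<bar> \<le> 0 * l1norm z"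
      unfolding u_def by (rule abs_kronecker_le_sup [OF z \<psi>'(1)]) simp
    then show False using \<psi>'(3) that by simp
  qed
  show ?thesis
  proof (cases "S = {}")
    case True
    then have "\<not> ?n > 0" using u nontrivial unfolding S_def by blast
    then show ?thesis using True n0 by simp
  next
    case False
    \<comment> \<open>A nonempty base is needed because the supremum over an empty set of simplices
      has no useful value; over an empty base all classes are trivial and \<open>S\<close> is
      empty.\<close>
    have X: "topspace X \<noteq> {}"
    proof
      assume "topspace X = {}"
      then have "\<not> singular_simplex p X \<sigma>" for p \<sigma> by (rule singular_simplex_empty)
      then have "bcohomologous 2 X {} \<psi> (\<lambda>_. 0)" for \<psi>
        unfolding bcohomologous_empty_iff by (auto simp: bounded_cochain_def)
      then show False using False unfolding S_def by blast
    qed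
    have le: "s \<le> ?n" and zero: "?n = 0 \<Longrightarrow> s = 0" if sS: "s \<in> S" for s
    proof -
      obtain \<psi> where s: "s = transported_pairing 2 Y A Inl X \<psi> z / binfnorm 2 X \<psi>" and \<psi>: "bcocycle 2 X {} \<psi>"
        using sS unfolding S_def by blast
      note b = abs_pairing_le [OF z \<psi> X]
      show "s \<le> ?n"
      \<comment> \<open>For a class of seminorm zero the quotient is 0 by the convention for
        division, which respects the bound.\<close>
      proof (cases "binfnorm 2 X \<psi> = 0")
        case True
        then show ?thesis using n0 s by simp
      next
        case False
        then have "binfnorm 2 X \<psi> > 0" using b(2) by simp
        moreover have "transported_pairing 2 Y A Inl X \<psi> z \<le> binfnorm 2 X \<psi> * ?n" using b(1) by linarith
        ultimately show ?thesis unfolding s by (simp add: pos_divide_le_eq mult.commute)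
      qed
      show "s = 0" if "?n = 0" using b(1) that s by simp
    qed
    have bdd: "bdd_above S" using le by (rule bdd_aboveI)
    have "Sup S \<le> ?n" using False le by (rule cSup_least)
    moreover have "?n \<le> Sup S"
    proof (cases "?n = 0")
      \<comment> \<open>All members of \<open>S\<close> are 0 in this case, but one of them is
        needed to bound \<open>Sup S\<close> from below.\<close>
      case True
      obtain s where s: "s \<in> S" using False by blast
      have "s \<le> Sup S" by (rule cSup_upper [OF s bdd])
      then show ?thesis using zero [OF s True] True by simp
    next
      case False
      then have pos: "?n > 0" using n0 by simp
      note b = abs_pairing_le [OF z u X]
      have b0: "binfnorm 2 X u > 0"
      proof (rule ccontr)
        assume "\<not> binfnorm 2 X u > 0"
        then have "binfnorm 2 X u = 0" using b(2) by simp
        then show False using b(1) pair pos by simp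
      qed
      have b1: "binfnorm 2 X u \<le> 1"
      proof -
        let ?sup = "\<lambda>\<psi>'. SUP \<sigma>\<in>singular_simplex_set 2 X. \<bar>\<psi>' \<sigma>\<bar>"
        have "binfnorm 2 X u \<le> ?sup u"
          unfolding binfnorm_def
        proof (rule cInf_lower)
          show "bdd_below {?sup \<psi>' | \<psi>'. bcocycle 2 X {} \<psi>' \<and> bcohomologous 2 X {} u \<psi>'}"
            using sup_cocycle_nonneg [OF _ X] by (intro bdd_belowI [of _ 0]) blast
        qed (use u bcohomologous_refl in blast)
        also have "\<dots> \<le> 1"
        proof (rule cSUP_least [OF singular_simplex_set_nonempty [OF X]])
          fix \<sigma> assume "\<sigma> \<in> singular_simplex_set 2 X"
          then show "\<bar>u \<sigma>\<bar> \<le> 1"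
            unfolding u_def pullback_def by (intro \<psi>'(2) singular_simplex_simplex_map [OF _ Inl_continuous]) simp
        qed
        finally show ?thesis .
      qed
      \<comment> \<open>The seminorm of \<open>u\<close> is at most 1, so dividing by it can only
        increase the value.\<close>
      have "?n \<le> ?n / binfnorm 2 X u"
        using b0 b1 pos by (simp add: le_divide_eq mult_le_cancel_left1)
      also have "\<dots> \<le> Sup S"
      proof (rule cSup_upper [OF _ bdd])
        show "?n / binfnorm 2 X u \<in> S"
          unfolding S_def mem_Collect_eq using u nontrivial [OF pos] pair by (intro exI [of _ u]) simp
      qed
      finally show ?thesis .
    qed
    ultimately show ?thesis using False by simp
  qed
qed

end

theorem theoremB:
  fixes X :: "'a topology" and k :: nat and \<gamma> :: "nat \<times> (nat \<Rightarrow> real) \<Rightarrow> 'a"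
    and z :: "('a + (nat \<times> (nat \<Rightarrow> real)) \<times> real) ssimplex \<Rightarrow> real"
  assumes "countable_cw_complex X"
    and "continuous_map (circles k) X \<gamma>"
    and "rrelcycle 2 (mapping_cylinder X k \<gamma>) (cyl_end k) z"
  shows "let S = {transported_pairing 2 (mapping_cylinder X k \<gamma>) (cyl_end k) Inl X \<psi> z
                    / binfnorm 2 X \<psi> | \<psi>. bcocycle 2 X {} \<psi> \<and> \<not> bcohomologous 2 X {} \<psi> (\<lambda>_. 0)}
         in gromov_norm 2 (mapping_cylinder X k \<gamma>) (cyl_end k) z = (if S = {} then 0 else Sup S)"
proof -
  interpret cylinder X k \<gamma> by unfold_locales (rule assms(2))
  show ?thesis unfolding Let_def by (rule gromov_norm_duality [OF assms(3)])
qed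

end
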